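(* Let $u$ be a blow-up (non-global) solution of $\partial_t^2u=\partial_x^2u+e^u$ with initial data $(u_0,u_1)\in H^1_{loc,u}(\mathbb R)\times L^2_{loc,u}(\mathbb R)$, with maximal domain of definition $D=\{(x,t): 0\le t<T(x)\}$ and blow-up graph $\Gamma=\{(x,T(x)):x\in\mathbb R\}$. For any $R>0$ there exists $C=C(R)>0$ such that: (i) (Upper bound on $u$) For all $(x,t)\in D\cap D_R$, $$e^{u(x,t)}\,d((x,t),\Gamma)^2\le C.$$ (ii) (Lower bound on $u$) If in addition $(u_0,u_1)\in W^{1,\infty}(\mathbb R)\times L^\infty(\mathbb R)$ and $x$ is a non-characteristic point, then for all $(x,t)\in D\cap\overline{D_R}$, $$e^{u(x,t)}\,d((x,t),\Gamma)^2\ge\frac1C.$$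
   Context: $L^2_{loc,u}(\mathbb R)$ is the space of $v$ with $\sup_{a\in\mathbb R}\int_{a-1}^{a+1}v^2\,dx<\infty$, and $H^1_{loc,u}(\mathbb R)=\{v: v,v'\in L^2_{loc,u}(\mathbb R)\}$. For $x\in\mathbb R$, $t>0$, $\delta>0$, let $\mathcal C_{x,t,\delta}=\{(\xi,\tau)\ne(x,t): 0\le\tau\le t-\delta|\xi-x|\}$. A solution on $\mathcal C_{x_0,t_0,1}$ is a function $u$ with $(u,\partial_tu)\in C([0,t_0),H^1\times L^2(|x-x_0|<t_0-t))$ satisfying Duhamel's formula $u(x,t)=\frac12(u_0(x-t)+u_0(x+t))+\frac12\int_{x-t}^{x+t}u_1+\frac12\int_0^t\int_{x-t+\tau}^{x+t-\tau}e^{u(z,\tau)}dz\,d\tau$. The maximal domain of definition $D$ is the set of $(x,t)$, $t\ge0$, such that the solution exists on $\mathcal C_{x,t',1}$ for some $t'>t$. The solution is a blow-up solution if it is not global; then $D=\{(x,t):0\le t<T(x)\}$ for a 1-Lipschitz function $T:\mathbb R\to(0,\infty)$, and $\Gamma$ is the graph of $T$. A point $x_0\in\mathbb R$ is non-characteristic if there is $\delta_0=\delta_0(x_0)\in(0,1)$ such that $u$ is defined on $\mathcal C_{x_0,T(x_0),\delta_0}$ (i.e. this cone is contained in $D$). $d((x,t),\Gamma)$ is the Euclidean distance from $(x,t)$ to $\Gamma$; $D_R=\{(x,t)\in\mathbb R\times\mathbb R_+: |x|<R-t\}$. The constant $C(R)$ may also depend on the initial data. *)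

theory Defs
  imports "HOL-Analysis.Analysis"
begin

definition test_function :: "real set \<Rightarrow> (real \<Rightarrow> real) \<Rightarrow> bool" where
  "test_function S \<phi> \<longleftrightarrow>
     (\<forall>n x. (deriv ^^ n) \<phi> differentiable (at x)) \<and>
     compact (closure {x. \<phi> x \<noteq> 0}) \<and> closure {x. \<phi> x \<noteq> 0} \<subseteq> S"

text \<open>Distributional derivative on an open set. It is only applied to functions that are locally
  integrable on that set, so that both integrals exist.\<close>

definition weak_deriv_on :: "real set \<Rightarrow> (real \<Rightarrow> real) \<Rightarrow> (real \<Rightarrow> real) \<Rightarrow> bool" where
  "weak_deriv_on S v w \<longleftrightarrow>
     (\<forall>\<phi>. test_function S \<phi> \<longrightarrow>
        (LINT x:S|lebesgue. v x * deriv \<phi> x) = - (LINT x:S|lebesgue. w x * \<phi> x))"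

definition L2_sq :: "real set \<Rightarrow> (real \<Rightarrow> real) \<Rightarrow> ennreal" where
  "L2_sq S f = (\<integral>\<^sup>+x\<in>S. ennreal ((f x)\<^sup>2) \<partial>lebesgue)"

definition L2_on :: "real set \<Rightarrow> (real \<Rightarrow> real) \<Rightarrow> bool" where
  "L2_on S f \<longleftrightarrow> set_borel_measurable lebesgue S f \<and> L2_sq S f < \<infinity>"

definition L2_locu :: "(real \<Rightarrow> real) \<Rightarrow> bool" where
  "L2_locu v \<longleftrightarrow> v \<in> borel_measurable lebesgue \<and> (SUP a. L2_sq {a - 1..a + 1} v) < \<infinity>"

definition H1_locu :: "(real \<Rightarrow> real) \<Rightarrow> bool" where
  "H1_locu v \<longleftrightarrow> L2_locu v \<and> (\<exists>v'. weak_deriv_on UNIV v v' \<and> L2_locu v')"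

definition L_inf :: "(real \<Rightarrow> real) \<Rightarrow> bool" where
  "L_inf v \<longleftrightarrow> v \<in> borel_measurable lebesgue \<and> (\<exists>M. AE x in lebesgue. \<bar>v x\<bar> \<le> M)"

definition W1_inf :: "(real \<Rightarrow> real) \<Rightarrow> bool" where
  "W1_inf v \<longleftrightarrow> L_inf v \<and> (\<exists>v'. weak_deriv_on UNIV v v' \<and> L_inf v')"

definition cone :: "real \<Rightarrow> real \<Rightarrow> real \<Rightarrow> (real \<times> real) set" where
  "cone x t \<delta> = {(\<xi>, \<tau>). (\<xi>, \<tau>) \<noteq> (x, t) \<and> 0 \<le> \<tau> \<and> \<tau> \<le> t - \<delta> * \<bar>\<xi> - x\<bar>}"

text \<open>Functions of space and time are curried, with the space variable first.
  The space \<open>C([0,t0), L2(\<bar>x - x0\<bar> < t0 - t))\<close> has a domain that shrinks with time. Membership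
  means that every slice is square integrable on its own interval and that, for each \<open>s < t0\<close>,
  the restriction to times in \<open>[0,s]\<close> is continuous with values in \<open>L2\<close> of the interval at time
  \<open>s\<close>, which is contained in all the earlier ones.\<close>

definition C_L2 :: "real \<Rightarrow> real \<Rightarrow> (real \<Rightarrow> real \<Rightarrow> real) \<Rightarrow> bool" where
  "C_L2 x0 t0 f \<longleftrightarrow>
     (\<forall>t\<in>{0..<t0}. L2_on (ball x0 (t0 - t)) (\<lambda>x. f x t)) \<and>
     (\<forall>s\<in>{0..<t0}. \<forall>t\<in>{0..s}.
        ((\<lambda>\<tau>. L2_sq (ball x0 (t0 - s)) (\<lambda>x. f x \<tau> - f x t)) \<longlongrightarrow> 0) (at t within {0..s}))"

definition C_H1 :: "real \<Rightarrow> real \<Rightarrow> (real \<Rightarrow> real \<Rightarrow> real) \<Rightarrow> bool" where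
  "C_H1 x0 t0 f \<longleftrightarrow> C_L2 x0 t0 f \<and>
     (\<exists>fx. (\<forall>t\<in>{0..<t0}. weak_deriv_on (ball x0 (t0 - t)) (\<lambda>x. f x t) (\<lambda>x. fx x t)) \<and>
           C_L2 x0 t0 fx)"

text \<open>The time derivative is that of the \<open>L2\<close>-valued function of time (one-sided at the ends of
  \<open>[0,s]\<close>).\<close>

definition L2_time_deriv ::
    "real \<Rightarrow> real \<Rightarrow> (real \<Rightarrow> real \<Rightarrow> real) \<Rightarrow> (real \<Rightarrow> real \<Rightarrow> real) \<Rightarrow> bool" where
  "L2_time_deriv x0 t0 f ft \<longleftrightarrow>
     (\<forall>s\<in>{0..<t0}. \<forall>t\<in>{0..s}.
        ((\<lambda>\<tau>. L2_sq (ball x0 (t0 - s)) (\<lambda>x. (f x \<tau> - f x t) / (\<tau> - t) - ft x t)) \<longlongrightarrow> 0)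
          (at t within {0..s}))"

definition duhamel ::
    "(real \<Rightarrow> real) \<Rightarrow> (real \<Rightarrow> real) \<Rightarrow> (real \<Rightarrow> real \<Rightarrow> real) \<Rightarrow> real \<Rightarrow> real \<Rightarrow> bool" where
  "duhamel u0 u1 u x t \<longleftrightarrow>
     u x t = (u0 (x - t) + u0 (x + t)) / 2
       + (LINT y:{x - t..x + t}|lebesgue. u1 y) / 2
       + (LINT \<tau>:{0..t}|lebesgue. (LINT z:{x - t + \<tau>..x + t - \<tau>}|lebesgue. exp (u z \<tau>))) / 2"

text \<open>The solution is taken on the slices \<open>\<bar>x - x0\<bar> < t0 - t\<close> of \<open>cone x0 t0 1\<close>. For a point
  \<open>(x,t)\<close> in such a slice the regularity makes \<open>exp u\<close> integrable over its backward light cone.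
  Duhamel's formula is required at every point and not only almost everywhere, so it also
  fixes the pointwise values of \<open>u\<close>.\<close>

definition solution_on_cone ::
    "(real \<Rightarrow> real) \<Rightarrow> (real \<Rightarrow> real) \<Rightarrow> (real \<Rightarrow> real \<Rightarrow> real) \<Rightarrow> real \<Rightarrow> real \<Rightarrow> bool" where
  "solution_on_cone u0 u1 u x0 t0 \<longleftrightarrow>
     C_H1 x0 t0 u \<and>
     (\<exists>ut. L2_time_deriv x0 t0 u ut \<and> C_L2 x0 t0 ut) \<and>
     (\<forall>t\<in>{0..<t0}. \<forall>x\<in>ball x0 (t0 - t). duhamel u0 u1 u x t)"

definition max_domain :: "(real \<Rightarrow> real) \<Rightarrow> (real \<Rightarrow> real) \<Rightarrow> (real \<times> real) set" where
  "max_domain u0 u1 = {(x, t). 0 \<le> t \<and> (\<exists>t'>t. \<exists>u. solution_on_cone u0 u1 u x t')}"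

text \<open>A single function that is the solution on the whole maximal domain; its values off that
  domain are irrelevant.\<close>

definition maximal_solution ::
    "(real \<Rightarrow> real) \<Rightarrow> (real \<Rightarrow> real) \<Rightarrow> (real \<Rightarrow> real \<Rightarrow> real) \<Rightarrow> bool" where
  "maximal_solution u0 u1 u \<longleftrightarrow>
     (\<forall>(x, t)\<in>max_domain u0 u1. \<exists>t'>t. solution_on_cone u0 u1 u x t')"

definition blowup_solution ::
    "(real \<Rightarrow> real) \<Rightarrow> (real \<Rightarrow> real) \<Rightarrow> (real \<Rightarrow> real \<Rightarrow> real) \<Rightarrow> bool" where
  "blowup_solution u0 u1 u \<longleftrightarrow>
     maximal_solution u0 u1 u \<and> max_domain u0 u1 \<noteq> UNIV \<times> {0..}"

text \<open>The function \<open>T\<close> with \<open>max_domain u0 u1 = {(x, t). 0 \<le> t \<and> t < T x}\<close>, meaningful when the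
  maximal domain is not the whole half-plane.\<close>

definition blowup_time :: "(real \<Rightarrow> real) \<Rightarrow> (real \<Rightarrow> real) \<Rightarrow> real \<Rightarrow> real" where
  "blowup_time u0 u1 x = Sup {t. (x, t) \<in> max_domain u0 u1}"

definition blowup_graph :: "(real \<Rightarrow> real) \<Rightarrow> (real \<Rightarrow> real) \<Rightarrow> (real \<times> real) set" where
  "blowup_graph u0 u1 = {(x, blowup_time u0 u1 x) | x. True}"

definition non_characteristic :: "(real \<Rightarrow> real) \<Rightarrow> (real \<Rightarrow> real) \<Rightarrow> real \<Rightarrow> bool" where
  "non_characteristic u0 u1 x0 \<longleftrightarrow>
     (\<exists>\<delta>0. 0 < \<delta>0 \<and> \<delta>0 < 1 \<and> cone x0 (blowup_time u0 u1 x0) \<delta>0 \<subseteq> max_domain u0 u1)"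

definition D_R :: "real \<Rightarrow> (real \<times> real) set" where
  "D_R R = {(x, t). 0 \<le> t \<and> \<bar>x\<bar> < R - t}"

end

theory Submission
  imports Defs
begin

text \<open>
  Write \<open>u = A (x + t) + B (x - t) + N\<close>, where \<open>2 N\<close> is the integral of \<open>exp u\<close> over the backward light cone.
  The Sobolev regularity bounds \<open>u\<close> on compact parts of the slices, hence \<open>N\<close> and then \<open>u\<close> are
  continuous on the maximal domain.

  Upper bound: on the forward light cone of \<open>(x, t)\<close>, \<open>u\<close> is at least \<open>m = u x t - O(1)\<close>. If
  \<open>u \<ge> m + n\<close> on the forward light cone of \<open>(x, s)\<close>, the source term makes \<open>u \<ge> m + n + 1\<close> on that of
  \<open>(x, s + 4 exp (- n / 4) exp (- m / 2))\<close>. These steps are summable, so that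
  \<open>T x - t \<le> C exp (- u x t / 2)\<close>.

  Lower bound: the equation for \<open>N\<close> is Liouville's, and \<open>\<psi> = exp (- N / 2)\<close> solves a linear system along null
  lines. This makes \<open>\<psi>\<close> Lipschitz continuous up to the blow-up graph, with a constant that depends on
  \<open>A\<close> and \<open>B\<close> only. If \<open>\<psi>\<close> did not tend to 0 at \<open>(x, T x)\<close> for a non-characteristic \<open>x\<close>, then \<open>u\<close>
  would be bounded on the light cone of that point and would agree there with the global solution of the equation with
  truncated nonlinearity, which solves the original equation on a larger cone. Hence
  \<open>\<psi> \<le> C (T x - t)\<close>.
\<close>

section \<open>Smooth bump functions\<close>

text \<open>Both bounds are estimates in terms of \<open>T x - t\<close>: the distance to the graph
  is at most \<open>T x - t\<close>, and at least half of it because the open light cone below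
  \<open>(x, T x)\<close> belongs to the maximal domain. The main obstacle is the contradiction in
  the lower bound. By the definition of \<open>max_domain\<close> it takes a function with the full
  regularity of \<open>solution_on_cone\<close> on a larger cone, and the fixed point of the
  truncated equation is at first only continuous. Its Duhamel part is continuously differentiable,
  so the two free waves remain. For data in \<open>W1_inf\<close> and \<open>L_inf\<close> they are
  primitives of bounded functions, and boundedness reduces convergence in L2 to convergence in L1,
  where density of continuous functions suffices. Being non-characteristic enters through one fact:
  the closed light cone below \<open>(x, T x)\<close>, without its tip, lies in the domain, so that
  \<open>u\<close> can be unbounded on it only near the tip. Test functions serve two purposes: to
  bound the slices of \<open>u\<close> almost everywhere, and to identify \<open>u0\<close> as the
  primitive of its weak derivative.\<close>

definition smooth :: "(real \<Rightarrow> real) \<Rightarrow> bool" where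
  "smooth f \<longleftrightarrow> (\<forall>n x. (deriv ^^ n) f differentiable (at x))"

text \<open>Iterated derivatives rarely have a usable closed form. In a class where every member has
  a derivative again in the class, all of them exist by induction on the order.\<close>

lemma smooth_coinduct:
  assumes "f \<in> S"
    and "\<And>g. g \<in> S \<Longrightarrow> \<exists>g'\<in>S. \<forall>x. (g has_real_derivative g' x) (at x)"
  shows "smooth f"
proof -
  have step: "deriv g \<in> S \<and> (\<forall>x. (g has_real_derivative deriv g x) (at x))" if g: "g \<in> S" for g
  proof -
    obtain g' where g': "g' \<in> S" "\<And>x. (g has_real_derivative g' x) (at x)"
      using assms(2)[OF g] by blast
    then have "deriv g = g'" by (auto intro!: ext DERIV_imp_deriv)
    with g' show ?thesis by simp
  qed
  have "(deriv ^^ n) f \<in> S" for n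
    by (induction n) (use assms(1) step in auto)
  then show ?thesis
    unfolding smooth_def by (meson step real_differentiable_def)
qed

lemma smooth_DERIV: "smooth f \<Longrightarrow> (f has_real_derivative deriv f x) (at x)"
  unfolding smooth_def
  by (metis DERIV_imp_deriv funpow_0 real_differentiable_def)

lemma smooth_deriv: "smooth f \<Longrightarrow> smooth (deriv f)"
  unfolding smooth_def by (metis comp_apply funpow_Suc_right)

lemma smoothI:
  assumes "\<And>x. (f has_real_derivative f' x) (at x)" "smooth f'"
  shows "smooth f"
proof (rule smooth_coinduct[of f "insert f {g. smooth g}"])
  fix g assume "g \<in> insert f {g. smooth g}"
  then show "\<exists>g'\<in>insert f {g. smooth g}. \<forall>x. (g has_real_derivative g' x) (at x)"
    using assms smooth_DERIV[of g] smooth_deriv[of g] by (cases "g = f") auto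
qed auto

lemma smooth_cont: "smooth f \<Longrightarrow> continuous_on S f"
  by (meson smooth_DERIV DERIV_isCont continuous_at_imp_continuous_on)

lemma smooth_affine:
  assumes "smooth f" shows "smooth (\<lambda>x. k * f (c * x + d))"
proof (rule smooth_coinduct[where S = "{h. \<exists>k f. smooth f \<and> h = (\<lambda>x. k * f (c * x + d))}"])
  fix h assume "h \<in> {h. \<exists>k f. smooth f \<and> h = (\<lambda>x. k * f (c * x + d))}"
  then obtain k f where f: "smooth f" "h = (\<lambda>x. k * f (c * x + d))" by auto
  have "(h has_real_derivative (k * c) * deriv f (c * x + d)) (at x)" for x
    unfolding f by (rule derivative_eq_intros DERIV_chain2[OF smooth_DERIV[OF f(1)]] refl | simp)+
  then show "\<exists>g'\<in>{h. \<exists>k f. smooth f \<and> h = (\<lambda>x. k * f (c * x + d))}. \<forall>x. (h has_real_derivative g' x) (at x)"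
    using smooth_deriv[OF f(1)]
    by (intro bexI[where x="\<lambda>x. (k * c) * deriv f (c * x + d)"]) auto
qed (use assms in auto)

text \<open>The derivative of a product is a sum of two products. Products alone therefore do not
  form a class for \<open>smooth_coinduct\<close>, but their sums do.\<close>

inductive_set sums_of_products :: "(real \<Rightarrow> real) set" where
  "smooth f \<Longrightarrow> smooth g \<Longrightarrow> (\<lambda>x. f x * g x) \<in> sums_of_products"
| "f \<in> sums_of_products \<Longrightarrow> g \<in> sums_of_products \<Longrightarrow> (\<lambda>x. f x + g x) \<in> sums_of_products"

lemma sums_of_products_deriv:
  "f \<in> sums_of_products \<Longrightarrow> \<exists>g'\<in>sums_of_products. \<forall>x. (f has_real_derivative g' x) (at x)"
proof (induction rule: sums_of_products.induct)
  case (1 f g)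
  show ?case
  proof (intro bexI allI)
    show "((\<lambda>x. f x * g x) has_real_derivative deriv f x * g x + f x * deriv g x) (at x)" for x
      using 1 by (auto intro!: derivative_eq_intros smooth_DERIV)
    show "(\<lambda>x. deriv f x * g x + f x * deriv g x) \<in> sums_of_products"
      by (intro sums_of_products.intros 1 smooth_deriv)
  qed
next
  case (2 f g)
  then show ?case
    by (metis (mono_tags, lifting) DERIV_add sums_of_products.intros(2))
qed

lemma smooth_sums_of_products: "f \<in> sums_of_products \<Longrightarrow> smooth f"
  by (rule smooth_coinduct[OF _ sums_of_products_deriv])

lemma smooth_mult: "smooth f \<Longrightarrow> smooth g \<Longrightarrow> smooth (\<lambda>x. f x * g x)"
  by (rule smooth_sums_of_products) (rule sums_of_products.intros)

lemma smooth_const: "smooth (\<lambda>x. c)"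
  by (rule smooth_coinduct[of _ "range (\<lambda>c x. c)"]) (auto intro: derivative_eq_intros)

lemma smooth_add: assumes "smooth f" "smooth g" shows "smooth (\<lambda>x. f x + g x)"
proof -
  have "(\<lambda>x. f x * 1 + g x * 1) \<in> sums_of_products"
    by (intro sums_of_products.intros assms smooth_const)
  then show ?thesis using smooth_sums_of_products by simp
qed

text \<open>With \<open>y = 1/x\<close> the chain rule turns \<open>p\<close> into
  \<open>y^2 * (p - p')\<close>, so that the family over all polynomials is closed under
  differentiation; \<open>flat 1\<close> is the standard flat function
  \<open>exp (- 1/x)\<close>.\<close>

definition flat :: "real poly \<Rightarrow> real \<Rightarrow> real" where
  "flat p x = (if x > 0 then poly p (1/x) * exp (- (1/x)) else 0)"

lemma poly_exp_tendsto_0: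
  fixes p :: "real poly"
  shows "((\<lambda>y. poly p y * exp (- y)) \<longlongrightarrow> 0) at_top"
proof -
  have "((\<lambda>y. \<Sum>i\<le>degree p. coeff p i * (y ^ i / exp y)) \<longlongrightarrow> (\<Sum>i\<le>degree p. coeff p i * 0)) at_top"
    by (intro tendsto_sum tendsto_mult_left tendsto_power_div_exp_0)
  moreover have "(\<Sum>i\<le>degree p. coeff p i * (y ^ i / exp y)) = poly p y * exp (- y)" for y
    by (simp add: poly_altdef sum_distrib_right exp_minus divide_inverse mult.assoc)
  ultimately show ?thesis by simp
qed

lemma flat_DERIV:
  "(flat p has_real_derivative flat ([:0, 0, 1:] * (p - pderiv p)) x) (at x)"
proof (cases "x = 0")
  case False
  show ?thesis
  proof (cases "x > 0")
    case True
    have "((\<lambda>x. poly p (1/x) * exp (- (1/x))) has_real_derivative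
        flat ([:0, 0, 1:] * (p - pderiv p)) x) (at x)"
      using True
      by (auto intro!: derivative_eq_intros poly_DERIV simp: flat_def power2_eq_square field_simps)
    then show ?thesis
      by (rule has_field_derivative_transform_within_open[where S="{0<..}"]) (use True in \<open>auto simp: flat_def\<close>)
  next
    case xn: False
    have "((\<lambda>x. 0) has_real_derivative flat ([:0, 0, 1:] * (p - pderiv p)) x) (at x)"
      using xn by (auto simp: flat_def)
    then show ?thesis
      by (rule has_field_derivative_transform_within_open[where S="{..<0}"]) (use False xn in \<open>auto simp: flat_def\<close>)
  qed
next
  case True
  \<comment> \<open>On the right the difference quotient at 0 is again a polynomial in
    \<open>1/x\<close> times \<open>exp (- 1/x)\<close>, and the exponential beats every
    polynomial.\<close>
  have "((\<lambda>y. (flat p y - flat p 0) / (y - 0)) \<longlongrightarrow> 0) (at 0)"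
  proof (rule filterlim_split_at)
    have "((\<lambda>y::real. 0::real) \<longlongrightarrow> 0) (at_left 0)" by simp
    then show "((\<lambda>y. (flat p y - flat p 0) / (y - 0)) \<longlongrightarrow> 0) (at_left 0)"
      by (rule Lim_transform_eventually) (auto simp: eventually_at_left_field flat_def intro!: exI[of _ "-1"])
    have "((\<lambda>y. poly ([:0,1:] * p) (inverse y) * exp (- (inverse y))) \<longlongrightarrow> 0) (at_right 0)"
      by (rule filterlim_compose[OF poly_exp_tendsto_0 filterlim_inverse_at_top_right])
    then show "((\<lambda>y. (flat p y - flat p 0) / (y - 0)) \<longlongrightarrow> 0) (at_right 0)"
      by (rule Lim_transform_eventually)
        (auto simp: eventually_at_right_field flat_def divide_inverse intro!: exI[of _ 1])
  qed
  then show ?thesis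
    using True by (simp add: has_field_derivative_iff flat_def)
qed

lemma smooth_flat: "smooth (flat p)"
  by (rule smooth_coinduct[of _ "range flat"]) (use flat_DERIV in blast)+

text \<open>The parameter \<open>k\<close> leaves the support alone and drives the values inside to
  1. Bumps thus approximate the indicator of the open interval, always between 0 and 1.\<close>

definition bump :: "real \<Rightarrow> real \<Rightarrow> real \<Rightarrow> real \<Rightarrow> real" where
  "bump a b k x = flat 1 (k * (x - a)) * flat 1 (k * (b - x))"

lemma smooth_bump: "smooth (bump a b k)"
proof -
  have "smooth (\<lambda>x. (1 * flat 1 (k * x + - k * a)) * (1 * flat 1 (- k * x + k * b)))"
    by (intro smooth_mult smooth_affine smooth_flat)
  then show ?thesis by (simp add: bump_def[abs_def] algebra_simps)
qed

lemma bump_nonneg: "0 \<le> bump a b k x" and bump_le_1: "bump a b k x \<le> 1"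
  by (auto simp: bump_def flat_def mult_le_one)

lemma bump_eq_0: "k > 0 \<Longrightarrow> x \<notin> {a<..<b} \<Longrightarrow> bump a b k x = 0"
  by (auto simp: bump_def flat_def zero_less_mult_iff)

lemma bump_pos: "k > 0 \<Longrightarrow> a < x \<Longrightarrow> x < b \<Longrightarrow> 0 < bump a b k x"
  by (auto simp: bump_def flat_def)

lemma bump_tendsto: "(\<lambda>n. bump a b (real (Suc n)) x) \<longlonglongrightarrow> indicator {a<..<b} x"
proof (cases "x \<in> {a<..<b}")
  case True
  have *: "(\<lambda>n. exp (- (1 / (real (Suc n) * c)))) \<longlonglongrightarrow> exp (- 0)" if "c > 0" for c :: real
  proof (intro tendsto_exp tendsto_minus)
    have "(\<lambda>n. (1/c) * inverse (real (Suc n))) \<longlonglongrightarrow> (1/c) * 0"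
      by (intro tendsto_mult_left LIMSEQ_inverse_real_of_nat)
    then show "(\<lambda>n. 1 / (real (Suc n) * c)) \<longlonglongrightarrow> 0" by (simp add: divide_inverse mult.commute)
  qed
  have "(\<lambda>n. exp (- (1 / (real (Suc n) * (x - a)))) * exp (- (1 / (real (Suc n) * (b - x)))))
      \<longlonglongrightarrow> exp (- 0) * exp (- 0)"
    using True by (intro tendsto_mult *) auto
  moreover have "bump a b (real (Suc n)) x
      = exp (- (1 / (real (Suc n) * (x - a)))) * exp (- (1 / (real (Suc n) * (b - x))))" for n
    using True by (simp add: bump_def flat_def zero_less_mult_iff)
  ultimately show ?thesis using True by simp
next
  case False
  then have "bump a b (real (Suc n)) x = 0" for n by (intro bump_eq_0) auto
  with False show ?thesis by simp
qed

section \<open>Primitives of mean-zero functions as test functions\<close>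

lemma smooth_primitive:
  assumes "smooth \<rho>" and "\<And>x. x \<notin> {c..d} \<Longrightarrow> \<rho> x = 0" and "integral {c..d} \<rho> = 0"
  shows "smooth (\<lambda>x. integral {c..x} \<rho>)"
    and "\<And>x. ((\<lambda>x. integral {c..x} \<rho>) has_real_derivative \<rho> x) (at x)"
    and "\<And>x. x \<notin> {c..d} \<Longrightarrow> integral {c..x} \<rho> = 0"
proof -
  note cont = smooth_cont[OF assms(1)]
  have int: "\<rho> integrable_on {u..v}" for u v
    by (rule integrable_continuous_real[OF cont])
  \<comment> \<open>The value at the endpoint itself is obtained by continuity from the left. Then
    the integral may start at any point left of \<open>c\<close>, which yields two-sided derivatives
    also at \<open>c\<close> and to the left of it.\<close>
  have rc: "\<rho> c = 0"
  proof -
    have "(\<rho> \<longlongrightarrow> \<rho> c) (at_left c)"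
      using cont[of UNIV] by (metis continuous_on_def UNIV_I filterlim_at_split iso_tuple_UNIV_I)
    moreover have "(\<rho> \<longlongrightarrow> 0) (at_left c)"
      by (rule Lim_transform_eventually[OF tendsto_const])
        (auto simp: eventually_at_left_field assms(2) intro!: exI[of _ "c - 1"])
    ultimately show ?thesis by (metis tendsto_unique trivial_limit_at_left_real)
  qed
  have left: "integral {u..v} \<rho> = 0" if "v \<le> c" for u v
  proof -
    have "integral {u..v} \<rho> = integral {u..v} (\<lambda>x. 0)"
      using that assms(2) rc by (intro integral_cong) (metis atLeastAtMost_iff antisym_conv1 linorder_not_le order_trans nle_le)
    then show ?thesis by simp
  qed
  have eq: "integral {c..y} \<rho> = integral {u..y} \<rho>" if "u \<le> c" for u y
  proof (cases "c \<le> y")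
    case True
    then show ?thesis using Henstock_Kurzweil_Integration.integral_combine[OF that True int] left by simp
  next
    case False
    then show ?thesis using left by simp
  qed
  show D: "((\<lambda>x. integral {c..x} \<rho>) has_real_derivative \<rho> x) (at x)" for x
  proof -
    let ?u = "min c x - 1" and ?v = "x + 1"
    have "((\<lambda>x. integral {?u..x} \<rho>) has_real_derivative \<rho> x) (at x within {?u..?v})"
      by (rule integral_has_real_derivative[OF cont]) auto
    then have "((\<lambda>x. integral {?u..x} \<rho>) has_real_derivative \<rho> x) (at x)"
      by (subst (asm) at_within_interior) (auto simp: interior_atLeastAtMost_real)
    moreover have "(\<lambda>x. integral {c..x} \<rho>) = (\<lambda>x. integral {?u..x} \<rho>)"
      by (rule ext, rule eq) auto
    ultimately show ?thesis by simp
  qed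
  show "smooth (\<lambda>x. integral {c..x} \<rho>)"
    using smoothI[OF D] assms(1) by blast
  show "integral {c..x} \<rho> = 0" if "x \<notin> {c..d}" for x
  proof (cases "x < c")
    case False
    then have "d < x" using that by auto
    show ?thesis
    proof (cases "c \<le> d")
      case True
      have "integral {d..x} \<rho> = 0"
      proof (rule integral_unique[OF has_integral_spike_finite[of "{d}" _ _ "\<lambda>x. 0"]])
        show "((\<lambda>x. 0) has_integral 0) {d..x}" by simp
      qed (use assms(2) in auto)
      then show ?thesis
        using Henstock_Kurzweil_Integration.integral_combine[OF True _ int] \<open>d < x\<close> assms(3) by auto
    next
      case False
      then have "\<rho> = (\<lambda>y. 0)" using assms(2) by auto
      then show ?thesis by simp
    qed
  qed simp
qed

lemma test_functionI:
  assumes "smooth \<phi>" and "\<And>x. x \<notin> {c..d} \<Longrightarrow> \<phi> x = 0" and "{c..d} \<subseteq> S"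
  shows "test_function S \<phi>"
proof -
  have "closure {x. \<phi> x \<noteq> 0} \<subseteq> {c..d}"
    using assms(2) by (intro closure_minimal) (blast, simp)
  moreover from this have "compact (closure {x. \<phi> x \<noteq> 0})"
    by (metis compact_Icc compact_Int_closed closed_closure inf.absorb_iff2)
  ultimately show ?thesis
    using assms unfolding test_function_def smooth_def by auto
qed

section \<open>Supremum bounds from weak derivatives\<close>

text \<open>By the Henstock lemma, the Riemann sums of the negative part are small.\<close>

lemma negligible_neg_of_intervals:
  fixes g :: "real \<Rightarrow> real"
  assumes int: "g integrable_on {c..d}"
    and nn: "\<And>a b. c \<le> a \<Longrightarrow> a < b \<Longrightarrow> b \<le> d \<Longrightarrow> 0 \<le> integral {a..b} g"
  shows "negligible {x \<in> {c..d}. g x < 0}"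
proof -
  let ?h = "\<lambda>x. max 0 (- g x)"
  have "(?h has_integral 0) (cbox c d)"
    unfolding has_integral
  proof (intro allI impI)
    fix e :: real assume "e > 0"
    obtain \<gamma> where \<gamma>: "gauge \<gamma>" and fine: "\<And>p. p tagged_partial_division_of (cbox c d) \<Longrightarrow> \<gamma> fine p \<Longrightarrow>
        (\<Sum>(x,k)\<in>p. norm (measure lborel k *\<^sub>R g x - integral k g)) < e"
      using Henstock_lemma[of g c d e] int \<open>e > 0\<close> by auto
    have "norm ((\<Sum>(x,k)\<in>p. measure lborel k *\<^sub>R ?h x) - 0) < e"
      if p: "p tagged_division_of cbox c d" "\<gamma> fine p" for p
    proof -
      \<comment> \<open>Where \<open>g x < 0\<close>, the Riemann term is negative while the
        integral over \<open>k\<close> is nonnegative, so the error of this single term already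
        dominates the negative part.\<close>
      have le: "0 \<le> measure lborel k *\<^sub>R ?h x \<and> measure lborel k *\<^sub>R ?h x \<le> norm (measure lborel k *\<^sub>R g x - integral k g)"
        if xk: "(x, k) \<in> p" for x k
      proof -
        have "k \<subseteq> cbox c d" "\<exists>a b. k = cbox a b"
          using tagged_division_ofD(3,4)[OF p(1) xk] by blast+
        then obtain a b where k: "k = {a..b}" "k \<subseteq> {c..d}"
          by (metis box_real(2))
        have "x \<in> k" using tagged_division_ofD(2)[OF p(1) xk] .
        then have ab: "a \<le> b" using k by auto
        then have "c \<le> a" "b \<le> d" using k by auto
        then have I: "0 \<le> integral k g"
          using nn[of a b] ab k(1) by (cases "a = b") auto
        have c: "0 \<le> measure lborel k" by simp
        show ?thesis
        proof (cases "g x < 0")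
          case True
          then have "measure lborel k * g x \<le> 0" using c by (simp add: mult_nonneg_nonpos)
          then show ?thesis using I c True by (simp add: max_def)
        qed (use c in \<open>auto simp: max_def\<close>)
      qed
      have "(\<Sum>(x,k)\<in>p. measure lborel k *\<^sub>R ?h x) \<le> (\<Sum>(x,k)\<in>p. norm (measure lborel k *\<^sub>R g x - integral k g))"
        by (rule sum_mono) (use le in \<open>auto split: prod.splits\<close>)
      also have "\<dots> < e"
        using fine p tagged_division_of_def by blast
      finally have "(\<Sum>(x,k)\<in>p. measure lborel k *\<^sub>R ?h x) < e" .
      moreover have "0 \<le> (\<Sum>(x,k)\<in>p. measure lborel k *\<^sub>R ?h x)"
        by (rule sum_nonneg) (use le in \<open>auto split: prod.splits\<close>)
      ultimately show ?thesis by simp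
    qed
    then show "\<exists>\<gamma>. gauge \<gamma> \<and> (\<forall>\<D>. \<D> tagged_division_of cbox c d \<and> \<gamma> fine \<D> \<longrightarrow>
        norm ((\<Sum>(x,k)\<in>\<D>. measure lborel k *\<^sub>R ?h x) - 0) < e)"
      using \<gamma> by blast
  qed
  then have h: "((\<lambda>x. if x \<in> {c..d} then ?h x else 0) has_integral 0) UNIV"
    by (subst has_integral_restrict_UNIV) simp
  then have "(\<lambda>x. if x \<in> {c..d} then ?h x else 0) \<in> borel_measurable lebesgue"
    and "(\<integral>\<^sup>+x. ennreal (if x \<in> {c..d} then ?h x else 0) \<partial>lebesgue) = 0"
    by (subst (asm) has_integral_iff_nn_integral_lebesgue; auto)+
  then have "AE x in lebesgue. ennreal (if x \<in> {c..d} then ?h x else 0) = 0"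
    by (subst (asm) nn_integral_0_iff_AE) auto
  then have "AE x in lebesgue. \<not> (x \<in> {c..d} \<and> g x < 0)"
    by eventually_elim (auto simp: max_def ennreal_eq_0_iff split: if_splits)
  then have "{x. x \<in> {c..d} \<and> g x < 0} \<in> null_sets lebesgue"
    by (simp add: completion.AE_iff_null_sets conj_ac)
  then show ?thesis by (simp add: negligible_iff_null_sets)
qed

lemma L2_on_square_integrable:
  assumes "L2_on S f"
  shows "set_integrable lebesgue S (\<lambda>x. (f x)\<^sup>2)" and "(LINT x:S|lebesgue. (f x)\<^sup>2) = enn2real (L2_sq S f)"
proof -
  have m: "(\<lambda>x. indicator S x *\<^sub>R f x) \<in> borel_measurable lebesgue"
    and fin: "L2_sq S f < \<infinity>"
    using assms by (auto simp: L2_on_def set_borel_measurable_def)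
  have eq: "indicator S x *\<^sub>R (f x)\<^sup>2 = (indicator S x *\<^sub>R f x)\<^sup>2" for x
    by (auto simp: indicator_def)
  have m2: "(\<lambda>x. indicator S x *\<^sub>R (f x)\<^sup>2) \<in> borel_measurable lebesgue"
    unfolding eq using m by measurable
  have nn: "(\<integral>\<^sup>+x. ennreal (indicator S x *\<^sub>R (f x)\<^sup>2) \<partial>lebesgue) = L2_sq S f"
    unfolding L2_sq_def by (intro nn_integral_cong) (auto simp: indicator_def)
  show "set_integrable lebesgue S (\<lambda>x. (f x)\<^sup>2)"
    unfolding set_integrable_def using m2 fin nn
    by (intro integrableI_nonneg) auto
  show "(LINT x:S|lebesgue. (f x)\<^sup>2) = enn2real (L2_sq S f)"
    unfolding set_lebesgue_integral_def nn[symmetric] using m2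
    by (intro integral_eq_nn_integral) auto
qed

lemma set_integrable_bound_real:
  fixes f g :: "real \<Rightarrow> real"
  assumes "set_integrable lebesgue S f" and "set_borel_measurable lebesgue S g"
    and "\<And>x. x \<in> S \<Longrightarrow> \<bar>g x\<bar> \<le> f x"
  shows "set_integrable lebesgue S g"
  unfolding set_integrable_def
  by (rule Bochner_Integration.integrable_bound[OF assms(1)[unfolded set_integrable_def]])
    (use assms(2,3) in \<open>auto simp: set_borel_measurable_def indicator_def intro!: order_trans[OF assms(3) abs_ge_self]\<close>)

lemma set_integrable_const:
  fixes S :: "real set"
  assumes "S \<in> lmeasurable" shows "set_integrable lebesgue S (\<lambda>x. k :: real)"
proof -
  have "integrable lebesgue (indicator S :: real \<Rightarrow> real)"
    using assms by (intro integrable_real_indicator) (auto simp: fmeasurable_def)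
  then show ?thesis by (simp add: set_integrable_def)
qed

text \<open>The inequality \<open>\<bar>f x\<bar> \<le> 1 + (f x)^2\<close> replaces Cauchy-Schwarz.
  The bound is linear in \<open>L2_sq\<close> instead of its square root, which is enough for bounds
  that are uniform in time.\<close>

lemma L2_on_integrable:
  assumes "L2_on S f" and "S \<in> lmeasurable"
  shows "set_integrable lebesgue S f" and "(LINT x:S|lebesgue. \<bar>f x\<bar>) \<le> measure lebesgue S + enn2real (L2_sq S f)"
proof -
  note sq = L2_on_square_integrable[OF assms(1)]
  have one: "set_integrable lebesgue S (\<lambda>x. 1::real)"
    by (rule set_integrable_const[OF assms(2)])
  have s: "set_integrable lebesgue S (\<lambda>x. 1 + (f x)\<^sup>2)"
    by (rule set_integral_add(1)[OF one sq(1)])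
  have b: "\<bar>f x\<bar> \<le> 1 + (f x)\<^sup>2" for x
  proof -
    have "0 \<le> (\<bar>f x\<bar> - 1)\<^sup>2" by simp
    then have "2 * \<bar>f x\<bar> \<le> 1 + (f x)\<^sup>2" by (simp add: power2_diff)
    then show ?thesis by linarith
  qed
  show i: "set_integrable lebesgue S f"
    by (rule set_integrable_bound_real[OF s]) (use assms(1) b in \<open>auto simp: L2_on_def\<close>)
  have "(LINT x:S|lebesgue. \<bar>f x\<bar>) \<le> (LINT x:S|lebesgue. 1 + (f x)\<^sup>2)"
    by (rule set_integral_mono[OF set_integrable_abs[OF i] s b])
  also have "\<dots> = (LINT x:S|lebesgue. 1) + (LINT x:S|lebesgue. (f x)\<^sup>2)"
    by (rule set_integral_add(2)[OF one sq(1)])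
  also have "(LINT x:S|lebesgue. 1) = measure lebesgue S"
    using assms(2) by (simp add: set_lebesgue_integral_def fmeasurable_def)
  finally show "(LINT x:S|lebesgue. \<bar>f x\<bar>) \<le> measure lebesgue S + enn2real (L2_sq S f)"
    using sq(2) by simp
qed

lemma set_integrable_mult_bounded:
  fixes f g :: "real \<Rightarrow> real"
  assumes f: "set_integrable lebesgue S f" and g: "g \<in> borel_measurable lebesgue"
    and b: "\<And>x. \<bar>g x\<bar> \<le> B"
  shows "set_integrable lebesgue S (\<lambda>x. f x * g x)"
    and "\<bar>LINT x:S|lebesgue. f x * g x\<bar> \<le> B * (LINT x:S|lebesgue. \<bar>f x\<bar>)"
proof -
  have B: "0 \<le> B" using b[of 0] by (meson abs_ge_zero order_trans)
  have s: "set_integrable lebesgue S (\<lambda>x. B * \<bar>f x\<bar>)"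
    using set_integrable_abs[OF f] by simp
  have m: "(\<lambda>x. indicator S x *\<^sub>R f x) \<in> borel_measurable lebesgue"
    using f by (auto simp: set_integrable_def)
  have "(\<lambda>x. (indicator S x *\<^sub>R f x) * g x) \<in> borel_measurable lebesgue"
    using m g by measurable
  then have m2: "set_borel_measurable lebesgue S (\<lambda>x. f x * g x)"
    by (simp add: set_borel_measurable_def mult.assoc)
  have le: "\<bar>f x * g x\<bar> \<le> B * \<bar>f x\<bar>" for x
    using mult_right_mono[OF b[of x], of "\<bar>f x\<bar>"] by (simp add: abs_mult mult.commute)
  show i: "set_integrable lebesgue S (\<lambda>x. f x * g x)"
    by (rule set_integrable_bound_real[OF s m2 le])
  have "\<bar>LINT x:S|lebesgue. f x * g x\<bar> \<le> (LINT x:S|lebesgue. \<bar>f x * g x\<bar>)"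
    using set_integral_norm_bound[OF i] by simp
  also have "\<dots> \<le> (LINT x:S|lebesgue. B * \<bar>f x\<bar>)"
    by (rule set_integral_mono[OF set_integrable_abs[OF i] s le])
  finally show "\<bar>LINT x:S|lebesgue. f x * g x\<bar> \<le> B * (LINT x:S|lebesgue. \<bar>f x\<bar>)"
    by simp
qed

lemma bump_integral:
  assumes "a < b" "k > 0" "c \<le> a" "b \<le> d"
  shows "integral {c..d} (bump a b k) = integral UNIV (bump a b k)"
    and "0 < integral UNIV (bump a b k)" and "integral UNIV (bump a b k) \<le> b - a"
proof -
  have i: "bump a b k integrable_on {c..d}" for c d
    by (rule integrable_continuous_real[OF smooth_cont[OF smooth_bump]])
  have eq: "(bump a b k has_integral integral {c..d} (bump a b k)) UNIV" if "c \<le> a" "b \<le> d" for c d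
    by (rule has_integral_on_superset[OF integrable_integral[OF i]])
      (use that assms in \<open>auto intro!: bump_eq_0\<close>)
  show U: "integral {c..d} (bump a b k) = integral UNIV (bump a b k)"
    using integral_unique[OF eq[OF assms(3,4)]] by simp
  have ab: "integral UNIV (bump a b k) = integral {a..b} (bump a b k)"
    using integral_unique[OF eq[of a b]] by simp
  have "integral {a..b} (bump a b k) \<le> integral {a..b} (\<lambda>x. 1)"
    by (rule integral_le[OF i]) (auto simp: bump_le_1)
  then show "integral UNIV (bump a b k) \<le> b - a" using ab assms(1) by simp
  have "0 \<le> integral {a..b} (bump a b k)"
    by (rule integral_nonneg[OF i]) (auto simp: bump_nonneg)
  moreover have "integral {a..b} (bump a b k) \<noteq> 0"
  proof
    assume z: "integral {a..b} (bump a b k) = 0"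
    have "bump a b k ((a+b)/2) = 0"
      by (rule has_integral_0_cbox_imp_0[of a b])
        (use assms z i[of a b] in \<open>auto simp: bump_nonneg smooth_cont smooth_bump has_integral_iff\<close>)
    then show False using bump_pos[of k a "(a+b)/2" b] assms by auto
  qed
  ultimately show "0 < integral UNIV (bump a b k)" using ab by simp
qed

text \<open>Two bumps, weighted so that their integrals cancel, form the derivative of a test
  function. Testing a weak derivative with it compares the averages of the function over the two
  intervals. If the first interval lies to the left of the second, the test function is the constant
  \<kappa> in between.\<close>

lemma bump_combination_primitive:
  fixes a b a' b' k k' :: real
  defines "\<kappa> \<equiv> integral UNIV (bump a b k)" and "\<kappa>' \<equiv> integral UNIV (bump a' b' k')"
  assumes ab: "a < b" "k > 0" and ab': "a' < b'" "k' > 0"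
    and sub: "{min a a'..max b b'} \<subseteq> S"
  obtains \<phi> where "test_function S \<phi>" "smooth \<phi>"
    "deriv \<phi> = (\<lambda>x. bump a b k x - \<kappa> / \<kappa>' * bump a' b' k' x)"
    "\<And>x. \<bar>\<phi> x\<bar> \<le> 2 * \<kappa>"
    "\<And>x. x \<notin> {min a a'..max b b'} \<Longrightarrow> \<phi> x = 0"
    "\<And>x. b \<le> x \<Longrightarrow> x \<le> a' \<Longrightarrow> \<phi> x = \<kappa>"
proof -
  define c where "c = min a a'"
  define d where "d = max b b'"
  have cd: "c \<le> a" "b \<le> d" "c \<le> a'" "b' \<le> d" by (auto simp: c_def d_def)
  define \<theta> where "\<theta> = (\<lambda>x. bump a b k x - \<kappa> / \<kappa>' * bump a' b' k' x)"
  note B = bump_integral[OF ab cd(1,2), folded \<kappa>_def] and B' = bump_integral[OF ab' cd(3,4), folded \<kappa>'_def]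
  have i: "bump a b k integrable_on {u..v}" for a b k u v
    by (rule integrable_continuous_real[OF smooth_cont[OF smooth_bump]])
  have sm: "smooth \<theta>"
  proof -
    have "smooth (\<lambda>x. bump a b k x + (- (\<kappa>/\<kappa>')) * bump a' b' k' (1 * x + 0))"
      by (intro smooth_add smooth_affine smooth_bump)
    then show ?thesis by (simp add: \<theta>_def)
  qed
  have zero: "\<theta> x = 0" if "x \<notin> {c..d}" for x
  proof -
    have "x \<notin> {a<..<b}" "x \<notin> {a'<..<b'}" using that cd by auto
    then show ?thesis using ab ab' by (simp add: \<theta>_def bump_eq_0)
  qed
  have split: "integral {u..v} \<theta> = integral {u..v} (bump a b k) - \<kappa>/\<kappa>' * integral {u..v} (bump a' b' k')" for u v
    unfolding \<theta>_def by (rule integral_diff[OF i integrable_on_mult_right[OF i], unfolded integral_mult_right])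
  have tot: "integral {c..d} \<theta> = 0"
    using split[of c d] B B' by simp
  note P = smooth_primitive[OF sm zero tot]
  have part: "0 \<le> integral {c..x} (bump a b k)" "integral {c..x} (bump a b k) \<le> integral UNIV (bump a b k)"
    if "a < b" "k > 0" "c \<le> a" for a b k x
  proof -
    show "0 \<le> integral {c..x} (bump a b k)"
      by (rule integral_nonneg[OF i]) (auto simp: bump_nonneg)
    have "integral {c..x} (bump a b k) \<le> integral {c..max x b} (bump a b k)"
      by (rule integral_subset_le) (auto intro: i simp: bump_nonneg)
    also have "\<dots> = integral UNIV (bump a b k)"
      by (rule bump_integral(1)) (use that in auto)
    finally show "integral {c..x} (bump a b k) \<le> integral UNIV (bump a b k)" .
  qed
  show thesis
  proof (rule that[of "\<lambda>x. integral {c..x} \<theta>"])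
    show "test_function S (\<lambda>x. integral {c..x} \<theta>)"
      by (rule test_functionI[OF P(1,3)]) (use sub in \<open>auto simp: c_def d_def\<close>)
    show "smooth (\<lambda>x. integral {c..x} \<theta>)" by (rule P)
    show "deriv (\<lambda>x. integral {c..x} \<theta>) = (\<lambda>x. bump a b k x - \<kappa> / \<kappa>' * bump a' b' k' x)"
      using P(2) by (auto intro!: ext DERIV_imp_deriv simp: \<theta>_def)
    show "\<bar>integral {c..x} \<theta>\<bar> \<le> 2 * \<kappa>" for x
    proof -
      note p = part[OF ab cd(1), of x, folded \<kappa>_def] and p' = part[OF ab' cd(3), of x, folded \<kappa>'_def]
      have "0 \<le> \<kappa>/\<kappa>' * integral {c..x} (bump a' b' k')" "\<kappa>/\<kappa>' * integral {c..x} (bump a' b' k') \<le> \<kappa>/\<kappa>' * \<kappa>'"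
        using p' B(2) B'(2) by (simp, intro mult_left_mono) auto
      then show ?thesis using p B' B by (simp add: split)
    qed
    show "integral {c..x} \<theta> = 0" if "x \<notin> {min a a'..max b b'}" for x
      using P(3) that by (simp add: c_def d_def)
    show "integral {c..x} \<theta> = \<kappa>" if "b \<le> x" "x \<le> a'" for x
    proof -
      have "integral {c..x} (bump a' b' k') = integral {c..x} (\<lambda>x. 0)"
        by (rule integral_cong) (use that ab' in \<open>auto intro!: bump_eq_0\<close>)
      moreover have "integral {c..x} (bump a b k) = \<kappa>"
        unfolding \<kappa>_def by (rule bump_integral) (use that ab cd in auto)
      ultimately show ?thesis by (simp add: split)
    qed
  qed
qed

text \<open>Testing with a bump on \<open>(a, b)\<close>, balanced by a fixed bump in the middle of
  the ball, bounds the integral of \<open>v\<close> over \<open>(a, b)\<close> by a multiple of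
  \<open>b - a\<close>. A bound on the averages over all intervals is a bound almost everywhere. In
  this form no continuous representative of \<open>v\<close> has to be constructed.\<close>

lemma weak_deriv_AE_bound:
  assumes r: "r > 0"
  obtains K where "K \<ge> 0" and
    "\<And>v w M. L2_on (ball x0 r) v \<Longrightarrow> L2_on (ball x0 r) w \<Longrightarrow> weak_deriv_on (ball x0 r) v w \<Longrightarrow>
       L2_sq (ball x0 r) v \<le> ennreal M \<Longrightarrow> L2_sq (ball x0 r) w \<le> ennreal M \<Longrightarrow> 0 \<le> M \<Longrightarrow>
       AE x in lebesgue. x \<in> ball x0 r \<longrightarrow> \<bar>v x\<bar> \<le> K * (1 + M)"
proof -
  define J where "J = ball x0 r"
  have J: "J = {x0 - r<..<x0 + r}" by (auto simp: J_def dist_real_def)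
  have Jm: "J \<in> lmeasurable" by (simp add: J_def)
  define \<kappa>' where "\<kappa>' = integral UNIV (bump (x0 - r/2) (x0 + r/2) 1)"
  have \<kappa>': "\<kappa>' > 0" unfolding \<kappa>'_def using r by (intro bump_integral(2)[of _ _ _ "x0-r/2" "x0+r/2"]) auto
  define N where "N = measure lebesgue J"
  have N: "N \<ge> 0" by (simp add: N_def)
  \<comment> \<open>\<open>1/\<kappa>'\<close> is the price of the balancing bump and 2 comes from
    \<open>\<bar>\<phi> x\<bar> \<le> 2 * \<kappa>\<close>; \<open>N + 1\<close> absorbs the passage
    from L2 to L1, as \<open>N + M\<close> is at most \<open>N + 1\<close> times
    \<open>1 + M\<close>.\<close>
  define K where "K = (1/\<kappa>' + 2) * (N + 1)"
  have main: "AE x in lebesgue. x \<in> J \<longrightarrow> \<bar>v x\<bar> \<le> K * (1 + M)"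
    if v: "L2_on J v" and w: "L2_on J w" and vw: "weak_deriv_on J v w"
      and M: "L2_sq J v \<le> ennreal M" "L2_sq J w \<le> ennreal M" "0 \<le> M" for v w M
  proof -
    note vi = L2_on_integrable[OF v Jm] and wi = L2_on_integrable[OF w Jm]
    define V where "V = (LINT x:J|lebesgue. \<bar>v x\<bar>)"
    define W where "W = (LINT x:J|lebesgue. \<bar>w x\<bar>)"
    have "enn2real (L2_sq J v) \<le> M" "enn2real (L2_sq J w) \<le> M"
      using M by (auto simp: enn2real_leI)
    then have VW: "V \<le> N + M" "W \<le> N + M" using vi wi by (auto simp: V_def W_def N_def)
    have VW0: "0 \<le> V" "0 \<le> W" unfolding V_def W_def set_lebesgue_integral_def by (auto intro!: integral_nonneg_AE)
    have "(1/\<kappa>' + 2) * (N + M) \<le> K * (1 + M)"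
      unfolding K_def mult.assoc using N M(3) \<kappa>' by (intro mult_left_mono) (auto simp: algebra_simps)
    moreover have "V / \<kappa>' + 2 * W \<le> (1/\<kappa>' + 2) * (N + M)"
    proof -
      have "V / \<kappa>' \<le> (N + M) / \<kappa>'" using VW \<kappa>' by (intro divide_right_mono) auto
      then show ?thesis using VW by (simp add: algebra_simps add_divide_distrib)
    qed
    ultimately have KM: "V / \<kappa>' + 2 * W \<le> K * (1 + M)" by linarith
    have meas: "bump a b k \<in> borel_measurable lebesgue" for a b k
      using smooth_cont[OF smooth_bump, of UNIV] by (simp add: borel_measurable_continuous_onI measurable_completion)
    \<comment> \<open>The factor \<open>b - a\<close> enters only through
      \<open>\<kappa> \<le> b - a\<close>; everything else is independent of the interval and of the
      sharpness \<open>k\<close>.\<close>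
    have key: "\<bar>LINT x:J|lebesgue. v x * bump a b k x\<bar> \<le> (b - a) * (K * (1 + M))"
      if ab: "a < b" "x0 - r < a" "b < x0 + r" and k: "k > 0" for a b k
    proof -
      define \<kappa> where "\<kappa> = integral UNIV (bump a b k)"
      have \<kappa>: "0 < \<kappa>" "\<kappa> \<le> b - a" using bump_integral[OF ab(1) k, of a b] by (auto simp: \<kappa>_def)
      have sub: "{min a (x0 - r/2)..max b (x0 + r/2)} \<subseteq> J" using ab r by (auto simp: J)
      obtain \<phi> where \<phi>: "test_function J \<phi>" "smooth \<phi>"
        "deriv \<phi> = (\<lambda>x. bump a b k x - \<kappa> / \<kappa>' * bump (x0 - r/2) (x0 + r/2) 1 x)"
        "\<And>x. \<bar>\<phi> x\<bar> \<le> 2 * \<kappa>"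
      proof (rule bump_combination_primitive[OF ab(1) k _ _ sub, folded \<kappa>_def])
        show "x0 - r/2 < x0 + r/2" "(1::real) > 0" using r by auto
      qed (rule that, auto simp: \<kappa>'_def)
      have b1: "\<bar>bump a b k x\<bar> \<le> 1" for a b k x by (simp add: bump_nonneg bump_le_1)
      note vb = set_integrable_mult_bounded[OF vi(1) meas b1]
      have "(LINT x:J|lebesgue. v x * deriv \<phi> x) = (LINT x:J|lebesgue. v x * bump a b k x)
          - (\<kappa> / \<kappa>') * (LINT x:J|lebesgue. v x * bump (x0 - r/2) (x0 + r/2) 1 x)"
      proof -
        have "(LINT x:J|lebesgue. v x * deriv \<phi> x) = (LINT x:J|lebesgue. v x * bump a b k x - \<kappa> / \<kappa>' * (v x * bump (x0 - r/2) (x0 + r/2) 1 x))"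
          by (simp add: \<phi>(3) algebra_simps)
        also have "\<dots> = (LINT x:J|lebesgue. v x * bump a b k x) - (LINT x:J|lebesgue. \<kappa> / \<kappa>' * (v x * bump (x0 - r/2) (x0 + r/2) 1 x))"
          by (rule set_integral_diff(2)[OF vb(1)]) (use vb(1) in \<open>auto intro!: set_integrable_mult_right\<close>)
        finally show ?thesis by simp
      qed
      moreover have "(LINT x:J|lebesgue. v x * deriv \<phi> x) = - (LINT x:J|lebesgue. w x * \<phi> x)"
        using vw \<phi>(1) by (auto simp: weak_deriv_on_def)
      moreover have "\<bar>LINT x:J|lebesgue. w x * \<phi> x\<bar> \<le> 2 * \<kappa> * W"
        unfolding W_def by (rule set_integrable_mult_bounded[OF wi(1) _ \<phi>(4)])
          (use smooth_cont[OF \<phi>(2), of UNIV] in \<open>simp add: borel_measurable_continuous_onI measurable_completion\<close>)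
      moreover have "(\<kappa> / \<kappa>') * \<bar>LINT x:J|lebesgue. v x * bump (x0 - r/2) (x0 + r/2) 1 x\<bar> \<le> (\<kappa> / \<kappa>') * V"
        using vb(2) \<kappa> \<kappa>' by (intro mult_left_mono) (auto simp: V_def)
      moreover have "\<bar>(\<kappa> / \<kappa>') * (LINT x:J|lebesgue. v x * bump (x0 - r/2) (x0 + r/2) 1 x)\<bar> =
          (\<kappa> / \<kappa>') * \<bar>LINT x:J|lebesgue. v x * bump (x0 - r/2) (x0 + r/2) 1 x\<bar>"
        using \<kappa> \<kappa>' by (simp add: abs_mult)
      ultimately have "\<bar>LINT x:J|lebesgue. v x * bump a b k x\<bar> \<le> (\<kappa> / \<kappa>') * V + 2 * \<kappa> * W"
        by linarith
      also have "\<dots> = \<kappa> * (V / \<kappa>' + 2 * W)" by (simp add: algebra_simps)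
      also have "\<dots> \<le> (b - a) * (K * (1 + M))"
        using \<kappa> KM VW0 \<kappa>' by (intro mult_mono) auto
      finally show ?thesis .
    qed
    \<comment> \<open>Letting the sharpness of the bump tend to infinity replaces it by the
      indicator of the interval.\<close>
    have int: "\<bar>integral {a..b} v\<bar> \<le> (b - a) * (K * (1 + M))"
      and vab: "v integrable_on {a..b}"
      if ab: "a < b" "x0 - r < a" "b < x0 + r" for a b
    proof -
      have sub: "{a..b} \<subseteq> J" using ab by (auto simp: J)
      have si: "set_integrable lebesgue {a..b} v"
        by (rule set_integrable_subset[OF vi(1)]) (use sub in auto)
      then show "v integrable_on {a..b}" by (rule set_lebesgue_integral_eq_integral)
      have "(\<lambda>n. LINT x:J|lebesgue. v x * bump a b (real (Suc n)) x) \<longlonglongrightarrow> (LINT x:J|lebesgue. v x * indicator {a<..<b} x)"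
        unfolding set_lebesgue_integral_def
      proof (rule integral_dominated_convergence[where w="\<lambda>x. \<bar>indicator J x *\<^sub>R v x\<bar>"])
        have m: "(\<lambda>x. indicator J x *\<^sub>R v x) \<in> borel_measurable lebesgue"
          using vi(1) by (auto simp: set_integrable_def)
        then have "(\<lambda>x. (indicator J x *\<^sub>R v x) * indicator {a<..<b} x) \<in> borel_measurable lebesgue"
          by (intro borel_measurable_times borel_measurable_indicator) auto
        then show "(\<lambda>x. indicator J x *\<^sub>R (v x * indicator {a<..<b} x)) \<in> borel_measurable lebesgue"
          by (simp add: mult.assoc)
        show "(\<lambda>x. indicator J x *\<^sub>R (v x * bump a b (real (Suc n)) x)) \<in> borel_measurable lebesgue" for n
          using borel_measurable_times[OF m meas[of a b "real (Suc n)"]] by (simp add: mult.assoc)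
        show "integrable lebesgue (\<lambda>x. \<bar>indicator J x *\<^sub>R v x\<bar>)"
          using vi(1) by (auto simp: set_integrable_def)
        show "AE x in lebesgue. (\<lambda>n. indicator J x *\<^sub>R (v x * bump a b (real (Suc n)) x)) \<longlonglongrightarrow> indicator J x *\<^sub>R (v x * indicator {a<..<b} x)"
          by (intro always_eventually allI tendsto_intros bump_tendsto)
        show "AE x in lebesgue. norm (indicator J x *\<^sub>R (v x * bump a b (real (Suc n)) x)) \<le> \<bar>indicator J x *\<^sub>R v x\<bar>" for n
          by (intro always_eventually allI) (auto simp: indicator_def abs_mult bump_nonneg bump_le_1 intro!: mult_left_le)
      qed
      moreover have "(LINT x:J|lebesgue. v x * indicator {a<..<b} x) = integral {a..b} v"
      proof -
        have "(LINT x:J|lebesgue. v x * indicator {a<..<b} x) = (LINT x:{a<..<b}|lebesgue. v x)"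
          unfolding set_lebesgue_integral_def
          by (intro Bochner_Integration.integral_cong) (use ab in \<open>auto simp: indicator_def J\<close>)
        also have "\<dots> = integral {a<..<b} v"
          by (rule set_lebesgue_integral_eq_integral, rule set_integrable_subset[OF si]) auto
        also have "\<dots> = integral {a..b} v" by (simp add: integral_open_interval_real)
        finally show ?thesis .
      qed
      ultimately have "(\<lambda>n. \<bar>LINT x:J|lebesgue. v x * bump a b (real (Suc n)) x\<bar>) \<longlonglongrightarrow> \<bar>integral {a..b} v\<bar>"
        by (metis tendsto_rabs)
      then show "\<bar>integral {a..b} v\<bar> \<le> (b - a) * (K * (1 + M))"
        by (rule LIMSEQ_le_const2) (use key[OF ab] in \<open>auto intro!: exI[of _ 0]\<close>)
    qed
    \<comment> \<open>Closed intervals that exhaust the ball; \<open>n + 3\<close> keeps each of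
      them nondegenerate and strictly inside.\<close>
    define J' where "J' n = {x0 - r + r / real (n + 3)..x0 + r - r / real (n + 3)}" for n
    have neg: "negligible {x \<in> J' n. \<bar>v x\<bar> > K * (1 + M)}" for n
    proof -
      have e: "r / real (n + 3) > 0" using r by auto
      have vJ: "v integrable_on J' n"
      proof -
        have "r / real (n + 3) \<le> r / 3" using r by (intro divide_left_mono) auto
        then show ?thesis unfolding J'_def by (intro vab) (use e r in auto)
      qed
      have bd: "\<bar>integral {a..b} v\<bar> \<le> (b - a) * (K * (1 + M))" "v integrable_on {a..b}"
        if "x0 - r + r / real (n + 3) \<le> a" "a < b" "b \<le> x0 + r - r / real (n + 3)" for a b
        using int[of a b] vab[of a b] that e by auto
      have "negligible {x \<in> J' n. K * (1 + M) - v x < 0}" unfolding J'_def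
      proof (rule negligible_neg_of_intervals)
        show "(\<lambda>x. K * (1 + M) - v x) integrable_on {x0 - r + r / real (n + 3)..x0 + r - r / real (n + 3)}"
          using vJ by (intro integrable_diff) (auto simp: J'_def)
        fix a b assume ab: "x0 - r + r / real (n + 3) \<le> a" "a < b" "b \<le> x0 + r - r / real (n + 3)"
        show "0 \<le> integral {a..b} (\<lambda>x. K * (1 + M) - v x)"
          by (subst integral_diff) (use bd[OF ab] ab in \<open>auto simp: abs_le_iff algebra_simps\<close>)
      qed
      moreover have "negligible {x \<in> J' n. K * (1 + M) + v x < 0}" unfolding J'_def
      proof (rule negligible_neg_of_intervals)
        show "(\<lambda>x. K * (1 + M) + v x) integrable_on {x0 - r + r / real (n + 3)..x0 + r - r / real (n + 3)}"
          using vJ by (intro integrable_add) (auto simp: J'_def)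
        fix a b assume ab: "x0 - r + r / real (n + 3) \<le> a" "a < b" "b \<le> x0 + r - r / real (n + 3)"
        show "0 \<le> integral {a..b} (\<lambda>x. K * (1 + M) + v x)"
          by (subst integral_add) (use bd[OF ab] ab in \<open>auto simp: abs_le_iff algebra_simps\<close>)
      qed
      ultimately show ?thesis
        by (rule negligible_subset[OF negligible_Un]) auto
    qed
    have "negligible (\<Union>n. {x \<in> J' n. \<bar>v x\<bar> > K * (1 + M)})"
      by (rule negligible_countable_Union) (use neg in auto)
    moreover have "{x. \<not> (x \<in> J \<longrightarrow> \<bar>v x\<bar> \<le> K * (1 + M))} \<subseteq> (\<Union>n. {x \<in> J' n. \<bar>v x\<bar> > K * (1 + M)})"
    proof
      fix x assume "x \<in> {x. \<not> (x \<in> J \<longrightarrow> \<bar>v x\<bar> \<le> K * (1 + M))}"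
      then have x: "x \<in> J" "\<bar>v x\<bar> > K * (1 + M)" by auto
      define e where "e = min (x - (x0 - r)) (x0 + r - x)"
      have "e > 0" using x by (auto simp: e_def J)
      then obtain n where "r / e < real n" using reals_Archimedean2 by blast
      then have "r / e < real (n + 3)" by auto
      then have "r / real (n + 3) < e" using \<open>e > 0\<close> r by (simp add: field_simps)
      then have "x \<in> J' n" by (auto simp: J'_def e_def)
      then show "x \<in> (\<Union>n. {x \<in> J' n. \<bar>v x\<bar> > K * (1 + M)})" using x by auto
    qed
    ultimately have "negligible {x. \<not> (x \<in> J \<longrightarrow> \<bar>v x\<bar> \<le> K * (1 + M))}"
      by (rule negligible_subset)
    then show ?thesis by (simp add: completion.AE_iff_null_sets negligible_iff_null_sets)
  qed
  have "K \<ge> 0" using N \<kappa>' by (simp add: K_def)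
  then show thesis by (rule that) (use main in \<open>auto simp: J_def\<close>)
qed

section \<open>Continuity of solutions\<close>

lemma L2_sq_mono: "S \<subseteq> S' \<Longrightarrow> L2_sq S f \<le> L2_sq S' f"
  unfolding L2_sq_def by (intro nn_integral_mono) (auto simp: indicator_def)

lemma set_borel_measurable_mono:
  assumes "set_borel_measurable lebesgue S (f :: real \<Rightarrow> real)" "S' \<subseteq> S" "S' \<in> sets lebesgue"
  shows "set_borel_measurable lebesgue S' f"
proof -
  have "(\<lambda>x. indicator S' x * (indicator S x *\<^sub>R f x)) \<in> borel_measurable lebesgue"
    using assms by (intro borel_measurable_times borel_measurable_indicator) (auto simp: set_borel_measurable_def)
  moreover have "(\<lambda>x. indicator S' x * (indicator S x *\<^sub>R f x)) = (\<lambda>x. indicator S' x *\<^sub>R f x)"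
    using assms(2) by (auto simp: indicator_def fun_eq_iff)
  ultimately show ?thesis unfolding set_borel_measurable_def by argo
qed

lemma L2_on_mono: "L2_on S f \<Longrightarrow> S' \<subseteq> S \<Longrightarrow> S' \<in> sets lebesgue \<Longrightarrow> L2_on S' f"
  unfolding L2_on_def using set_borel_measurable_mono L2_sq_mono le_less_trans by blast

lemma test_function_deriv_zero:
  assumes "test_function S \<phi>" "x \<notin> S" shows "\<phi> x = 0" "deriv \<phi> x = 0"
proof -
  have x: "x \<notin> closure {x. \<phi> x \<noteq> 0}" using assms by (auto simp: test_function_def)
  then show "\<phi> x = 0" using closure_subset[of "{x. \<phi> x \<noteq> 0}"] by auto
  have "((\<lambda>x. 0) has_real_derivative 0) (at x)" by simp
  then have "(\<phi> has_real_derivative 0) (at x)"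
    by (rule has_field_derivative_transform_within_open[where S="- closure {x. \<phi> x \<noteq> 0}"])
      (use x closure_subset[of "{x. \<phi> x \<noteq> 0}"] in auto)
  then show "deriv \<phi> x = 0" by (rule DERIV_imp_deriv)
qed

text \<open>A test function supported in the smaller set vanishes outside of it together with its
  derivative, so that shrinking the domain changes neither integral.\<close>

lemma weak_deriv_on_mono:
  assumes "weak_deriv_on S v w" "S' \<subseteq> S" shows "weak_deriv_on S' v w"
  unfolding weak_deriv_on_def
proof (intro allI impI)
  fix \<phi> assume \<phi>: "test_function S' \<phi>"
  then have "test_function S \<phi>" using assms(2) by (auto simp: test_function_def)
  then have "(LINT x:S|lebesgue. v x * deriv \<phi> x) = - (LINT x:S|lebesgue. w x * \<phi> x)"
    using assms(1) by (auto simp: weak_deriv_on_def)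
  moreover have "(LINT x:S|lebesgue. v x * deriv \<phi> x) = (LINT x:S'|lebesgue. v x * deriv \<phi> x)"
    unfolding set_lebesgue_integral_def using assms(2) test_function_deriv_zero[OF \<phi>]
    by (intro Bochner_Integration.integral_cong) (auto simp: indicator_def)
  moreover have "(LINT x:S|lebesgue. w x * \<phi> x) = (LINT x:S'|lebesgue. w x * \<phi> x)"
    unfolding set_lebesgue_integral_def using assms(2) test_function_deriv_zero[OF \<phi>]
    by (intro Bochner_Integration.integral_cong) (auto simp: indicator_def)
  ultimately show "(LINT x:S'|lebesgue. v x * deriv \<phi> x) = - (LINT x:S'|lebesgue. w x * \<phi> x)"
    by simp
qed

section \<open>Restriction of solutions to smaller light cones\<close>

context
  fixes x0 x t0 t1 :: real
  assumes sub: "\<bar>x - x0\<bar> \<le> t0 - t1"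
begin

lemma subcone_ball: "ball x (t1 - t) \<subseteq> ball x0 (t0 - t)"
  using sub by (auto simp: dist_real_def)

lemma C_L2_subcone: "C_L2 x0 t0 f \<Longrightarrow> C_L2 x t1 f"
proof -
  assume f: "C_L2 x0 t0 f"
  show "C_L2 x t1 f"
    unfolding C_L2_def
  proof (intro conjI ballI)
    fix t assume "t \<in> {0..<t1}"
    then have "L2_on (ball x0 (t0 - t)) (\<lambda>x. f x t)" using f sub by (auto simp: C_L2_def)
    then show "L2_on (ball x (t1 - t)) (\<lambda>x. f x t)" by (rule L2_on_mono[OF _ subcone_ball]) auto
  next
    fix s t assume "s \<in> {0..<t1}" "t \<in> {0..s}"
    then have "((\<lambda>\<tau>. L2_sq (ball x0 (t0 - s)) (\<lambda>x. f x \<tau> - f x t)) \<longlongrightarrow> 0) (at t within {0..s})"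
      using f sub by (auto simp: C_L2_def)
    then show "((\<lambda>\<tau>. L2_sq (ball x (t1 - s)) (\<lambda>x. f x \<tau> - f x t)) \<longlongrightarrow> 0) (at t within {0..s})"
      by (rule tendsto_sandwich[OF _ _ tendsto_const, rotated 2])
        (auto intro!: always_eventually L2_sq_mono subcone_ball)
  qed
qed

lemma C_H1_subcone: "C_H1 x0 t0 f \<Longrightarrow> C_H1 x t1 f"
proof -
  assume "C_H1 x0 t0 f"
  then obtain fx where f: "C_L2 x0 t0 f" "C_L2 x0 t0 fx"
    "\<And>t. t \<in> {0..<t0} \<Longrightarrow> weak_deriv_on (ball x0 (t0 - t)) (\<lambda>x. f x t) (\<lambda>x. fx x t)"
    by (auto simp: C_H1_def)
  have "weak_deriv_on (ball x (t1 - t)) (\<lambda>x. f x t) (\<lambda>x. fx x t)" if "t \<in> {0..<t1}" for t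
    by (rule weak_deriv_on_mono[OF f(3) subcone_ball]) (use that sub in auto)
  then show "C_H1 x t1 f"
    using f C_L2_subcone by (auto simp: C_H1_def intro!: exI[of _ fx])
qed

lemma L2_time_deriv_subcone: "L2_time_deriv x0 t0 f ft \<Longrightarrow> L2_time_deriv x t1 f ft"
  unfolding L2_time_deriv_def
proof (intro ballI)
  fix s t assume f: "\<forall>s\<in>{0..<t0}. \<forall>t\<in>{0..s}. ((\<lambda>\<tau>. L2_sq (ball x0 (t0 - s)) (\<lambda>x. (f x \<tau> - f x t) / (\<tau> - t) - ft x t)) \<longlongrightarrow> 0) (at t within {0..s})"
    and s: "s \<in> {0..<t1}" and t: "t \<in> {0..s}"
  have "((\<lambda>\<tau>. L2_sq (ball x0 (t0 - s)) (\<lambda>x. (f x \<tau> - f x t) / (\<tau> - t) - ft x t)) \<longlongrightarrow> 0) (at t within {0..s})"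
    using f s t sub by auto
  then show "((\<lambda>\<tau>. L2_sq (ball x (t1 - s)) (\<lambda>x. (f x \<tau> - f x t) / (\<tau> - t) - ft x t)) \<longlongrightarrow> 0) (at t within {0..s})"
    by (rule tendsto_sandwich[OF _ _ tendsto_const, rotated 2])
      (auto intro!: always_eventually L2_sq_mono subcone_ball)
qed

lemma solution_on_subcone: "solution_on_cone u0 u1 u x0 t0 \<Longrightarrow> solution_on_cone u0 u1 u x t1"
proof -
  assume u: "solution_on_cone u0 u1 u x0 t0"
  have "duhamel u0 u1 u y t" if "t \<in> {0..<t1}" "y \<in> ball x (t1 - t)" for y t
  proof -
    have "t \<in> {0..<t0}" "y \<in> ball x0 (t0 - t)" using that sub subcone_ball[of t] by auto
    then show ?thesis using u by (auto simp: solution_on_cone_def)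
  qed
  then show ?thesis
    using u C_H1_subcone L2_time_deriv_subcone C_L2_subcone unfolding solution_on_cone_def by blast
qed

end

lemma L2_sq_add_le:
  assumes "set_borel_measurable lebesgue S f" "set_borel_measurable lebesgue S g"
  shows "L2_sq S (\<lambda>x. f x + g x) \<le> 2 * L2_sq S f + 2 * L2_sq S g"
proof -
  have m: "(\<lambda>x. ennreal ((indicator S x *\<^sub>R h x)\<^sup>2)) \<in> borel_measurable lebesgue"
    if "set_borel_measurable lebesgue S h" for h :: "real \<Rightarrow> real"
    using that by (auto simp: set_borel_measurable_def)
  have eq: "L2_sq S h = (\<integral>\<^sup>+x. ennreal ((indicator S x *\<^sub>R h x)\<^sup>2) \<partial>lebesgue)" for h
    unfolding L2_sq_def by (intro nn_integral_cong) (auto simp: indicator_def)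
  have le: "(a + b)\<^sup>2 \<le> 2 * a\<^sup>2 + 2 * b\<^sup>2" for a b :: real
    using zero_le_power2[of "a - b"] by (simp add: power2_eq_square algebra_simps)
  have "L2_sq S (\<lambda>x. f x + g x) \<le> (\<integral>\<^sup>+x. 2 * ennreal ((indicator S x *\<^sub>R f x)\<^sup>2) + 2 * ennreal ((indicator S x *\<^sub>R g x)\<^sup>2) \<partial>lebesgue)"
    unfolding eq
  proof (rule nn_integral_mono)
    fix x :: real
    have "ennreal ((a + b)\<^sup>2) \<le> 2 * ennreal (a\<^sup>2) + 2 * ennreal (b\<^sup>2)" for a b :: real
    proof -
      have "2 * ennreal (a\<^sup>2) + 2 * ennreal (b\<^sup>2) = ennreal (2 * a\<^sup>2 + 2 * b\<^sup>2)"
        by (subst ennreal_plus) (auto simp: ennreal_mult)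
      then show ?thesis using ennreal_leI[OF le[of a b]] by simp
    qed
    then show "ennreal ((indicator S x *\<^sub>R (f x + g x))\<^sup>2) \<le> 2 * ennreal ((indicator S x *\<^sub>R f x)\<^sup>2) + 2 * ennreal ((indicator S x *\<^sub>R g x)\<^sup>2)"
      unfolding scaleR_right_distrib by blast
  qed
  also have "\<dots> = 2 * L2_sq S f + 2 * L2_sq S g"
    unfolding eq using m[OF assms(1)] m[OF assms(2)]
    by (simp add: nn_integral_add nn_integral_cmult)
  finally show ?thesis .
qed

lemma C_L2_measurable:
  assumes "C_L2 x0 t0 f" "t \<in> {0..<t0}" "r \<le> t0 - t"
  shows "L2_on (ball x0 r) (\<lambda>x. f x t)"
proof -
  have "L2_on (ball x0 (t0 - t)) (\<lambda>x. f x t)" using assms by (auto simp: C_L2_def)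
  then show ?thesis by (rule L2_on_mono) (use assms in auto)
qed

text \<open>The ball is the one at the latest time \<open>s\<close>, since continuity in time is
  only available on a ball that is common to all times in \<open>[0, s]\<close>.\<close>

lemma C_L2_locally_bounded:
  assumes f: "C_L2 x0 t0 f" and s: "s \<in> {0..<t0}" and t: "t \<in> {0..s}"
  obtains \<delta> M where "\<delta> > 0" "M \<ge> 0"
    "\<And>\<tau>. \<tau> \<in> {0..s} \<Longrightarrow> \<bar>\<tau> - t\<bar> < \<delta> \<Longrightarrow> L2_sq (ball x0 (t0 - s)) (\<lambda>x. f x \<tau>) \<le> ennreal M"
proof -
  let ?B = "ball x0 (t0 - s)"
  have m: "L2_on ?B (\<lambda>x. f x \<tau>)" if "\<tau> \<in> {0..s}" for \<tau>
    by (rule C_L2_measurable[OF f]) (use that s in auto)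
  define m0 where "m0 = enn2real (L2_sq ?B (\<lambda>x. f x t))"
  have m0: "L2_sq ?B (\<lambda>x. f x t) = ennreal m0"
    using m[OF t] by (simp add: m0_def L2_on_def)
  have "((\<lambda>\<tau>. L2_sq ?B (\<lambda>x. f x \<tau> - f x t)) \<longlongrightarrow> 0) (at t within {0..s})"
    using f s t by (auto simp: C_L2_def)
  then have "\<forall>\<^sub>F \<tau> in at t within {0..s}. L2_sq ?B (\<lambda>x. f x \<tau> - f x t) < 1"
    by (rule order_tendstoD) simp
  then obtain \<delta> where \<delta>: "\<delta> > 0"
    "\<And>\<tau>. \<tau> \<in> {0..s} \<Longrightarrow> \<tau> \<noteq> t \<Longrightarrow> \<bar>\<tau> - t\<bar> < \<delta> \<Longrightarrow> L2_sq ?B (\<lambda>x. f x \<tau> - f x t) < 1"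
    unfolding eventually_at by (auto simp: dist_real_def)
  show thesis
  proof (rule that[OF \<delta>(1), of "2 + 2 * m0"])
    have "m0 \<ge> 0" by (simp add: m0_def)
    then show "2 + 2 * m0 \<ge> 0" by simp
    fix \<tau> assume \<tau>: "\<tau> \<in> {0..s}" "\<bar>\<tau> - t\<bar> < \<delta>"
    have le1: "L2_sq ?B (\<lambda>x. f x \<tau> - f x t) \<le> 1"
    proof (cases "\<tau> = t")
      case True then show ?thesis by (simp add: L2_sq_def)
    next
      case False then show ?thesis using \<delta>(2)[OF \<tau>(1) _ \<tau>(2)] by simp
    qed
    have ms: "set_borel_measurable lebesgue ?B (\<lambda>x. f x \<tau>)" "set_borel_measurable lebesgue ?B (\<lambda>x. f x t)"
      using m[OF \<tau>(1)] m[OF t] by (auto simp: L2_on_def)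
    then have "set_borel_measurable lebesgue ?B (\<lambda>x. f x \<tau> - f x t)"
      unfolding set_borel_measurable_def scaleR_right_diff_distrib by (rule borel_measurable_diff)
    from L2_sq_add_le[OF this ms(2)]
    have "L2_sq ?B (\<lambda>x. f x \<tau>) \<le> 2 * L2_sq ?B (\<lambda>x. f x \<tau> - f x t) + 2 * L2_sq ?B (\<lambda>x. f x t)" by simp
    also have "\<dots> \<le> 2 * 1 + 2 * ennreal m0"
      unfolding m0 by (intro add_mono mult_left_mono le1) auto
    also have "\<dots> = ennreal (2 + 2 * m0)"
      using \<open>m0 \<ge> 0\<close> by (simp add: ennreal_plus ennreal_mult)
    finally show "L2_sq ?B (\<lambda>x. f x \<tau>) \<le> ennreal (2 + 2 * m0)" .
  qed
qed

text \<open>Bounds near each time come from the estimate for weak derivatives, and Bolzano's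
  bisection principle glues them together on \<open>[0, t1]\<close>. The gap \<open>g\<close> keeps
  away from the lateral boundary of the cone, where no uniform bound is available.\<close>

lemma C_H1_bounded:
  assumes u: "C_H1 x0 t0 u" and g: "g > 0" "0 \<le> t1" "t1 + g < t0"
  obtains K where "\<And>\<tau>. \<tau> \<in> {0..t1} \<Longrightarrow> AE x in lebesgue. x \<in> ball x0 (t0 - g - \<tau>) \<longrightarrow> \<bar>u x \<tau>\<bar> \<le> K"
proof -
  obtain ux where ux: "C_L2 x0 t0 u" "C_L2 x0 t0 ux"
    "\<And>t. t \<in> {0..<t0} \<Longrightarrow> weak_deriv_on (ball x0 (t0 - t)) (\<lambda>x. u x t) (\<lambda>x. ux x t)"
    using u by (auto simp: C_H1_def)
  \<comment> \<open>The intervals of the bisection argument may reach below time 0, hence the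
    intersection.\<close>
  define P where "P a b \<longleftrightarrow> (\<exists>K. \<forall>\<tau>\<in>{a..b} \<inter> {0..}. AE x in lebesgue. x \<in> ball x0 (t0 - g - \<tau>) \<longrightarrow> \<bar>u x \<tau>\<bar> \<le> K)" for a b
  have "P 0 t1"
    using g(2)
  proof (induction rule: Bolzano)
    case (trans a b c)
    then obtain K K' where K: "\<And>\<tau>. \<tau> \<in> {a..b} \<inter> {0..} \<Longrightarrow> AE x in lebesgue. x \<in> ball x0 (t0 - g - \<tau>) \<longrightarrow> \<bar>u x \<tau>\<bar> \<le> K"
      "\<And>\<tau>. \<tau> \<in> {b..c} \<inter> {0..} \<Longrightarrow> AE x in lebesgue. x \<in> ball x0 (t0 - g - \<tau>) \<longrightarrow> \<bar>u x \<tau>\<bar> \<le> K'"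
      unfolding P_def by blast
    show ?case
      unfolding P_def
    proof (intro exI ballI)
      fix \<tau> assume "\<tau> \<in> {a..c} \<inter> {0..}"
      then consider "\<tau> \<in> {a..b} \<inter> {0..}" | "\<tau> \<in> {b..c} \<inter> {0..}" by force
      then show "AE x in lebesgue. x \<in> ball x0 (t0 - g - \<tau>) \<longrightarrow> \<bar>u x \<tau>\<bar> \<le> max K K'"
      proof cases
        case 1 from K(1)[OF 1] show ?thesis by eventually_elim auto
      next
        case 2 from K(2)[OF 2] show ?thesis by eventually_elim auto
      qed
    qed
  next
    case (local t)
    \<comment> \<open>Half of the gap: times up to \<open>g/2\<close> after \<open>t\<close> are
      still covered by \<open>[0, s]\<close>, and for times down to \<open>g/2\<close> before
      \<open>t\<close> the ball of radius \<open>t0 - g - \<tau>\<close> is still contained in the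
      ball at time \<open>s\<close>.\<close>
    define s where "s = t + g/2"
    have s: "s \<in> {0..<t0}" and ts: "t \<in> {0..s}" using local g by (auto simp: s_def)
    let ?B = "ball x0 (t0 - s)"
    obtain \<delta> M where M: "\<delta> > 0" "M \<ge> 0"
      "\<And>\<tau>. \<tau> \<in> {0..s} \<Longrightarrow> \<bar>\<tau> - t\<bar> < \<delta> \<Longrightarrow> L2_sq ?B (\<lambda>x. u x \<tau>) \<le> ennreal M"
      using C_L2_locally_bounded[OF ux(1) s ts] by blast
    obtain \<delta>' M' where M': "\<delta>' > 0" "M' \<ge> 0"
      "\<And>\<tau>. \<tau> \<in> {0..s} \<Longrightarrow> \<bar>\<tau> - t\<bar> < \<delta>' \<Longrightarrow> L2_sq ?B (\<lambda>x. ux x \<tau>) \<le> ennreal M'"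
      using C_L2_locally_bounded[OF ux(2) s ts] by blast
    obtain K where K: "K \<ge> 0"
      "\<And>v w M. L2_on ?B v \<Longrightarrow> L2_on ?B w \<Longrightarrow> weak_deriv_on ?B v w \<Longrightarrow>
       L2_sq ?B v \<le> ennreal M \<Longrightarrow> L2_sq ?B w \<le> ennreal M \<Longrightarrow> 0 \<le> M \<Longrightarrow>
       AE x in lebesgue. x \<in> ?B \<longrightarrow> \<bar>v x\<bar> \<le> K * (1 + M)"
      using weak_deriv_AE_bound[of "t0 - s" x0] s by auto
    define d where "d = min (min \<delta> \<delta>') (g/2)"
    have d: "d > 0" using M M' g by (auto simp: d_def)
    have bd: "AE x in lebesgue. x \<in> ball x0 (t0 - g - \<tau>) \<longrightarrow> \<bar>u x \<tau>\<bar> \<le> K * (1 + max M M')"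
      if \<tau>: "\<bar>\<tau> - t\<bar> < d" "0 \<le> \<tau>" for \<tau>
    proof -
      have "\<tau> < t + g/2" using \<tau> unfolding d_def by linarith
      then have ts: "\<tau> \<in> {0..s}" using \<tau> by (auto simp: s_def)
      then have st: "\<tau> \<in> {0..<t0}" "t0 - s \<le> t0 - \<tau>" using s by auto
      have "AE x in lebesgue. x \<in> ?B \<longrightarrow> \<bar>u x \<tau>\<bar> \<le> K * (1 + max M M')"
      proof (rule K(2))
        show "L2_on ?B (\<lambda>x. u x \<tau>)" "L2_on ?B (\<lambda>x. ux x \<tau>)"
          by (rule C_L2_measurable[OF ux(1) st] C_L2_measurable[OF ux(2) st])+
        show "weak_deriv_on ?B (\<lambda>x. u x \<tau>) (\<lambda>x. ux x \<tau>)"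
          by (rule weak_deriv_on_mono[OF ux(3)[OF st(1)]]) (use st in auto)
        show "L2_sq ?B (\<lambda>x. u x \<tau>) \<le> ennreal (max M M')"
          using M(3)[OF ts] \<tau> by (auto simp: d_def intro: order_trans[OF _ ennreal_leI])
        show "L2_sq ?B (\<lambda>x. ux x \<tau>) \<le> ennreal (max M M')"
          using M'(3)[OF ts] \<tau> by (auto simp: d_def intro: order_trans[OF _ ennreal_leI])
        show "0 \<le> max M M'" using M by auto
      qed
      moreover have "t0 - g - \<tau> \<le> t0 - s" using \<tau> unfolding d_def s_def by linarith
      then have "ball x0 (t0 - g - \<tau>) \<subseteq> ?B" by (rule subset_ball)
      ultimately show ?thesis by (auto elim!: eventually_mono)
    qed
    show ?case
    proof (intro exI conjI allI impI)
      show "0 < d" by fact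
      fix a b assume ab: "a \<le> t \<and> t \<le> b \<and> b - a < d"
      show "P a b"
        unfolding P_def
      proof (intro exI ballI)
        fix \<tau> assume "\<tau> \<in> {a..b} \<inter> {0..}"
        then show "AE x in lebesgue. x \<in> ball x0 (t0 - g - \<tau>) \<longrightarrow> \<bar>u x \<tau>\<bar> \<le> K * (1 + max M M')"
          using ab by (intro bd) auto
      qed
    qed
  qed
  then show thesis using that unfolding P_def by force
qed

text \<open>The inequality \<open>\<bar>a\<bar> \<le> k + a^2 / k\<close>, with \<open>k\<close>
  proportional to the tolerance, replaces Cauchy-Schwarz.\<close>

lemma L1_tendsto_of_L2:
  fixes f :: "'b \<Rightarrow> real \<Rightarrow> real"
  assumes L: "((\<lambda>\<tau>. L2_sq B (f \<tau>)) \<longlongrightarrow> 0) F" and B: "B \<in> lmeasurable"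
    and on: "\<forall>\<^sub>F \<tau> in F. L2_on B (f \<tau>)"
  shows "((\<lambda>\<tau>. LINT x:B|lebesgue. \<bar>f \<tau> x\<bar>) \<longlongrightarrow> 0) F"
proof (rule tendstoI)
  fix e :: real assume e: "e > 0"
  define m where "m = measure lebesgue B"
  have m: "m \<ge> 0" by (simp add: m_def)
  define k where "k = e / (2 * (m + 1))"
  have k: "k > 0" "k * m < e" using e m by (auto simp: k_def field_simps intro: add_nonneg_pos)
  have "\<forall>\<^sub>F \<tau> in F. L2_sq B (f \<tau>) < ennreal (k * (e - k * m))"
    using L by (rule order_tendstoD) (use k in auto)
  with on show "\<forall>\<^sub>F \<tau> in F. dist (LINT x:B|lebesgue. \<bar>f \<tau> x\<bar>) 0 < e"
  proof eventually_elim
    case (elim \<tau>)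
    note sq = L2_on_square_integrable[OF elim(1)] and i = L2_on_integrable(1)[OF elim(1) B]
    have one: "set_integrable lebesgue B (\<lambda>x. k)"
      by (rule set_integrable_const[OF B])
    have b: "\<bar>a\<bar> \<le> k + (1/k) * a\<^sup>2" for a :: real
    proof -
      have "0 \<le> (\<bar>a\<bar> - k)\<^sup>2" by simp
      then have "2 * k * \<bar>a\<bar> \<le> k\<^sup>2 + a\<^sup>2" by (simp add: power2_diff mult_ac add.commute)
      then have "k * \<bar>a\<bar> \<le> k\<^sup>2 + a\<^sup>2" using k mult_nonneg_nonneg[of k "\<bar>a\<bar>"] by linarith
      then show ?thesis using k by (simp add: field_simps power2_eq_square)
    qed
    have "(LINT x:B|lebesgue. \<bar>f \<tau> x\<bar>) \<le> (LINT x:B|lebesgue. k + (1/k) * (f \<tau> x)\<^sup>2)"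
      by (rule set_integral_mono[OF set_integrable_abs[OF i] set_integral_add(1)[OF one]])
        (use sq(1) b in auto)
    also have "\<dots> = (LINT x:B|lebesgue. k) + (1/k) * (LINT x:B|lebesgue. (f \<tau> x)\<^sup>2)"
      by (subst set_integral_add(2)[OF one]) (use sq(1) in auto)
    also have "(LINT x:B|lebesgue. k) = k * m"
      using B by (simp add: set_lebesgue_integral_def m_def fmeasurable_def)
    also have "(LINT x:B|lebesgue. (f \<tau> x)\<^sup>2) < k * (e - k * m)"
    proof -
      have X: "ennreal (enn2real (L2_sq B (f \<tau>))) = L2_sq B (f \<tau>)" using elim(1) by (simp add: L2_on_def)
      have "ennreal (enn2real (L2_sq B (f \<tau>))) < ennreal (k * (e - k * m))" unfolding X by (rule elim(2))
      then show ?thesis unfolding sq(2) by (simp add: ennreal_less_iff)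
    qed
    then have "k * m + (1/k) * (LINT x:B|lebesgue. (f \<tau> x)\<^sup>2) < e"
      using k by (simp add: field_simps)
    finally have "(LINT x:B|lebesgue. \<bar>f \<tau> x\<bar>) < e" using k by (simp add: mult.commute)
    moreover have "0 \<le> (LINT x:B|lebesgue. \<bar>f \<tau> x\<bar>)"
      unfolding set_lebesgue_integral_def by (auto intro!: integral_nonneg_AE)
    ultimately show ?case by simp
  qed
qed


lemma exp_diff_le:
  fixes a b K :: real
  assumes "a \<le> K" "b \<le> K" shows "\<bar>exp a - exp b\<bar> \<le> exp K * \<bar>a - b\<bar>"
proof -
  have *: "exp a - exp b \<le> exp K * (a - b)" if "b \<le> a" "a \<le> K" for a b :: real
  proof -
    have "1 + (b - a) \<le> exp (b - a)" by simp
    then have "exp a * (1 + (b - a)) \<le> exp a * exp (b - a)" by (intro mult_left_mono) auto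
    then have "exp a - exp b \<le> exp a * (a - b)" by (simp add: mult_exp_exp algebra_simps)
    also have "\<dots> \<le> exp K * (a - b)" using that by (intro mult_right_mono) auto
    finally show ?thesis .
  qed
  show ?thesis using *[of a b] *[of b a] assms by (cases "b \<le> a") (auto simp: abs_if)
qed

text \<open>An oriented integral: for \<open>y \<noteq> 0\<close> one of the two intervals is
  empty.\<close>

definition prim :: "(real \<Rightarrow> real) \<Rightarrow> real \<Rightarrow> real" where
  "prim f y = integral {0..y} f - integral {y..0} f"

text \<open>The double integral of \<open>duhamel\<close> without its factor 1/2, as a gauge
  integral, for which continuity and differentiation in the endpoints are at hand.\<close>

definition duh :: "(real \<Rightarrow> real \<Rightarrow> real) \<Rightarrow> real \<Rightarrow> real \<Rightarrow> real" where
  "duh F x t = integral {0..t} (\<lambda>\<tau>. integral {x - t + \<tau>..x + t - \<tau>} (\<lambda>z. F z \<tau>))"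

lemma prim_eq:
  assumes f: "\<And>a b. f integrable_on {a..b}" and "c \<le> 0" "c \<le> y"
  shows "prim f y = integral {c..y} f - integral {c..0} f"
proof (cases "0 \<le> y")
  case True
  then have "prim f y = integral {0..y} f" by (cases "y = 0") (auto simp: prim_def)
  then show ?thesis using Henstock_Kurzweil_Integration.integral_combine[OF assms(2) True f] by simp
next
  case False
  then have "prim f y = - integral {y..0} f" by (auto simp: prim_def)
  then show ?thesis using Henstock_Kurzweil_Integration.integral_combine[OF assms(3) _ f, of 0] False by simp
qed

lemma prim_diff:
  assumes f: "\<And>a b. f integrable_on {a..b}" and "x \<le> y"
  shows "prim f y - prim f x = integral {x..y} f"
proof -
  define c where "c = min 0 x"
  have "prim f y = integral {c..y} f - integral {c..0} f" "prim f x = integral {c..x} f - integral {c..0} f"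
    by (rule prim_eq[OF f]; use assms in \<open>simp add: c_def\<close>)+
  then show ?thesis
    using Henstock_Kurzweil_Integration.integral_combine[of c x y f] assms by (simp add: c_def)
qed

lemma prim_continuous:
  assumes f: "\<And>a b. f integrable_on {a..b}" shows "continuous_on S (prim f)"
proof -
  have "isCont (prim f) y" for y
  proof -
    let ?c = "\<bar>y\<bar> + 1"
    have "continuous_on {-?c..?c} (\<lambda>y. integral {-?c..y} f - integral {-?c..0} f)"
      by (intro continuous_intros indefinite_integral_continuous_1 f)
    then have "continuous_on {-?c..?c} (prim f)"
      by (rule continuous_on_eq) (subst prim_eq[OF f, of "-?c"], auto)
    then show ?thesis by (rule continuous_on_interior) (auto simp: abs_if)
  qed
  then show ?thesis by (simp add: continuous_at_imp_continuous_on)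
qed

lemma L2_locu_integrable:
  assumes "L2_locu f" shows "set_integrable lebesgue {a..b} f" and "f integrable_on {a..b}"
proof -
  have m: "f \<in> borel_measurable lebesgue" and s: "(SUP a. L2_sq {a - 1..a + 1} f) < \<infinity>"
    using assms by (auto simp: L2_locu_def)
  have one: "set_integrable lebesgue {a - 1..a + 1} f" for a
  proof (rule L2_on_integrable)
    have "L2_sq {a - 1..a + 1} f \<le> (SUP a. L2_sq {a - 1..a + 1} f)" by (rule SUP_upper) auto
    from le_less_trans[OF this s] have "L2_sq {a - 1..a + 1} f < \<infinity>" .
    moreover have "set_borel_measurable lebesgue {a - 1..a + 1} f"
      unfolding set_borel_measurable_def using m by (intro borel_measurable_scaleR borel_measurable_indicator) auto
    ultimately show "L2_on {a - 1..a + 1} f" by (simp add: L2_on_def)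
  qed auto
  have n: "set_integrable lebesgue {a..a + real n} f" for n
  proof (induction n)
    case 0
    show ?case by (rule set_integrable_subset[OF one[of a]]) auto
  next
    case (Suc n)
    have "set_integrable lebesgue {a + real n..a + real n + 1} f"
      by (rule set_integrable_subset[OF one[of "a + real n"]]) auto
    with Suc have "set_integrable lebesgue ({a..a + real n} \<union> {a + real n..a + real n + 1}) f"
      by (intro set_integrable_Un) auto
    moreover have "{a..a + real n} \<union> {a + real n..a + real n + 1} = {a..a + real (Suc n)}" by auto
    ultimately show ?case by simp
  qed
  show "set_integrable lebesgue {a..b} f"
    by (rule set_integrable_subset[OF n[of "nat \<lceil>b - a\<rceil>"]]) (auto, linarith)
  then show "f integrable_on {a..b}" by (rule set_lebesgue_integral_eq_integral)
qed

lemma set_integrable_bounded_AE: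
  fixes f :: "real \<Rightarrow> real"
  assumes "set_borel_measurable lebesgue S f" "S \<in> lmeasurable"
    and "AE x in lebesgue. x \<in> S \<longrightarrow> \<bar>f x\<bar> \<le> E"
  shows "set_integrable lebesgue S f" and "\<bar>LINT x:S|lebesgue. f x\<bar> \<le> E * measure lebesgue S"
proof -
  have c: "set_integrable lebesgue S (\<lambda>x. E)" by (rule set_integrable_const[OF assms(2)])
  show i: "set_integrable lebesgue S f"
    unfolding set_integrable_def
    by (rule Bochner_Integration.integrable_bound[OF c[unfolded set_integrable_def]])
      (use assms(1,3) in \<open>auto simp: set_borel_measurable_def indicator_def abs_mult elim!: eventually_mono\<close>)
  have "\<bar>LINT x:S|lebesgue. f x\<bar> \<le> (LINT x:S|lebesgue. \<bar>f x\<bar>)"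
    using set_integral_norm_bound[OF i] by simp
  also have "\<dots> \<le> (LINT x:S|lebesgue. E)"
    by (rule set_integral_mono_AE[OF set_integrable_abs[OF i] c]) (use assms(3) in \<open>auto elim!: eventually_mono\<close>)
  also have "\<dots> = E * measure lebesgue S"
    using assms(2) by (simp add: set_lebesgue_integral_def fmeasurable_def)
  finally show "\<bar>LINT x:S|lebesgue. f x\<bar> \<le> E * measure lebesgue S" .
qed

text \<open>Both integrals are differences of one primitive that starts at the smaller of the two
  left ends, and this primitive has the Lipschitz constant \<open>E\<close>.\<close>

lemma integral_endpoints_diff:
  fixes f :: "real \<Rightarrow> real"
  assumes S: "set_borel_measurable lebesgue (ball c r) f" and E: "AE x in lebesgue. x \<in> ball c r \<longrightarrow> \<bar>f x\<bar> \<le> E"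
    and E0: "0 \<le> E"
    and ab: "a \<le> b" "a' \<le> b'" "{a..b} \<subseteq> ball c r" "{a'..b'} \<subseteq> ball c r"
  shows "\<bar>(LINT x:{a..b}|lebesgue. f x) - (LINT x:{a'..b'}|lebesgue. f x)\<bar> \<le> E * (\<bar>a - a'\<bar> + \<bar>b - b'\<bar>)"
    and "f integrable_on {a..b}" "(LINT x:{a..b}|lebesgue. f x) = integral {a..b} f"
    and "\<bar>LINT x:{a..b}|lebesgue. f x\<bar> \<le> E * (b - a)"
proof -
  have i: "set_integrable lebesgue {u..v} f" "\<bar>LINT x:{u..v}|lebesgue. f x\<bar> \<le> E * measure lebesgue {u..v}"
    if "{u..v} \<subseteq> ball c r" for u v
    by (rule set_integrable_bounded_AE; use that set_borel_measurable_mono[OF S] E in \<open>auto elim!: eventually_mono\<close>)+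
  have hk: "f integrable_on {u..v}" "(LINT x:{u..v}|lebesgue. f x) = integral {u..v} f"
    if "{u..v} \<subseteq> ball c r" for u v
    using set_lebesgue_integral_eq_integral[OF i(1)[OF that]] by auto
  show "f integrable_on {a..b}" "(LINT x:{a..b}|lebesgue. f x) = integral {a..b} f" using hk ab by auto
  show "\<bar>LINT x:{a..b}|lebesgue. f x\<bar> \<le> E * (b - a)" using i(2)[OF ab(3)] ab by simp
  define m where "m = min a a'"
  have ball: "ball c r = {c - r<..<c + r}" by (auto simp: dist_real_def)
  have ends: "a \<in> ball c r" "b \<in> ball c r" "a' \<in> ball c r" "b' \<in> ball c r" using ab by auto
  have sub: "{u..v} \<subseteq> ball c r" if "u \<in> ball c r" "v \<in> ball c r" for u v
    using that unfolding ball by auto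
  have "m \<in> ball c r" using ends by (auto simp: m_def min_def)
  define P where "P y = integral {m..y} f" for y
  have Pd: "\<bar>P y - P x\<bar> \<le> E * \<bar>y - x\<bar>" "integral {x..y} f = P y - P x"
    if "m \<le> x" "x \<le> y" "x \<in> ball c r" "y \<in> ball c r" for x y
  proof -
    have "integral {m..x} f + integral {x..y} f = integral {m..y} f"
      by (rule Henstock_Kurzweil_Integration.integral_combine) (use that hk sub \<open>m \<in> ball c r\<close> in auto)
    then show "integral {x..y} f = P y - P x" by (simp add: P_def)
    then show "\<bar>P y - P x\<bar> \<le> E * \<bar>y - x\<bar>"
      using i(2)[OF sub[OF that(3,4)]] hk(2)[OF sub[OF that(3,4)]] that by simp
  qed
  have Pd': "\<bar>P y - P x\<bar> \<le> E * \<bar>y - x\<bar>" if "m \<le> x" "m \<le> y" "x \<in> ball c r" "y \<in> ball c r" for x y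
    using Pd(1)[of x y] Pd(1)[of y x] that by (cases "x \<le> y") (auto simp: abs_minus_commute)
  have "(LINT x:{a..b}|lebesgue. f x) = P b - P a" "(LINT x:{a'..b'}|lebesgue. f x) = P b' - P a'"
    using hk(2)[OF ab(3)] hk(2)[OF ab(4)] Pd(2)[of a b] Pd(2)[of a' b'] ends ab by (auto simp: m_def)
  moreover have "\<bar>P a - P a'\<bar> \<le> E * \<bar>a - a'\<bar>" "\<bar>P b - P b'\<bar> \<le> E * \<bar>b - b'\<bar>"
    using ends ab by (auto intro!: Pd' simp: m_def)
  ultimately show "\<bar>(LINT x:{a..b}|lebesgue. f x) - (LINT x:{a'..b'}|lebesgue. f x)\<bar> \<le> E * (\<bar>a - a'\<bar> + \<bar>b - b'\<bar>)"
    by (simp add: distrib_left)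
qed

text \<open>Slices of \<open>u\<close> are controlled only as elements of L2, so the inner Duhamel
  integral has to be examined before \<open>u\<close> itself is known to be continuous. Moving the
  endpoints costs at most the bound \<open>E\<close> on \<open>exp u\<close> times the displacement.
  Moving the time costs in addition the L1 distance of two slices, which tends to 0 by continuity in
  time. Continuity in \<tau> also allows the outer integral to be read as a gauge integral.\<close>

lemma solution_local:
  assumes u: "C_H1 x0 t0 u" and t: "0 \<le> t" "\<bar>x - x0\<bar> < t0 - t"
  defines "F \<equiv> \<lambda>x t \<tau>. (LINT z:{x - t + \<tau>..x + t - \<tau>}|lebesgue. exp (u z \<tau>))"
  obtains \<epsilon> E where "\<epsilon> > 0" "E \<ge> 0"
    "\<And>x' t' \<tau>. \<bar>x' - x\<bar> + \<bar>t' - t\<bar> < \<epsilon> \<Longrightarrow> \<tau> \<in> {0..t'} \<Longrightarrow> F x' t' \<tau> = integral {x' - t' + \<tau>..x' + t' - \<tau>} (\<lambda>z. exp (u z \<tau>))"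
    "\<And>x' t' \<tau>. \<bar>x' - x\<bar> + \<bar>t' - t\<bar> < \<epsilon> \<Longrightarrow> \<tau> \<in> {0..t'} \<Longrightarrow> \<bar>F x' t' \<tau>\<bar> \<le> E * (2 * (t' - \<tau>))"
    "\<And>x' t' \<tau>. \<bar>x' - x\<bar> + \<bar>t' - t\<bar> < \<epsilon> \<Longrightarrow> \<tau> \<in> {0..t'} \<Longrightarrow> \<tau> \<le> t \<Longrightarrow> \<bar>F x' t' \<tau> - F x t \<tau>\<bar> \<le> E * (2 * (\<bar>x' - x\<bar> + \<bar>t' - t\<bar>))"
    "\<And>x' t'. \<bar>x' - x\<bar> + \<bar>t' - t\<bar> < \<epsilon> \<Longrightarrow> continuous_on {0..t'} (F x' t')"
proof -
  define \<rho> where "\<rho> = t0 - t - \<bar>x - x0\<bar>"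
  have \<rho>: "\<rho> > 0" using t by (simp add: \<rho>_def)
  \<comment> \<open>A quarter of the slack: one part is the gap of the sup bound, one is for moving
    the vertex, and the rest leaves strict inequalities.\<close>
  define g where "g = \<rho> / 4"
  define t1 where "t1 = t + g"
  have g: "g > 0" "0 \<le> t1" "t1 + g < t0"
  proof -
    show g0: "g > 0" using \<rho> by (simp add: g_def)
    show "0 \<le> t1" using g0 t by (simp add: t1_def)
    have "4 * g \<le> t0 - t" by (simp add: g_def \<rho>_def)
    then show "t1 + g < t0" using g0 unfolding t1_def by linarith
  qed
  obtain K where K: "\<And>\<tau>. \<tau> \<in> {0..t1} \<Longrightarrow> AE x in lebesgue. x \<in> ball x0 (t0 - g - \<tau>) \<longrightarrow> \<bar>u x \<tau>\<bar> \<le> K"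
    using C_H1_bounded[OF u g] by blast
  define E where "E = exp K"
  have cl: "C_L2 x0 t0 u" using u by (simp add: C_H1_def)
  have E: "AE z in lebesgue. z \<in> ball x0 (t0 - g - \<tau>) \<longrightarrow> \<bar>exp (u z \<tau>)\<bar> \<le> E" if "\<tau> \<in> {0..t1}" for \<tau>
    using K[OF that] by eventually_elim (auto simp: E_def)
  have um: "set_borel_measurable lebesgue (ball x0 (t0 - g - \<tau>)) (\<lambda>z. u z \<tau>)" if "\<tau> \<in> {0..t1}" for \<tau>
    using C_L2_measurable[OF cl, of \<tau> "t0 - g - \<tau>"] that g by (auto simp: L2_on_def)
  have em: "set_borel_measurable lebesgue S (\<lambda>z. exp (u z \<tau>))"
    if "set_borel_measurable lebesgue S (\<lambda>z. u z \<tau>)" "S \<in> sets lebesgue" for S \<tau>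
  proof -
    have "(\<lambda>z. indicator S z * exp (indicator S z *\<^sub>R u z \<tau>)) \<in> borel_measurable lebesgue"
      using that by (intro borel_measurable_times borel_measurable_indicator borel_measurable_exp) (auto simp: set_borel_measurable_def)
    moreover have "(\<lambda>z. indicator S z * exp (indicator S z *\<^sub>R u z \<tau>)) = (\<lambda>z. indicator S z *\<^sub>R exp (u z \<tau>))"
      by (auto simp: indicator_def fun_eq_iff)
    ultimately show ?thesis unfolding set_borel_measurable_def by argo
  qed
  have sub: "{x' - t' + \<tau>..x' + t' - \<tau>} \<subseteq> ball x0 (t0 - g - \<tau>)" "\<tau> \<in> {0..t1}" "x' - t' + \<tau> \<le> x' + t' - \<tau>"
    if "\<bar>x' - x\<bar> + \<bar>t' - t\<bar> < g" "\<tau> \<in> {0..t'}" for x' t' \<tau>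
  proof -
    show "\<tau> \<in> {0..t1}" "x' - t' + \<tau> \<le> x' + t' - \<tau>" using that by (auto simp: t1_def)
    have zb: "\<bar>x0 - z\<bar> < t0 - g - \<tau>" if "z \<in> {x' - t' + \<tau>..x' + t' - \<tau>}" for z
    proof -
      have "\<bar>z - x'\<bar> \<le> t' - \<tau>" using that by auto
      then have "\<bar>z - x0\<bar> \<le> \<bar>x - x0\<bar> + g + t - \<tau>"
        using \<open>\<bar>x' - x\<bar> + \<bar>t' - t\<bar> < g\<close> by linarith
      moreover have "\<bar>x - x0\<bar> + t = t0 - 4 * g" unfolding g_def \<rho>_def by simp argo
      ultimately show ?thesis using g(1) by linarith
    qed
    show "{x' - t' + \<tau>..x' + t' - \<tau>} \<subseteq> ball x0 (t0 - g - \<tau>)"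
      by (rule subsetI) (use zb in \<open>simp add: dist_real_def\<close>)
  qed
  have E0: "0 \<le> E" by (simp add: E_def)
  note ends = integral_endpoints_diff[OF em[OF um] E E0]
  have cont: "continuous_on {0..t'} (F x' t')" if n: "\<bar>x' - x\<bar> + \<bar>t' - t\<bar> < g" for x' t'
    unfolding continuous_on_def
  proof
    fix t1' assume t1': "t1' \<in> {0..t'}"
    \<comment> \<open>Continuity in time is used on the ball at the later time \<open>s\<close>, so
      that \<open>t1'\<close> can be approached from above as well.\<close>
    define s where "s = t1' + g"
    have s: "s \<in> {0..<t0}" "t1' \<in> {0..s}" using t1' n g by (auto simp: s_def t1_def)
    define B where "B = ball x0 (t0 - s)"
    have Bm: "B \<in> lmeasurable" by (simp add: B_def)
    have on: "L2_on B (\<lambda>z. u z \<tau>)" if "\<tau> \<in> {0..s}" for \<tau>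
      unfolding B_def using that s by (intro C_L2_measurable[OF cl]) auto
    have on2: "L2_on B (\<lambda>z. u z \<tau> - u z t1')" if "\<tau> \<in> {0..s}" "L2_sq B (\<lambda>z. u z \<tau> - u z t1') < \<infinity>" for \<tau>
      using on[OF that(1)] on[OF s(2)] that(2)
      unfolding L2_on_def set_borel_measurable_def scaleR_right_diff_distrib by (auto intro: borel_measurable_diff)
    have "((\<lambda>\<tau>. L2_sq B (\<lambda>z. u z \<tau> - u z t1')) \<longlongrightarrow> 0) (at t1' within {0..s})"
      using cl s by (auto simp: C_L2_def B_def)
    moreover from this have "\<forall>\<^sub>F \<tau> in at t1' within {0..s}. L2_sq B (\<lambda>z. u z \<tau> - u z t1') < 1"
      by (rule order_tendstoD) simp
    moreover have "\<forall>\<^sub>F \<tau> in at t1' within {0..s}. \<tau> \<in> {0..s}" by (simp add: eventually_at_filter)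
    ultimately have L1: "((\<lambda>\<tau>. LINT z:B|lebesgue. \<bar>u z \<tau> - u z t1'\<bar>) \<longlongrightarrow> 0) (at t1' within {0..s})"
      and ev: "\<forall>\<^sub>F \<tau> in at t1' within {0..s}. L2_on B (\<lambda>z. u z \<tau> - u z t1')"
    proof -
      assume a: "((\<lambda>\<tau>. L2_sq B (\<lambda>z. u z \<tau> - u z t1')) \<longlongrightarrow> 0) (at t1' within {0..s})"
       and b: "\<forall>\<^sub>F \<tau> in at t1' within {0..s}. L2_sq B (\<lambda>z. u z \<tau> - u z t1') < 1"
       and c: "\<forall>\<^sub>F \<tau> in at t1' within {0..s}. \<tau> \<in> {0..s}"
      from b c show "\<forall>\<^sub>F \<tau> in at t1' within {0..s}. L2_on B (\<lambda>z. u z \<tau> - u z t1')"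
        by eventually_elim (rule on2, auto intro: less_trans)
      from L1_tendsto_of_L2[OF a Bm this]
      show "((\<lambda>\<tau>. LINT z:B|lebesgue. \<bar>u z \<tau> - u z t1'\<bar>) \<longlongrightarrow> 0) (at t1' within {0..s})" .
    qed
    have "((\<lambda>\<tau>. E * (2 * \<bar>\<tau> - t1'\<bar>) + E * (LINT z:B|lebesgue. \<bar>u z \<tau> - u z t1'\<bar>)) \<longlongrightarrow> E * (2 * \<bar>t1' - t1'\<bar>) + E * 0) (at t1' within {0..s})"
      by (intro tendsto_intros L1)
    then have lim: "((\<lambda>\<tau>. E * (2 * \<bar>\<tau> - t1'\<bar>) + E * (LINT z:B|lebesgue. \<bar>u z \<tau> - u z t1'\<bar>)) \<longlongrightarrow> 0) (at t1' within {0..s})" by simp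
    have "\<forall>\<^sub>F \<tau> in at t1' within {0..s}. \<tau> \<in> {0..t'} \<longrightarrow>
        \<bar>F x' t' \<tau> - F x' t' t1'\<bar> \<le> E * (2 * \<bar>\<tau> - t1'\<bar>) + E * (LINT z:B|lebesgue. \<bar>u z \<tau> - u z t1'\<bar>)"
      using ev
    proof eventually_elim
      case (elim \<tau>)
      show ?case
      proof
        assume \<tau>: "\<tau> \<in> {0..t'}"
        \<comment> \<open>The intervals of integration shrink with time. Both slices are compared on
          the interval of the later time \<open>m\<close>; the excess is covered by the bound
          \<open>E\<close>.\<close>
        define m where "m = max \<tau> t1'"
        have m: "m \<in> {0..t'}" "\<tau> \<le> m" "t1' \<le> m" using \<tau> t1' by (auto simp: m_def)
        define a where "a = x' - t' + m"
        define b where "b = x' + t' - m"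
        have ab: "a \<le> b" "{a..b} \<subseteq> ball x0 (t0 - g - m)" using sub[OF n m(1)] by (auto simp: a_def b_def)
        have abs: "{a..b} \<subseteq> ball x0 (t0 - g - \<tau>)" "{a..b} \<subseteq> ball x0 (t0 - g - t1')" "{a..b} \<subseteq> B"
          using ab(2) m subset_ball[of "t0 - g - m" "t0 - g - \<tau>" x0] subset_ball[of "t0 - g - m" "t0 - g - t1'" x0]
          by (auto simp: B_def s_def diff_diff_eq add.commute)
        note \<tau>1 = sub[OF n \<tau>] and t11 = sub[OF n t1']
        have 1: "\<bar>F x' t' \<tau> - (LINT z:{a..b}|lebesgue. exp (u z \<tau>))\<bar> \<le> E * (2 * (m - \<tau>))"
          using ends(1)[OF \<tau>1(2) _ \<tau>1(2) \<tau>1(3) ab(1) \<tau>1(1) abs(1)] m by (simp add: F_def a_def b_def)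
        have 2: "\<bar>F x' t' t1' - (LINT z:{a..b}|lebesgue. exp (u z t1'))\<bar> \<le> E * (2 * (m - t1'))"
          using ends(1)[OF t11(2) _ t11(2) t11(3) ab(1) t11(1) abs(2)] m by (simp add: F_def a_def b_def)
        have si: "set_integrable lebesgue {a..b} (\<lambda>z. exp (u z \<tau>))" if "\<tau> \<in> {0..t1}" "{a..b} \<subseteq> ball x0 (t0 - g - \<tau>)" for \<tau>
          by (rule set_integrable_bounded_AE[where E=E])
            (use that E[OF that(1)] set_borel_measurable_mono[OF em[OF um[OF that(1)]]] in \<open>auto elim!: eventually_mono\<close>)
        note sia = si[OF \<tau>1(2) abs(1)] and sib = si[OF t11(2) abs(2)]
        have sid: "set_integrable lebesgue B (\<lambda>z. u z \<tau> - u z t1')" by (rule L2_on_integrable(1)[OF elim Bm])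
        have "\<bar>(LINT z:{a..b}|lebesgue. exp (u z \<tau>)) - (LINT z:{a..b}|lebesgue. exp (u z t1'))\<bar>
           = \<bar>LINT z:{a..b}|lebesgue. exp (u z \<tau>) - exp (u z t1')\<bar>"
          by (subst set_integral_diff(2)[OF sia sib]) simp
        also have "\<dots> \<le> (LINT z:{a..b}|lebesgue. \<bar>exp (u z \<tau>) - exp (u z t1')\<bar>)"
          using set_integral_norm_bound[OF set_integral_diff(1)[OF sia sib]] by simp
        also have "\<dots> \<le> (LINT z:{a..b}|lebesgue. E * \<bar>u z \<tau> - u z t1'\<bar>)"
        proof (rule set_integral_mono_AE[OF set_integrable_abs[OF set_integral_diff(1)[OF sia sib]]])
          show "set_integrable lebesgue {a..b} (\<lambda>z. E * \<bar>u z \<tau> - u z t1'\<bar>)"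
            using set_integrable_subset[OF set_integrable_abs[OF sid], of "{a..b}"] abs by auto
          show "AE z\<in>{a..b} in lebesgue. \<bar>exp (u z \<tau>) - exp (u z t1')\<bar> \<le> E * \<bar>u z \<tau> - u z t1'\<bar>"
            using K[OF \<tau>1(2)] K[OF t11(2)]
          proof eventually_elim
            case (elim z)
            show ?case
            proof
              assume "z \<in> {a..b}"
              then have "u z \<tau> \<le> K" "u z t1' \<le> K" using elim abs by (auto simp: subset_iff abs_le_iff)
              then show "\<bar>exp (u z \<tau>) - exp (u z t1')\<bar> \<le> E * \<bar>u z \<tau> - u z t1'\<bar>"
                unfolding E_def by (rule exp_diff_le)
            qed
          qed
        qed
        also have "\<dots> = E * (LINT z:{a..b}|lebesgue. \<bar>u z \<tau> - u z t1'\<bar>)" by simp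
        also have "\<dots> \<le> E * (LINT z:B|lebesgue. \<bar>u z \<tau> - u z t1'\<bar>)"
        proof (intro mult_left_mono E0)
          show "(LINT z:{a..b}|lebesgue. \<bar>u z \<tau> - u z t1'\<bar>) \<le> (LINT z:B|lebesgue. \<bar>u z \<tau> - u z t1'\<bar>)"
            unfolding set_lebesgue_integral_def
          proof (rule integral_mono)
            show "integrable lebesgue (\<lambda>z. indicator {a..b} z *\<^sub>R \<bar>u z \<tau> - u z t1'\<bar>)"
              using set_integrable_subset[OF set_integrable_abs[OF sid], of "{a..b}"] abs by (auto simp: set_integrable_def)
            show "integrable lebesgue (\<lambda>z. indicator B z *\<^sub>R \<bar>u z \<tau> - u z t1'\<bar>)"
              using set_integrable_abs[OF sid] by (simp add: set_integrable_def)
          qed (use abs(3) in \<open>auto simp: indicator_def simp del: atLeastAtMost_iff\<close>)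
        qed
        finally have 3: "\<bar>(LINT z:{a..b}|lebesgue. exp (u z \<tau>)) - (LINT z:{a..b}|lebesgue. exp (u z t1'))\<bar>
          \<le> E * (LINT z:B|lebesgue. \<bar>u z \<tau> - u z t1'\<bar>)" .
        have "E * (2 * (m - \<tau>)) + E * (2 * (m - t1')) = E * (2 * \<bar>\<tau> - t1'\<bar>)"
          by (simp add: m_def max_def algebra_simps)
        then show "\<bar>F x' t' \<tau> - F x' t' t1'\<bar> \<le> E * (2 * \<bar>\<tau> - t1'\<bar>) + E * (LINT z:B|lebesgue. \<bar>u z \<tau> - u z t1'\<bar>)"
          using 1 2 3 by linarith
      qed
    qed
    then have "\<forall>\<^sub>F \<tau> in at t1' within {0..s} \<inter> {0..t'}. 
        norm (F x' t' \<tau> - F x' t' t1') \<le> E * (2 * \<bar>\<tau> - t1'\<bar>) + E * (LINT z:B|lebesgue. \<bar>u z \<tau> - u z t1'\<bar>)"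
      by (auto simp: eventually_at_filter elim!: eventually_mono)
    moreover have "((\<lambda>\<tau>. E * (2 * \<bar>\<tau> - t1'\<bar>) + E * (LINT z:B|lebesgue. \<bar>u z \<tau> - u z t1'\<bar>)) \<longlongrightarrow> 0) (at t1' within {0..s} \<inter> {0..t'})"
      by (rule tendsto_within_subset[OF lim]) auto
    ultimately have "((\<lambda>\<tau>. F x' t' \<tau> - F x' t' t1') \<longlongrightarrow> 0) (at t1' within {0..s} \<inter> {0..t'})"
      by (rule Lim_null_comparison)
    then have "(F x' t' \<longlongrightarrow> F x' t' t1') (at t1' within {0..s} \<inter> {0..t'})" by (simp add: LIM_zero_iff)
    moreover have "at t1' within {0..s} \<inter> {0..t'} = at t1' within {0..t'}"
      by (rule at_within_nhd[of _ "{..<s}"]) (use g in \<open>auto simp: s_def\<close>)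
    ultimately show "(F x' t' \<longlongrightarrow> F x' t' t1') (at t1' within {0..t'})" by simp
  qed
  show thesis
  proof (rule that[OF g(1) E0 _ _ _ cont])
    fix x' t' \<tau> assume n: "\<bar>x' - x\<bar> + \<bar>t' - t\<bar> < g" and \<tau>: "\<tau> \<in> {0..t'}"
    note s = sub[OF n \<tau>]
    show "F x' t' \<tau> = integral {x' - t' + \<tau>..x' + t' - \<tau>} (\<lambda>z. exp (u z \<tau>))"
      unfolding F_def using ends(3)[OF s(2) _ s(2,3,3,1,1)] by simp
    show "\<bar>F x' t' \<tau>\<bar> \<le> E * (2 * (t' - \<tau>))"
      unfolding F_def using ends(4)[OF s(2) _ s(2,3,3,1,1)] by simp
    assume \<tau>t: "\<tau> \<le> t"
    have n0: "\<bar>x - x\<bar> + \<bar>t - t\<bar> < g" using g by simp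
    have \<tau>2: "\<tau> \<in> {0..t}" using \<tau> \<tau>t by auto
    note s2 = sub[OF n0 \<tau>2]
    have "\<bar>F x' t' \<tau> - F x t \<tau>\<bar> \<le> E * (\<bar>x' - t' + \<tau> - (x - t + \<tau>)\<bar> + \<bar>x' + t' - \<tau> - (x + t - \<tau>)\<bar>)"
      unfolding F_def using ends(1)[OF s(2) _ s(2,3) s2(3) s(1) s2(1)] by simp
    also have "\<dots> \<le> E * (2 * (\<bar>x' - x\<bar> + \<bar>t' - t\<bar>))"
      by (intro mult_left_mono E0) (smt (verit))
    finally show "\<bar>F x' t' \<tau> - F x t \<tau>\<bar> \<le> E * (2 * (\<bar>x' - x\<bar> + \<bar>t' - t\<bar>))" .
  qed
qed


text \<open>The free wave splits as \<open>wave_plus (x + t) + wave_minus (x - t)\<close>.\<close>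

definition wave_plus :: "(real \<Rightarrow> real) \<Rightarrow> (real \<Rightarrow> real) \<Rightarrow> real \<Rightarrow> real" where
  "wave_plus u0 u1 y = (u0 y + prim u1 y) / 2"

definition wave_minus :: "(real \<Rightarrow> real) \<Rightarrow> (real \<Rightarrow> real) \<Rightarrow> real \<Rightarrow> real" where
  "wave_minus u0 u1 y = (u0 y - prim u1 y) / 2"

lemma wave_continuous:
  assumes "continuous_on UNIV u0" "L2_locu u1"
  shows "continuous_on S (wave_plus u0 u1)" "continuous_on S (wave_minus u0 u1)"
  unfolding wave_plus_def[abs_def] wave_minus_def[abs_def]
  using continuous_on_subset[OF assms(1) subset_UNIV] prim_continuous[OF L2_locu_integrable(2)[OF assms(2)]]
  by (auto intro!: continuous_on_divide continuous_on_add continuous_on_diff)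

lemma free_wave_eq:
  assumes "L2_locu u1" "0 \<le> t"
  shows "(u0 (x - t) + u0 (x + t)) / 2 + (LINT y:{x - t..x + t}|lebesgue. u1 y) / 2
    = wave_plus u0 u1 (x + t) + wave_minus u0 u1 (x - t)"
proof -
  have "(LINT y:{x - t..x + t}|lebesgue. u1 y) = integral {x - t..x + t} u1"
    by (rule set_lebesgue_integral_eq_integral[OF L2_locu_integrable(1)[OF assms(1)]])
  also have "\<dots> = prim u1 (x + t) - prim u1 (x - t)"
    by (rule prim_diff[OF L2_locu_integrable(2)[OF assms(1)], symmetric]) (use assms in auto)
  finally show ?thesis by (simp add: wave_plus_def wave_minus_def field_simps)
qed

lemma continuous_LINT:
  fixes f :: "real \<Rightarrow> real"
  assumes "continuous_on {a..b} f"
  shows "(LINT x:{a..b}|lebesgue. f x) = integral {a..b} f"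
  by (intro set_lebesgue_integral_eq_integral absolutely_integrable_continuous_real assms)

text \<open>Duhamel's formula holds at every point, so \<open>u\<close> inherits continuity from its
  right-hand side, whose dependence on the vertex is controlled by
  \<open>solution_local\<close>.\<close>

lemma solution_duhamel:
  assumes sol: "solution_on_cone u0 u1 u x0 t0" and u0: "continuous_on UNIV u0" and u1: "L2_locu u1"
    and t: "0 \<le> t" "\<bar>x - x0\<bar> < t0 - t"
  shows "u x t = wave_plus u0 u1 (x + t) + wave_minus u0 u1 (x - t) + duh (\<lambda>z \<tau>. exp (u z \<tau>)) x t / 2"
    and "continuous (at (x, t) within {(x, t). 0 \<le> t \<and> \<bar>x - x0\<bar> < t0 - t}) (\<lambda>(x, t). u x t)"
proof -
  define F where "F x t \<tau> = (LINT z:{x - t + \<tau>..x + t - \<tau>}|lebesgue. exp (u z \<tau>))" for x t \<tau>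
  have h1: "C_H1 x0 t0 u" using sol by (simp add: solution_on_cone_def)
  obtain \<epsilon> E where \<epsilon>: "\<epsilon> > 0" "E \<ge> 0"
    and F: "\<And>x' t' \<tau>. \<bar>x' - x\<bar> + \<bar>t' - t\<bar> < \<epsilon> \<Longrightarrow> \<tau> \<in> {0..t'} \<Longrightarrow> F x' t' \<tau> = integral {x' - t' + \<tau>..x' + t' - \<tau>} (\<lambda>z. exp (u z \<tau>))"
    "\<And>x' t' \<tau>. \<bar>x' - x\<bar> + \<bar>t' - t\<bar> < \<epsilon> \<Longrightarrow> \<tau> \<in> {0..t'} \<Longrightarrow> \<bar>F x' t' \<tau>\<bar> \<le> E * (2 * (t' - \<tau>))"
    "\<And>x' t' \<tau>. \<bar>x' - x\<bar> + \<bar>t' - t\<bar> < \<epsilon> \<Longrightarrow> \<tau> \<in> {0..t'} \<Longrightarrow> \<tau> \<le> t \<Longrightarrow> \<bar>F x' t' \<tau> - F x t \<tau>\<bar> \<le> E * (2 * (\<bar>x' - x\<bar> + \<bar>t' - t\<bar>))"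
    "\<And>x' t'. \<bar>x' - x\<bar> + \<bar>t' - t\<bar> < \<epsilon> \<Longrightarrow> continuous_on {0..t'} (F x' t')"
    by (rule solution_local[OF h1 t, folded F_def]) (rule that)
  define S where "S = {(x, t). 0 \<le> t \<and> \<bar>x - x0\<bar> < t0 - t}"
  have eq: "u x' t' = wave_plus u0 u1 (x' + t') + wave_minus u0 u1 (x' - t') + integral {0..t'} (F x' t') / 2"
    if n: "\<bar>x' - x\<bar> + \<bar>t' - t\<bar> < \<epsilon>" and S: "(x', t') \<in> S" for x' t'
  proof -
    have "duhamel u0 u1 u x' t'"
      using sol S by (auto simp: solution_on_cone_def S_def dist_real_def abs_minus_commute)
    moreover have "(LINT \<tau>:{0..t'}|lebesgue. F x' t' \<tau>) = integral {0..t'} (F x' t')"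
      by (rule continuous_LINT[OF F(4)[OF n]])
    ultimately show ?thesis
      using free_wave_eq[OF u1, of t' u0 x'] S by (auto simp: duhamel_def F_def[symmetric] S_def)
  qed
  have n0: "\<bar>x - x\<bar> + \<bar>t - t\<bar> < \<epsilon>" using \<epsilon> by simp
  have xS: "(x, t) \<in> S" using t by (auto simp: S_def)
  have "integral {0..t} (F x t) = duh (\<lambda>z \<tau>. exp (u z \<tau>)) x t"
    unfolding duh_def by (rule integral_cong) (rule F(1)[OF n0])
  with eq[OF n0 xS]
  show "u x t = wave_plus u0 u1 (x + t) + wave_minus u0 u1 (x - t) + duh (\<lambda>z \<tau>. exp (u z \<tau>)) x t / 2" by simp
  have int: "F x' t' integrable_on {a..b}" if "\<bar>x' - x\<bar> + \<bar>t' - t\<bar> < \<epsilon>" "0 \<le> a" "b \<le> t'" for x' t' a b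
    by (rule integrable_continuous_real, rule continuous_on_subset[OF F(4)[OF that(1)]]) (use that in auto)
  have bnd: "\<bar>integral {0..t'} (F x' t') - integral {0..t} (F x t)\<bar>
      \<le> E * (2 * (\<bar>x' - x\<bar> + \<bar>t' - t\<bar>)) * t + 2 * (E * (2 * \<bar>t' - t\<bar>)) * \<bar>t' - t\<bar>"
    if n: "\<bar>x' - x\<bar> + \<bar>t' - t\<bar> < \<epsilon>" and t': "0 \<le> t'" for x' t'
  proof -
    \<comment> \<open>Up to the smaller of the two times both integrands are defined and close to
      each other; beyond it the integrand is at most \<open>2 * E\<close> times the remaining time,
      so that the tail is of second order.\<close>
    define m where "m = min t t'"
    have m: "0 \<le> m" "m \<le> t" "m \<le> t'" using t t' by (auto simp: m_def)
    have c: "integral {0..s} (F y s) = integral {0..m} (F y s) + integral {m..s} (F y s)"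
      if "\<bar>y - x\<bar> + \<bar>s - t\<bar> < \<epsilon>" "m \<le> s" for y s
      by (rule Henstock_Kurzweil_Integration.integral_combine[symmetric]) (use m that int in auto)
    have tail: "\<bar>integral {m..s} (F y s)\<bar> \<le> E * (2 * (s - m)) * (s - m)"
      if "\<bar>y - x\<bar> + \<bar>s - t\<bar> < \<epsilon>" "m \<le> s" for y s
    proof -
      have "norm (integral {m..s} (F y s)) \<le> E * (2 * (s - m)) * measure lborel (cbox m s)"
      proof (rule has_integral_bound)
        show "(F y s has_integral integral {m..s} (F y s)) (cbox m s)"
          using int[of y s m s] that m by auto
        show "0 \<le> E * (2 * (s - m))" using that \<epsilon> by auto
        fix \<tau> assume \<tau>: "\<tau> \<in> cbox m s"
        then have "\<tau> \<in> {0..s}" using m by auto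
        from F(2)[OF that(1) this] have "norm (F y s \<tau>) \<le> E * (2 * (s - \<tau>))" by simp
        also have "\<dots> \<le> E * (2 * (s - m))" using \<tau> \<epsilon> by (intro mult_left_mono) auto
        finally show "norm (F y s \<tau>) \<le> E * (2 * (s - m))" .
      qed
      then show ?thesis using that by simp
    qed
    have head: "\<bar>integral {0..m} (F x' t') - integral {0..m} (F x t)\<bar> \<le> E * (2 * (\<bar>x' - x\<bar> + \<bar>t' - t\<bar>)) * m"
    proof -
      have i: "F x' t' integrable_on {0..m}" "F x t integrable_on {0..m}"
        using int[OF n, of 0 m] int[OF n0, of 0 m] m by auto
      have "norm (integral {0..m} (\<lambda>\<tau>. F x' t' \<tau> - F x t \<tau>)) \<le> E * (2 * (\<bar>x' - x\<bar> + \<bar>t' - t\<bar>)) * measure lborel (cbox 0 m)"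
      proof (rule has_integral_bound)
        show "((\<lambda>\<tau>. F x' t' \<tau> - F x t \<tau>) has_integral integral {0..m} (\<lambda>\<tau>. F x' t' \<tau> - F x t \<tau>)) (cbox 0 m)"
          using integrable_diff[OF i] by (simp add: has_integral_integral)
        show "0 \<le> E * (2 * (\<bar>x' - x\<bar> + \<bar>t' - t\<bar>))" using \<epsilon> by auto
        fix \<tau> assume "\<tau> \<in> cbox 0 m"
        then show "norm (F x' t' \<tau> - F x t \<tau>) \<le> E * (2 * (\<bar>x' - x\<bar> + \<bar>t' - t\<bar>))"
          using F(3)[OF n, of \<tau>] m by auto
      qed
      then show ?thesis using m integral_diff[OF i] by simp
    qed
    have d: "t - m \<le> \<bar>t' - t\<bar>" "t' - m \<le> \<bar>t' - t\<bar>" by (auto simp: m_def)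
    have 1: "E * (2 * (\<bar>x' - x\<bar> + \<bar>t' - t\<bar>)) * m \<le> E * (2 * (\<bar>x' - x\<bar> + \<bar>t' - t\<bar>)) * t"
      using m \<epsilon> by (intro mult_left_mono) auto
    have 2: "E * (2 * (s - m)) * (s - m) \<le> E * (2 * \<bar>t' - t\<bar>) * \<bar>t' - t\<bar>" if "m \<le> s" "s - m \<le> \<bar>t' - t\<bar>" for s
      using that \<epsilon> by (intro mult_mono) auto
    show ?thesis
      using c[OF n m(3)] c[OF n0 m(2)] tail[OF n m(3)] tail[OF n0 m(2)] head 1 2[OF m(2) d(1)] 2[OF m(3) d(2)]
      by linarith
  qed
  have lim: "((\<lambda>p. integral {0..snd p} (F (fst p) (snd p)) - integral {0..t} (F x t)) \<longlongrightarrow> 0) (at (x, t) within S)"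
  proof (rule Lim_null_comparison)
    have "((\<lambda>p. E * (2 * (\<bar>fst p - x\<bar> + \<bar>snd p - t\<bar>)) * t + 2 * (E * (2 * \<bar>snd p - t\<bar>)) * \<bar>snd p - t\<bar>)
        \<longlongrightarrow> E * (2 * (\<bar>fst (x, t) - x\<bar> + \<bar>snd (x, t) - t\<bar>)) * t + 2 * (E * (2 * \<bar>snd (x, t) - t\<bar>)) * \<bar>snd (x, t) - t\<bar>) (at (x, t) within S)"
      by (intro tendsto_intros)
    then show "((\<lambda>p. E * (2 * (\<bar>fst p - x\<bar> + \<bar>snd p - t\<bar>)) * t + 2 * (E * (2 * \<bar>snd p - t\<bar>)) * \<bar>snd p - t\<bar>) \<longlongrightarrow> 0) (at (x, t) within S)"
      by simp
    have ev: "\<forall>\<^sub>F p in at (x, t) within S. \<bar>fst p - x\<bar> + \<bar>snd p - t\<bar> < \<epsilon>"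
    proof -
      have "((\<lambda>p. \<bar>fst p - x\<bar> + \<bar>snd p - t\<bar>) \<longlongrightarrow> \<bar>fst (x, t) - x\<bar> + \<bar>snd (x, t) - t\<bar>) (at (x, t) within S)"
        by (intro tendsto_intros)
      then show ?thesis by (rule order_tendstoD) (use \<epsilon> in simp)
    qed
    moreover have "\<forall>\<^sub>F p in at (x, t) within S. p \<in> S" by (simp add: eventually_at_filter)
    ultimately show "\<forall>\<^sub>F p in at (x, t) within S. norm (integral {0..snd p} (F (fst p) (snd p)) - integral {0..t} (F x t))
       \<le> E * (2 * (\<bar>fst p - x\<bar> + \<bar>snd p - t\<bar>)) * t + 2 * (E * (2 * \<bar>snd p - t\<bar>)) * \<bar>snd p - t\<bar>"
      by eventually_elim (use bnd in \<open>auto simp: S_def\<close>)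
  qed
  have ev: "\<forall>\<^sub>F p in at (x, t) within S. wave_plus u0 u1 (fst p + snd p) + wave_minus u0 u1 (fst p - snd p) + integral {0..snd p} (F (fst p) (snd p)) / 2 = (case p of (x, t) \<Rightarrow> u x t)"
  proof -
    have "((\<lambda>p. \<bar>fst p - x\<bar> + \<bar>snd p - t\<bar>) \<longlongrightarrow> \<bar>fst (x, t) - x\<bar> + \<bar>snd (x, t) - t\<bar>) (at (x, t) within S)"
      by (intro tendsto_intros)
    then have "\<forall>\<^sub>F p in at (x, t) within S. \<bar>fst p - x\<bar> + \<bar>snd p - t\<bar> < \<epsilon>" by (rule order_tendstoD) (use \<epsilon> in simp)
    moreover have "\<forall>\<^sub>F p in at (x, t) within S. p \<in> S" by (simp add: eventually_at_filter)
    ultimately show ?thesis by eventually_elim (use eq in \<open>auto split: prod.split\<close>)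
  qed
  have w: "((\<lambda>p. wave_plus u0 u1 (fst p + snd p)) \<longlongrightarrow> wave_plus u0 u1 (fst (x,t) + snd (x,t))) (at (x, t) within S)"
       "((\<lambda>p. wave_minus u0 u1 (fst p - snd p)) \<longlongrightarrow> wave_minus u0 u1 (fst (x,t) - snd (x,t))) (at (x, t) within S)"
  proof -
    have c: "isCont (wave_plus u0 u1) y" "isCont (wave_minus u0 u1) y" for y
      using wave_continuous[OF u0 u1, of UNIV] by (simp_all add: continuous_on_eq_continuous_at)
    show "((\<lambda>p. wave_plus u0 u1 (fst p + snd p)) \<longlongrightarrow> wave_plus u0 u1 (fst (x,t) + snd (x,t))) (at (x, t) within S)"
      by (rule isCont_tendsto_compose[OF c(1)]) (intro tendsto_intros)
    show "((\<lambda>p. wave_minus u0 u1 (fst p - snd p)) \<longlongrightarrow> wave_minus u0 u1 (fst (x,t) - snd (x,t))) (at (x, t) within S)"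
      by (rule isCont_tendsto_compose[OF c(2)]) (intro tendsto_intros)
  qed
  have "((\<lambda>p. wave_plus u0 u1 (fst p + snd p) + wave_minus u0 u1 (fst p - snd p) + integral {0..snd p} (F (fst p) (snd p)) / 2)
      \<longlongrightarrow> wave_plus u0 u1 (fst (x,t) + snd (x,t)) + wave_minus u0 u1 (fst (x,t) - snd (x,t)) + integral {0..t} (F x t) / 2) (at (x, t) within S)"
    using lim by (intro tendsto_intros w) (simp_all add: LIM_zero_iff)
  then have "((\<lambda>(x, t). u x t) \<longlongrightarrow> wave_plus u0 u1 (x + t) + wave_minus u0 u1 (x - t) + integral {0..t} (F x t) / 2) (at (x, t) within S)"
    using Lim_transform_eventually[OF _ ev] by simp
  then show "continuous (at (x, t) within {(x, t). 0 \<le> t \<and> \<bar>x - x0\<bar> < t0 - t}) (\<lambda>(x, t). u x t)"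
    unfolding continuous_within S_def[symmetric] using eq[OF n0 xS] by simp
qed

section \<open>Calculus of the Duhamel integral\<close>

lemma prim_DERIV:
  assumes "continuous_on UNIV f"
  shows "(prim f has_real_derivative f y) (at y)"
proof -
  have i: "f integrable_on {a..b}" for a b
    by (rule integrable_continuous_real[OF continuous_on_subset[OF assms]]) auto
  let ?c = "- \<bar>y\<bar> - 1" and ?d = "\<bar>y\<bar> + 1"
  have "((\<lambda>y. integral {?c..y} f) has_real_derivative f y) (at y within {?c..?d})"
    by (rule integral_has_real_derivative[OF continuous_on_subset[OF assms]]) auto
  then have "((\<lambda>y. integral {?c..y} f - integral {?c..0} f) has_real_derivative f y) (at y within {?c..?d})"
    by (auto intro!: derivative_eq_intros)
  then have "((\<lambda>y. integral {?c..y} f - integral {?c..0} f) has_real_derivative f y) (at y)"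
    by (subst (asm) at_within_interior) (auto simp: abs_if)
  then show ?thesis
    by (rule has_field_derivative_transform_within_open[where S="{?c<..<?d}"])
      (auto simp: abs_if prim_eq[OF i, of ?c])
qed

lemma prim_0 [simp]: "prim f 0 = 0"
  by (simp add: prim_def)

lemma prim_nonneg_eq: "0 \<le> y \<Longrightarrow> prim f y = integral {0..y} f"
  by (cases "y = 0") (auto simp: prim_def)

text \<open>Moving the variable endpoint into the integrand reduces the dependence on endpoint and
  parameter to theorems about integrals over a fixed interval.\<close>

lemma prim_rescaled:
  assumes "continuous_on UNIV f"
  shows "prim f y = y * integral {0..1} (\<lambda>\<theta>. f (y * \<theta>))"
proof -
  have "((\<lambda>\<theta>. y * f (y * \<theta>)) has_integral (prim f (y * 1) - prim f (y * 0))) {0..1}"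
  proof (rule fundamental_theorem_of_calculus)
    show "((\<lambda>\<theta>. prim f (y * \<theta>)) has_vector_derivative y * f (y * x)) (at x within {0..1})" for x
    proof -
      have "((\<lambda>\<theta>. y * \<theta>) has_real_derivative y) (at x)" by (auto intro!: derivative_eq_intros)
      from DERIV_chain2[OF prim_DERIV[OF assms] this]
      have "((\<lambda>\<theta>. prim f (y * \<theta>)) has_real_derivative y * f (y * x)) (at x within {0..1})"
        by (simp add: mult.commute has_field_derivative_at_within)
      then show ?thesis by (simp only: has_real_derivative_iff_has_vector_derivative)
    qed
  qed auto
  then show ?thesis by (simp add: has_integral_iff)
qed

lemma continuous_on_UNIV_section:
  fixes F :: "'a::topological_space \<Rightarrow> 'b::topological_space \<Rightarrow> 'c::topological_space"
  assumes "continuous_on UNIV (\<lambda>(a, b). F a b)"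
    and "continuous_on S f" "continuous_on S g"
  shows "continuous_on S (\<lambda>x. F (f x) (g x))"
  using continuous_on_compose2[OF assms(1) continuous_on_Pair[OF assms(2,3)]] by simp

lemma prim_continuous_param:
  fixes F :: "'a::topological_space \<Rightarrow> real \<Rightarrow> real"
  assumes F: "continuous_on UNIV (\<lambda>(a, b). F a b)"
  shows "continuous_on UNIV (\<lambda>(a, y). prim (F a) y)"
proof -
  have c: "continuous_on UNIV (F a)" for a
    by (rule continuous_on_UNIV_section[OF F]) (auto intro: continuous_intros)
  have "continuous_on UNIV (\<lambda>p. integral (cbox 0 1) (\<lambda>\<theta>. F (fst p) (snd p * \<theta>)))"
  proof (rule integral_continuous_on_param)
    show "continuous_on (UNIV \<times> cbox 0 1) (\<lambda>(p, \<theta>). F (fst p) (snd p * \<theta>))"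
      unfolding split_beta by (rule continuous_on_UNIV_section[OF F]) (auto intro!: continuous_intros)
  qed
  then have "continuous_on UNIV (\<lambda>p. snd p * integral {0..1} (\<lambda>\<theta>. F (fst p) (snd p * \<theta>)))"
    by (intro continuous_intros) simp
  then show ?thesis by (simp add: split_beta prim_rescaled[OF c])
qed

text \<open>The partial derivative in the parameter comes from the rescaled form, the one in the
  endpoint from the fundamental theorem of calculus. As the latter is continuous, the primitive is
  jointly differentiable, and the chain rule along \<open>(a, r a)\<close> applies.\<close>

lemma prim_leibniz:
  fixes f f' :: "real \<Rightarrow> real \<Rightarrow> real"
  assumes f: "continuous_on UNIV (\<lambda>(a, b). f a b)" and f': "continuous_on UNIV (\<lambda>(a, b). f' a b)"
    and D: "\<And>a b. ((\<lambda>a. f a b) has_real_derivative f' a b) (at a)"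
    and r: "(r has_real_derivative r') (at a)"
  shows "((\<lambda>a. prim (f a) (r a)) has_real_derivative f a (r a) * r' + prim (f' a) (r a)) (at a)"
proof -
  have c: "continuous_on UNIV (f a)" for a
    by (rule continuous_on_UNIV_section[OF f]) (auto intro: continuous_intros)
  have c': "continuous_on UNIV (f' a)" for a
    by (rule continuous_on_UNIV_section[OF f']) (auto intro: continuous_intros)
  have Da: "((\<lambda>a. prim (f a) y) has_real_derivative prim (f' a) y) (at a)" for a y
  proof -
    have "((\<lambda>a. integral (cbox 0 1) (\<lambda>\<theta>. f a (y * \<theta>))) has_real_derivative integral (cbox 0 1) (\<lambda>\<theta>. f' a (y * \<theta>))) (at a within UNIV)"
    proof (rule leibniz_rule_field_derivative)
      show "(\<lambda>\<theta>. f a (y * \<theta>)) integrable_on cbox 0 1" for a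
        by (rule integrable_continuous, rule continuous_on_UNIV_section[OF f]) (auto intro!: continuous_intros)
      show "continuous_on (UNIV \<times> cbox 0 1) (\<lambda>(a, \<theta>). f' a (y * \<theta>))"
        unfolding split_beta by (rule continuous_on_UNIV_section[OF f']) (auto intro!: continuous_intros)
    qed (use D in auto)
    then have "((\<lambda>a. y * integral {0..1} (\<lambda>\<theta>. f a (y * \<theta>))) has_real_derivative y * integral {0..1} (\<lambda>\<theta>. f' a (y * \<theta>))) (at a)"
      by (intro DERIV_cmult) simp
    then show ?thesis by (simp add: prim_rescaled[OF c] prim_rescaled[OF c'])
  qed
  have P: "((\<lambda>(a, y). prim (f a) y) has_derivative (\<lambda>(ta, ty). prim (f' a) (r a) * ta + blinfun_apply (blinfun_mult_right (f a (r a))) ty)) (at (a, r a) within UNIV \<times> UNIV)"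
  proof (rule has_derivative_partialsI)
    show "((\<lambda>a. prim (f a) (r a0)) has_derivative (*) (prim (f' a) (r a0))) (at a within UNIV)" for a0
      using Da[of "r a0" a] by (simp add: has_field_derivative_def)
    show "(prim (f a) has_derivative blinfun_apply (blinfun_mult_right (f a y))) (at y within UNIV)" for a y
      using prim_DERIV[OF c, of a y] by (simp add: has_field_derivative_def blinfun_mult_right.rep_eq)
    have "continuous_on UNIV (\<lambda>p. blinfun_mult_right (f (fst p) (snd p)))"
      by (intro bounded_linear.continuous_on[OF bounded_linear_blinfun_mult_right] continuous_on_UNIV_section[OF f] continuous_intros)
    from this[unfolded continuous_on_eq_continuous_at[OF open_UNIV], rule_format, of "(a, r a)"]
    show "continuous (at (a, r a) within UNIV \<times> UNIV) (\<lambda>(x, y). blinfun_mult_right (f x y))"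
      by (simp add: split_beta')
  qed auto
  have "((\<lambda>a. (a, r a)) has_derivative (\<lambda>h. (h, r' * h))) (at a)"
    using r by (auto intro!: derivative_eq_intros simp: has_field_derivative_def)
  from has_derivative_compose[OF this P[simplified]]
  have "((\<lambda>a. prim (f a) (r a)) has_derivative (\<lambda>h. prim (f' a) (r a) * h + blinfun_apply (blinfun_mult_right (f a (r a))) (r' * h))) (at a)"
    by simp
  then show ?thesis
    unfolding has_field_derivative_def
    by (rule has_derivative_eq_rhs) (auto simp: blinfun_mult_right.rep_eq algebra_simps)
qed

text \<open>\<open>wduh\<close> extends \<open>duh\<close> to negative times by oriented integrals. It is continuously
  differentiable on the whole plane, so that no one-sided derivatives occur at time 0.\<close>

definition wduh :: "(real \<Rightarrow> real \<Rightarrow> real) \<Rightarrow> real \<Rightarrow> real \<Rightarrow> real" where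
  "wduh G x t = prim (\<lambda>\<tau>. prim (\<lambda>z. G z \<tau>) (x + t - \<tau>) - prim (\<lambda>z. G z \<tau>) (x - t + \<tau>)) t"

context
  fixes G :: "real \<Rightarrow> real \<Rightarrow> real"
  assumes G: "continuous_on UNIV (\<lambda>(z, \<tau>). G z \<tau>)"
begin

lemma continuous_slice: "continuous_on S (\<lambda>z. G z \<tau>)"
  by (rule continuous_on_UNIV_section[OF G]) (auto intro: continuous_intros)

lemma continuous_swapped: "continuous_on UNIV (\<lambda>(\<tau>, z). G z \<tau>)"
  unfolding split_beta by (rule continuous_on_UNIV_section[OF G]) (auto intro: continuous_intros)

lemma continuous_prim_section:
  assumes "continuous_on S f" "continuous_on S g"
  shows "continuous_on S (\<lambda>x. prim (\<lambda>z. G z (f x)) (g x))"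
  by (rule continuous_on_UNIV_section[OF prim_continuous_param[OF continuous_swapped] assms])

lemma slice_integral: "a \<le> b \<Longrightarrow> integral {a..b} (\<lambda>z. G z \<tau>) = prim (\<lambda>z. G z \<tau>) b - prim (\<lambda>z. G z \<tau>) a"
  by (rule prim_diff[symmetric]) (auto intro!: integrable_continuous_real continuous_slice)

lemma duh_eq_wduh:
  assumes "0 \<le> t" shows "duh G x t = wduh G x t"
  unfolding duh_def wduh_def prim_nonneg_eq[OF assms]
  by (rule integral_cong) (simp add: slice_integral)

lemma duh_inner_continuous: "continuous_on {0..t} (\<lambda>\<tau>. integral {x - t + \<tau>..x + t - \<tau>} (\<lambda>z. G z \<tau>))"
proof -
  have "continuous_on {0..t} (\<lambda>\<tau>. prim (\<lambda>z. G z \<tau>) (x + t - \<tau>) - prim (\<lambda>z. G z \<tau>) (x - t + \<tau>))"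
    by (intro continuous_intros continuous_prim_section)
  then show ?thesis
    by (rule continuous_on_eq) (simp add: slice_integral)
qed

text \<open>The inner integral vanishes at the vertex, so the moving outer limit contributes nothing
  and only the endpoints on the two null sides of the triangle are left. For \<open>p = q\<close> or
  \<open>p = - q\<close> one of these two terms disappears as well.\<close>

lemma wduh_DERIV:
  "((\<lambda>l. wduh G (x + p * l) (t + q * l)) has_real_derivative
     prim (\<lambda>\<tau>. (p + q) * G (x + t + (p + q) * l - \<tau>) \<tau> - (p - q) * G (x - t + (p - q) * l + \<tau>) \<tau>) (t + q * l)) (at l)"
proof -
  define f where "f l \<tau> = prim (\<lambda>z. G z \<tau>) (x + t + (p + q) * l - \<tau>) - prim (\<lambda>z. G z \<tau>) (x - t + (p - q) * l + \<tau>)" for l \<tau>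
  define f' where "f' l \<tau> = (p + q) * G (x + t + (p + q) * l - \<tau>) \<tau> - (p - q) * G (x - t + (p - q) * l + \<tau>) \<tau>" for l \<tau>
  have W: "wduh G (x + p * l) (t + q * l) = prim (f l) (t + q * l)" for l
    unfolding wduh_def f_def by (simp add: algebra_simps)
  have "((\<lambda>l. prim (f l) (t + q * l)) has_real_derivative f l (t + q * l) * q + prim (f' l) (t + q * l)) (at l)"
  proof (rule prim_leibniz)
    show "continuous_on UNIV (\<lambda>(l, \<tau>). f l \<tau>)"
      unfolding f_def split_beta by (intro continuous_intros continuous_prim_section)
    show "continuous_on UNIV (\<lambda>(l, \<tau>). f' l \<tau>)"
      unfolding f'_def split_beta by (intro continuous_intros continuous_on_UNIV_section[OF G])
    show "((\<lambda>l. f l \<tau>) has_real_derivative f' l \<tau>) (at l)" for l \<tau>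
      unfolding f_def f'_def
      by (auto intro!: derivative_eq_intros DERIV_chain2[OF prim_DERIV[OF continuous_slice]] simp: algebra_simps)
  qed (auto intro!: derivative_eq_intros)
  moreover have "f l (t + q * l) = 0" for l
    unfolding f_def by (simp add: algebra_simps)
  ultimately show ?thesis unfolding W f'_def by simp
qed

lemma wduh_continuous: "continuous_on UNIV (\<lambda>(x, t). wduh G x t)"
proof -
  have "continuous_on UNIV (\<lambda>(p, \<tau>). prim (\<lambda>z. G z \<tau>) (fst p + snd p - \<tau>) - prim (\<lambda>z. G z \<tau>) (fst p - snd p + \<tau>))"
    unfolding split_beta by (intro continuous_intros continuous_prim_section)
  from continuous_on_UNIV_section[OF prim_continuous_param[OF this], of UNIV "\<lambda>p. p" snd]
  show ?thesis by (simp add: wduh_def split_beta' continuous_on_snd)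
qed

end

lemma duh_cong:
  assumes "\<And>z \<tau>. 0 \<le> \<tau> \<Longrightarrow> \<bar>z - x\<bar> \<le> t - \<tau> \<Longrightarrow> F z \<tau> = G z \<tau>"
  shows "duh F x t = duh G x t"
  unfolding duh_def by (intro integral_cong assms) (auto simp: abs_le_iff)

text \<open>In contrast to \<open>cone x t 1\<close> the tip is included, which makes the set
  compact.\<close>

definition tri :: "real \<Rightarrow> real \<Rightarrow> (real \<times> real) set" where
  "tri x t = {(z, \<tau>). 0 \<le> \<tau> \<and> \<bar>z - x\<bar> \<le> t - \<tau>}"

lemma compact_triangle: "compact (tri x t)"
proof -
  have "closed {p::real\<times>real. 0 \<le> snd p \<and> \<bar>fst p - x\<bar> \<le> t - snd p}"
    by (intro closed_Collect_conj closed_Collect_le continuous_intros)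
  moreover have "tri x t = {p. 0 \<le> snd p \<and> \<bar>fst p - x\<bar> \<le> t - snd p}"
    by (auto simp: tri_def)
  moreover have "tri x t \<subseteq> {x - t..x + t} \<times> {0..t}"
    by (auto simp: tri_def)
  then have "bounded (tri x t)"
    by (rule bounded_subset[OF bounded_Times, rotated -1]) auto
  ultimately show ?thesis by (simp add: compact_eq_bounded_closed)
qed

text \<open>\<open>u\<close> is continuous on its domain, whereas the calculus of
  \<open>wduh\<close> works on the whole plane. Duhamel integrals with vertex in the triangle do not
  see the extension.\<close>

lemma triangle_extension:
  fixes F :: "real \<Rightarrow> real \<Rightarrow> real"
  assumes "continuous_on (tri x t) (\<lambda>(z, \<tau>). F z \<tau>)"
  obtains G where "continuous_on UNIV (\<lambda>(z, \<tau>). G z \<tau>)" "\<And>z \<tau>. (z, \<tau>) \<in> tri x t \<Longrightarrow> G z \<tau> = F z \<tau>"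
proof -
  have "closedin (top_of_set UNIV) (tri x t)"
    using compact_imp_closed[OF compact_triangle] by simp
  from Tietze_unbounded[OF assms this]
  obtain g where g: "continuous_on UNIV g" "\<And>p. p \<in> tri x t \<Longrightarrow> g p = (\<lambda>(z, \<tau>). F z \<tau>) p" by blast
  show thesis
    by (rule that[of "\<lambda>z \<tau>. g (z, \<tau>)"]) (use g in auto)
qed

section \<open>The upper bound\<close>

text \<open>The triangle below \<open>(y, s)\<close> contains the one below \<open>(x0, t0)\<close>
  and a rectangle of area \<open>2 * l * (q - p)\<close>. The rectangle lies above time
  \<open>t0\<close>, so the two contributions add up, and what remains is nonnegative.\<close>

lemma duh_lower:
  assumes F: "continuous_on (tri y s) (\<lambda>(z, \<tau>). F z \<tau>)" and F0: "\<And>z \<tau>. (z, \<tau>) \<in> tri y s \<Longrightarrow> 0 \<le> F z \<tau>"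
    and x0: "0 \<le> t0" "\<bar>y - x0\<bar> \<le> s - t0" and pq: "t0 \<le> p" "p \<le> q" "q \<le> s" and l: "0 \<le> l"
    and m: "\<And>z \<tau>. p \<le> \<tau> \<Longrightarrow> \<tau> \<le> q \<Longrightarrow> \<bar>z - c\<bar> \<le> l \<Longrightarrow> \<bar>z - y\<bar> \<le> s - \<tau> \<and> m \<le> F z \<tau>"
  shows "duh F x0 t0 + m * (2 * l) * (q - p) \<le> duh F y s"
proof -
  obtain G where G: "continuous_on UNIV (\<lambda>(z, \<tau>). G z \<tau>)"
    and GF: "\<And>z \<tau>. (z, \<tau>) \<in> tri y s \<Longrightarrow> G z \<tau> = F z \<tau>"
    using triangle_extension[OF F] by blast
  define I where "I x t \<tau> = integral {x - t + \<tau>..x + t - \<tau>} (\<lambda>z. G z \<tau>)" for x t \<tau>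
  have Ii: "I x t integrable_on {a..b}" if "0 \<le> a" "b \<le> t" for x t a b
    unfolding I_def by (rule integrable_continuous_real, rule continuous_on_subset[OF duh_inner_continuous[OF G]])
      (use that in auto)
  have Gi: "(\<lambda>z. G z \<tau>) integrable_on {a..b}" for a b \<tau>
    by (intro integrable_continuous_real continuous_slice G)
  have G0: "0 \<le> G z \<tau>" if "0 \<le> \<tau>" "y - s + \<tau> \<le> z" "z \<le> y + s - \<tau>" for z \<tau>
    using that F0[of z \<tau>] GF[of z \<tau>] by (auto simp: tri_def abs_le_iff)
  have I0: "0 \<le> I y s \<tau>" if "0 \<le> \<tau>" for \<tau>
    unfolding I_def by (rule integral_nonneg[OF Gi]) (use G0 that in auto)
  have t0s: "t0 \<le> s" using x0 by linarith
  have "duh F x0 t0 = duh G x0 t0"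
    by (rule duh_cong) (use x0 in \<open>auto simp: tri_def intro!: GF[symmetric]\<close>)
  also have "\<dots> = integral {0..t0} (I x0 t0)" by (simp add: duh_def I_def[abs_def])
  also have "\<dots> \<le> integral {0..t0} (I y s)"
  proof (rule integral_le)
    fix \<tau> assume \<tau>: "\<tau> \<in> {0..t0}"
    show "I x0 t0 \<tau> \<le> I y s \<tau>"
      unfolding I_def by (rule integral_subset_le[OF _ Gi Gi]) (use \<tau> x0 G0 in \<open>auto simp: abs_le_iff\<close>)
  qed (use Ii t0s in auto)
  finally have 1: "duh F x0 t0 \<le> integral {0..t0} (I y s)" .
  have "m * (2 * l) * (q - p) = integral {p..q} (\<lambda>\<tau>. m * (2 * l))" using pq by simp
  also have "\<dots> \<le> integral {p..q} (I y s)"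
  proof (rule integral_le)
    fix \<tau> assume \<tau>: "\<tau> \<in> {p..q}"
    have "m * (2 * l) = integral {c - l..c + l} (\<lambda>z. m)" using l by simp
    also have "\<dots> \<le> integral {c - l..c + l} (\<lambda>z. G z \<tau>)"
    proof (rule integral_le[OF _ Gi])
      fix z assume "z \<in> {c - l..c + l}"
      then have "\<bar>z - c\<bar> \<le> l" by auto
      from m[OF _ _ this, of \<tau>] \<tau> show "m \<le> G z \<tau>"
        using GF[of z \<tau>] x0 pq by (auto simp: tri_def)
    qed auto
    also have "\<dots> \<le> I y s \<tau>"
      unfolding I_def
    proof (rule integral_subset_le[OF _ Gi Gi])
      show "{c - l..c + l} \<subseteq> {y - s + \<tau>..y + s - \<tau>}"
      proof
        fix z assume "z \<in> {c - l..c + l}"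
        then have "\<bar>z - c\<bar> \<le> l" by auto
        from m[OF _ _ this, of \<tau>] \<tau> show "z \<in> {y - s + \<tau>..y + s - \<tau>}" by (auto simp: abs_le_iff)
      qed
    qed (use \<tau> pq x0 G0 in auto)
    finally show "m * (2 * l) \<le> I y s \<tau>" .
  qed (use Ii pq x0 in auto)
  also have "\<dots> \<le> integral {t0..s} (I y s)"
    by (rule integral_subset_le) (use Ii I0 pq x0 in auto)
  finally have 2: "m * (2 * l) * (q - p) \<le> integral {t0..s} (I y s)" .
  have "duh F y s = duh G y s"
    by (rule duh_cong) (auto simp: tri_def intro!: GF[symmetric])
  also have "\<dots> = integral {0..s} (I y s)" by (simp add: duh_def I_def[abs_def])
  also have "\<dots> = integral {0..t0} (I y s) + integral {t0..s} (I y s)"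
    by (rule Henstock_Kurzweil_Integration.integral_combine[symmetric]) (use Ii x0 t0s in auto)
  finally show ?thesis using 1 2 by linarith
qed

section \<open>Geometry of the maximal domain\<close>

lemma max_domain_subcone:
  assumes "(x, t) \<in> max_domain u0 u1" "\<bar>x' - x\<bar> \<le> t - t'" "0 \<le> t'"
  shows "(x', t') \<in> max_domain u0 u1"
proof -
  obtain s v where s: "s > t" "solution_on_cone u0 u1 v x s"
    using assms(1) by (auto simp: max_domain_def)
  have "solution_on_cone u0 u1 v x' (s - \<bar>x' - x\<bar>)"
    by (rule solution_on_subcone[OF _ s(2)]) simp
  moreover have "t' < s - \<bar>x' - x\<bar>" using s assms by linarith
  ultimately show ?thesis using assms(3) unfolding max_domain_def by blast
qed

lemma max_domain_open:
  assumes "(x, t) \<in> max_domain u0 u1" obtains t' where "t' > t" "(x, t') \<in> max_domain u0 u1"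
proof -
  obtain s v where s: "s > t" "0 \<le> t" "solution_on_cone u0 u1 v x s"
    using assms by (auto simp: max_domain_def)
  then have "(x, (t + s) / 2) \<in> max_domain u0 u1"
    unfolding max_domain_def by (auto intro!: exI[of _ s])
  then show thesis by (rule that[rotated]) (use s in auto)
qed

locale blowup =
  fixes u0 u1 :: "real \<Rightarrow> real" and u :: "real \<Rightarrow> real \<Rightarrow> real"
  assumes u0: "continuous_on UNIV u0" and u1: "L2_locu u1" and blowup: "blowup_solution u0 u1 u"
begin

abbreviation "D \<equiv> max_domain u0 u1"
abbreviation "T \<equiv> blowup_time u0 u1"
abbreviation "A \<equiv> wave_plus u0 u1"
abbreviation "B \<equiv> wave_minus u0 u1"

lemma missing_point: obtains y s where "0 \<le> s" "(y, s) \<notin> D"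
proof -
  have "D \<subseteq> UNIV \<times> {0..}" by (auto simp: max_domain_def)
  moreover have "D \<noteq> UNIV \<times> {0..}" using blowup by (simp add: blowup_solution_def)
  ultimately obtain p where "p \<in> UNIV \<times> {0..}" "p \<notin> D" by auto
  then show thesis using that[of "snd p" "fst p"] by auto
qed

text \<open>One missing point suffices: it lies in the backward light cone of every point far enough
  above it, and the domain contains the backward light cones of its points.\<close>

lemma domain_bounded: obtains K where "K \<ge> 0" "\<And>x t. (x, t) \<in> D \<Longrightarrow> t < K + \<bar>x\<bar>"
proof -
  obtain y s where y: "0 \<le> s" "(y, s) \<notin> D" using missing_point .
  show thesis
  proof (rule that[of "s + \<bar>y\<bar>"])
    show "t < s + \<bar>y\<bar> + \<bar>x\<bar>" if "(x, t) \<in> D" for x t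
    proof (rule ccontr)
      assume "\<not> t < s + \<bar>y\<bar> + \<bar>x\<bar>"
      then have "\<bar>y - x\<bar> \<le> t - s" by linarith
      from max_domain_subcone[OF that this y(1)] y(2) show False by simp
    qed
  qed (use y in auto)
qed

lemma fibre_bdd: "bdd_above {t. (x, t) \<in> D}"
proof -
  obtain K where "K \<ge> 0" "\<And>x t. (x, t) \<in> D \<Longrightarrow> t < K + \<bar>x\<bar>"
    by (rule domain_bounded) (rule that)
  then show ?thesis by (intro bdd_aboveI[of _ "K + \<bar>x\<bar>"]) (auto intro: less_imp_le)
qed

lemma less_T: assumes "(x, t) \<in> D" shows "t < T x"
proof -
  obtain t' where "t' > t" "(x, t') \<in> D" using max_domain_open[OF assms] .
  then have "t' \<le> T x" unfolding blowup_time_def by (intro cSup_upper fibre_bdd) auto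
  then show ?thesis using \<open>t' > t\<close> by simp
qed

lemma in_domainI: assumes "(x, t) \<in> D" "0 \<le> t'" "t' < T x" shows "(x, t') \<in> D"
proof -
  obtain s where "(x, s) \<in> D" "t' < s"
    using less_cSupD[of "{t. (x, t) \<in> D}" t'] assms unfolding blowup_time_def by auto
  then show ?thesis using max_domain_subcone[of x s u0 u1 x t'] assms by auto
qed

lemma domain_cone: assumes "(x, t) \<in> D" "0 \<le> t'" "\<bar>x' - x\<bar> < T x - t'" shows "(x', t') \<in> D"
proof -
  define s where "s = (t' + \<bar>x' - x\<bar> + T x) / 2"
  have "(x, s) \<in> D" by (rule in_domainI[OF assms(1)]) (use assms in \<open>auto simp: s_def\<close>)
  then show ?thesis by (rule max_domain_subcone) (use assms in \<open>auto simp: s_def field_simps\<close>)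
qed

lemma solution_at:
  assumes "(x, t) \<in> D" obtains t' where "t' > t" "solution_on_cone u0 u1 u x t'"
  using blowup assms unfolding blowup_solution_def maximal_solution_def by blast

lemma D_nonneg: "(x, t) \<in> D \<Longrightarrow> 0 \<le> t"
  by (auto simp: max_domain_def)

lemma duhamel_D:
  assumes "(x, t) \<in> D"
  shows "u x t = A (x + t) + B (x - t) + duh (\<lambda>z \<tau>. exp (u z \<tau>)) x t / 2"
proof -
  obtain t' where "t' > t" "solution_on_cone u0 u1 u x t'" using solution_at[OF assms] .
  then show ?thesis
    by (intro solution_duhamel(1)[OF _ u0 u1]) (use D_nonneg[OF assms] in auto)
qed

lemma continuous_on_D: "continuous_on D (\<lambda>(x, t). u x t)"
  unfolding continuous_on_eq_continuous_within
proof safe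
  fix x t assume xt: "(x, t) \<in> D"
  obtain t' where t': "t' > t" "solution_on_cone u0 u1 u x t'" using solution_at[OF xt] .
  \<comment> \<open>\<open>solution_duhamel\<close> gives continuity within a single cone. Dropping
    the condition on the sign of the time makes the set open, so that its intersection with
    \<open>D\<close> is a neighbourhood of the point in \<open>D\<close>.\<close>
  define U where "U = {p::real\<times>real. \<bar>fst p - x\<bar> < t' - snd p}"
  have U: "open U" unfolding U_def by (intro open_Collect_less continuous_intros)
  have "continuous (at (x, t) within {(y, s). 0 \<le> s \<and> \<bar>y - x\<bar> < t' - s}) (\<lambda>(x, t). u x t)"
    by (rule solution_duhamel(2)[OF t'(2) u0 u1]) (use t' D_nonneg[OF xt] in auto)
  then have "continuous (at (x, t) within D \<inter> U) (\<lambda>(x, t). u x t)"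
    by (rule continuous_within_subset) (auto simp: U_def dest: D_nonneg)
  moreover have "at (x, t) within D \<inter> U = at (x, t) within D"
    by (rule at_within_nhd[of _ U]) (use U t' in \<open>auto simp: U_def\<close>)
  ultimately show "continuous (at (x, t) within D) (\<lambda>(x, t). u x t)" by simp
qed

lemma triangle_subset_D: "(x, t) \<in> D \<Longrightarrow> tri x t \<subseteq> D"
  by (auto simp: tri_def intro: max_domain_subcone)

lemma continuous_exp_u: "(x, t) \<in> D \<Longrightarrow> continuous_on (tri x t) (\<lambda>(z, \<tau>). exp (u z \<tau>))"
  using continuous_on_exp[OF continuous_on_subset[OF continuous_on_D triangle_subset_D]]
  by (simp add: split_beta')

lemma free_wave_bounded:
  obtains \<kappa> where "\<kappa> \<ge> 0" "\<And>y. \<bar>y\<bar> \<le> M \<Longrightarrow> \<bar>A y\<bar> \<le> \<kappa>" "\<And>y. \<bar>y\<bar> \<le> M \<Longrightarrow> \<bar>B y\<bar> \<le> \<kappa>"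
proof -
  have b: "\<exists>k. \<forall>y\<in>{-M..M}. \<bar>f y\<bar> \<le> k" if "continuous_on {-M..M} f" for f :: "real \<Rightarrow> real"
    using compact_imp_bounded[OF compact_continuous_image[OF that]] by (auto simp: bounded_iff)
  obtain k k' where k: "\<forall>y\<in>{-M..M}. \<bar>A y\<bar> \<le> k" "\<forall>y\<in>{-M..M}. \<bar>B y\<bar> \<le> k'"
    using b[OF wave_continuous(1)[OF u0 u1]] b[OF wave_continuous(2)[OF u0 u1]] by blast
  show thesis
  proof (rule that[of "max 0 (max k k')"])
    fix y assume "\<bar>y\<bar> \<le> M"
    then have "y \<in> {-M..M}" by auto
    with k have "\<bar>A y\<bar> \<le> k" "\<bar>B y\<bar> \<le> k'" by blast+
    then show "\<bar>A y\<bar> \<le> max 0 (max k k')" "\<bar>B y\<bar> \<le> max 0 (max k k')" by linarith+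
  qed simp
qed

text \<open>On the forward light cone of a point, \<open>u\<close> gains one unit after each of the time steps
  \<open>4 * exp (- n / 4) * exp (- m / 2)\<close>, whose sum is finite.\<close>

lemma blowup_after_large_value:
  assumes S: "(x0, S) \<in> D" and t0: "0 \<le> t0" "t0 \<le> S"
    and \<kappa>: "\<And>y. \<bar>y - x0\<bar> \<le> S \<Longrightarrow> \<bar>A y\<bar> \<le> \<kappa>" "\<And>y. \<bar>y - x0\<bar> \<le> S \<Longrightarrow> \<bar>B y\<bar> \<le> \<kappa>"
  defines "m \<equiv> u x0 t0 - 4 * \<kappa>"
  shows "S - t0 \<le> 4 / (1 - exp (- (1/4))) * exp (- m / 2)"
proof (rule ccontr)
  assume contra: "\<not> S - t0 \<le> 4 / (1 - exp (- (1/4))) * exp (- m / 2)"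
  \<comment> \<open>With this step, half of \<open>exp (m + n)\<close> times the area of the
    rectangle used below is \<open>2 * exp (n / 2) \<ge> n + 2\<close>. The steps form a geometric
    series, whence the constant \<open>4 / (1 - exp (- (1/4)))\<close>.\<close>
  define h where "h n = 4 * exp (- (1/4)) ^ n * exp (- m / 2)" for n :: nat
  define tn where "tn n = t0 + (\<Sum>i<n. h i)" for n
  have h0: "0 < h n" for n by (simp add: h_def)
  have tS: "tn n \<le> S" and t0n: "t0 \<le> tn n" for n
  proof -
    have q: "exp (- (1/4)) < (1::real)" by simp
    have "(\<Sum>i<n. exp (- (1/4)) ^ i) \<le> 1 / (1 - exp (- (1/4)::real))"
      using q by (subst sum_gp_strict) (auto intro!: divide_right_mono)
    then have "4 * exp (- m / 2) * (\<Sum>i<n. exp (- (1/4)) ^ i) \<le> 4 * exp (- m / 2) * (1 / (1 - exp (- (1/4)::real)))"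
      by (intro mult_left_mono) auto
    moreover have "(\<Sum>i<n. h i) = 4 * exp (- m / 2) * (\<Sum>i<n. exp (- (1/4)) ^ i)"
      by (simp add: h_def sum_distrib_left mult_ac)
    ultimately show "tn n \<le> S" using contra by (simp add: tn_def mult.commute)
    show "t0 \<le> tn n" using h0 by (simp add: tn_def sum_nonneg less_imp_le)
  qed
  have wave: "\<bar>A (y + s) + B (y - s)\<bar> \<le> 2 * \<kappa>" if "(y, s) \<in> tri x0 S" for y s
    using \<kappa>(1)[of "y + s"] \<kappa>(2)[of "y - s"] that by (auto simp: tri_def abs_le_iff)
  have inD: "(y, s) \<in> D" if "(y, s) \<in> tri x0 S" for y s
    using that triangle_subset_D[OF S] by auto
  have x0t: "(x0, t0) \<in> tri x0 S" using t0 by (auto simp: tri_def)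
  \<comment> \<open>The free waves at two points differ by at most \<open>4 * \<kappa>\<close>,
    which is the loss built into \<open>m\<close>. What is left is the monotonicity of the Duhamel
    integral.\<close>
  have low: "u y s \<ge> m + d * (2 * l) * (q - p) / 2"
    if ys: "(y, s) \<in> tri x0 S" "\<bar>y - x0\<bar> \<le> s - t0" "t0 \<le> p" "p \<le> q" "q \<le> s" "0 \<le> l"
      and d: "\<And>z \<tau>. p \<le> \<tau> \<Longrightarrow> \<tau> \<le> q \<Longrightarrow> \<bar>z - x0\<bar> \<le> l \<Longrightarrow> \<bar>z - y\<bar> \<le> s - \<tau> \<and> d \<le> exp (u z \<tau>)"
    for y s p q l d
  proof -
    have "duh (\<lambda>z \<tau>. exp (u z \<tau>)) x0 t0 + d * (2 * l) * (q - p) \<le> duh (\<lambda>z \<tau>. exp (u z \<tau>)) y s"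
      by (rule duh_lower[where c = x0]) (use ys d t0 continuous_exp_u[OF inD[OF ys(1)]] in auto)
    with duhamel_D[OF inD[OF ys(1)]] duhamel_D[OF inD[OF x0t]] wave[OF ys(1)] wave[OF x0t]
    show ?thesis unfolding m_def by linarith
  qed
  have step: "\<forall>y s. (y, s) \<in> tri x0 S \<longrightarrow> \<bar>y - x0\<bar> \<le> s - tn n \<longrightarrow> m + real n \<le> u y s" for n
  proof (induction n)
    case 0
    show ?case
    proof (intro allI impI)
      fix y s assume "(y, s) \<in> tri x0 S" "\<bar>y - x0\<bar> \<le> s - tn 0"
      then have "m + 0 * (2 * 0) * (t0 - t0) / 2 \<le> u y s"
        by (intro low) (auto simp: tn_def)
      then show "m + real 0 \<le> u y s" by simp
    qed
  next
    case (Suc n)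
    show ?case
    proof (intro allI impI)
      fix y s assume ys: "(y, s) \<in> tri x0 S" "\<bar>y - x0\<bar> \<le> s - tn (Suc n)"
      have tS: "tn (Suc n) = tn n + h n" by (simp add: tn_def)
      \<comment> \<open>The gain is counted from \<open>m\<close> and not from \<open>m + n\<close>,
        so the rectangle has to supply \<open>n + 1\<close> at once. It sits in the middle of the
        time step, with a quarter of the step as half-width, inside both the forward cone of
        \<open>(x0, tn n)\<close> and the backward cone of \<open>(y, s)\<close>.\<close>
      have "m + exp (m + real n) * (2 * (h n / 4)) * ((tn n + 3 * h n / 4) - (tn n + h n / 4)) / 2 \<le> u y s"
      proof (rule low[OF ys(1)])
        fix z \<tau> assume z: "tn n + h n / 4 \<le> \<tau>" "\<tau> \<le> tn n + 3 * h n / 4" "\<bar>z - x0\<bar> \<le> h n / 4"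
        have zy: "\<bar>z - y\<bar> \<le> s - \<tau>" using z ys(2) tS by linarith
        have "(z, \<tau>) \<in> tri x0 S"
          using zy ys(1) z t0n[of n] t0 h0[of n] unfolding tri_def by auto
        moreover have "\<bar>z - x0\<bar> \<le> \<tau> - tn n" using z by linarith
        ultimately have "m + real n \<le> u z \<tau>" using Suc by blast
        then show "\<bar>z - y\<bar> \<le> s - \<tau> \<and> exp (m + real n) \<le> exp (u z \<tau>)" using zy by simp
      qed (use ys(2) tS t0n[of n] h0[of n] in \<open>auto\<close>)
      moreover have "m + real (Suc n) \<le> m + exp (m + real n) * (2 * (h n / 4)) * ((tn n + 3 * h n / 4) - (tn n + h n / 4)) / 2"
      proof -
        have e: "exp (- (1/4)) ^ n = exp (- (real n / 4))"
          by (simp add: exp_of_nat_mult[symmetric])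
        have "(h n)\<^sup>2 = 16 * (exp (- (real n / 4)) * exp (- m / 2))\<^sup>2"
          unfolding h_def e by (simp add: power_mult_distrib)
        also have "\<dots> = 16 * exp (- (real n / 2) - m)"
          by (simp add: exp_add[symmetric] exp_double[symmetric] algebra_simps)
        finally have hh: "(h n)\<^sup>2 = 16 * exp (- (real n / 2) - m)" .
        have "exp (m + real n) * (2 * (h n / 4)) * ((tn n + 3 * h n / 4) - (tn n + h n / 4)) / 2 = exp (m + real n) * (h n)\<^sup>2 / 8"
          by (simp add: power2_eq_square field_simps)
        also have "\<dots> = 2 * (exp (m + real n) * exp (- (real n / 2) - m))" unfolding hh by simp
        also have "exp (m + real n) * exp (- (real n / 2) - m) = exp (real n / 2)"
          by (simp add: exp_add[symmetric])
        finally have "exp (m + real n) * (2 * (h n / 4)) * ((tn n + 3 * h n / 4) - (tn n + h n / 4)) / 2 = 2 * exp (real n / 2)" .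
        moreover have "1 + real n / 2 \<le> exp (real n / 2)" by (rule exp_ge_add_one_self)
        ultimately show ?thesis unfolding of_nat_Suc by linarith
      qed
      ultimately show "m + real (Suc n) \<le> u y s" by linarith
    qed
  qed
  \<comment> \<open>Every level is reached by time \<open>S\<close>, but \<open>u x0 S\<close> is
    finite.\<close>
  obtain n where "u x0 S - m < real n" using reals_Archimedean2 by blast
  moreover have "m + real n \<le> u x0 S"
    using step[of n] tS[of n] t0 by (auto simp: tri_def)
  ultimately show False by simp
qed

lemma T_bounded:
  obtains K where "K \<ge> 0" "\<And>x t. (x, t) \<in> D \<Longrightarrow> T x \<le> K + \<bar>x\<bar>"
proof -
  obtain K where K: "K \<ge> 0" "\<And>x t. (x, t) \<in> D \<Longrightarrow> t < K + \<bar>x\<bar>"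
    by (rule domain_bounded) (rule that)
  show thesis
  proof (rule that[OF K(1)])
    show "T x \<le> K + \<bar>x\<bar>" if "(x, t) \<in> D" for x t
      unfolding blowup_time_def by (rule cSup_least) (use that K(2) in \<open>auto intro: less_imp_le\<close>)
  qed
qed

lemma infdist_graph_le: "(x, t) \<in> D \<Longrightarrow> infdist (x, t) (blowup_graph u0 u1) \<le> T x - t"
  using infdist_le[of "(x, T x)" "blowup_graph u0 u1" "(x, t)"] less_T[of x t]
  by (auto simp: blowup_graph_def dist_prod_def dist_real_def)

lemma upper_bound:
  "\<exists>C>0. \<forall>(x, t) \<in> D \<inter> D_R R. exp (u x t) * (infdist (x, t) (blowup_graph u0 u1))\<^sup>2 \<le> C"
proof -
  obtain K where K: "K \<ge> 0" "\<And>x t. (x, t) \<in> D \<Longrightarrow> T x \<le> K + \<bar>x\<bar>"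
    by (rule T_bounded) (rule that)
  \<comment> \<open>For \<open>\<bar>x\<bar> < R\<close> and \<open>S < T x \<le> K + R\<close> the
    base of the light cone of \<open>(x, S)\<close> lies in
    \<open>\<bar>y\<bar> \<le> K + 2 * R\<close>.\<close>
  obtain \<kappa> where \<kappa>: "\<kappa> \<ge> 0" "\<And>y. \<bar>y\<bar> \<le> K + 2 * R \<Longrightarrow> \<bar>A y\<bar> \<le> \<kappa>" "\<And>y. \<bar>y\<bar> \<le> K + 2 * R \<Longrightarrow> \<bar>B y\<bar> \<le> \<kappa>"
    by (rule free_wave_bounded[of "K + 2 * R"]) (rule that)
  define c where "c = 4 / (1 - exp (- (1/4 :: real)))"
  have c: "c > 0" by (simp add: c_def)
  have "exp (u x t) * (infdist (x, t) (blowup_graph u0 u1))\<^sup>2 \<le> c\<^sup>2 * exp (4 * \<kappa>)"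
    if xt: "(x, t) \<in> D" "(x, t) \<in> D_R R" for x t
  proof -
    have t: "0 \<le> t" "\<bar>x\<bar> < R" using xt by (auto simp: D_R_def)
    define m where "m = u x t - 4 * \<kappa>"
    \<comment> \<open>The estimate needs a point of the domain, so it is applied at times
      \<open>S\<close> below the blow-up time, which then tend to it.\<close>
    have "S \<le> t + c * exp (- m / 2)" if S: "S < T x" "t < S" for S
    proof -
      have SD: "(x, S) \<in> D" by (rule in_domainI[OF xt(1)]) (use t S in auto)
      have "S \<le> K + R" using S K(2)[OF xt(1)] t by linarith
      then have le: "\<bar>y\<bar> \<le> K + 2 * R" if "\<bar>y - x\<bar> \<le> S" for y using that t by linarith
      have "S - t \<le> c * exp (- m / 2)"
        unfolding c_def m_def by (rule blowup_after_large_value[OF SD]) (use t S \<kappa> le in auto)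
      then show ?thesis by simp
    qed
    then have "T x \<le> t + c * exp (- m / 2)"
      by (intro dense_le_bounded[OF less_T[OF xt(1)]]) auto
    then have i: "infdist (x, t) (blowup_graph u0 u1) \<le> c * exp (- m / 2)"
      using infdist_graph_le[OF xt(1)] by simp
    have "exp (u x t) * (infdist (x, t) (blowup_graph u0 u1))\<^sup>2 \<le> exp (u x t) * (c * exp (- m / 2))\<^sup>2"
      by (intro mult_left_mono power_mono i infdist_nonneg) auto
    also have "\<dots> = c\<^sup>2 * (exp (u x t) * exp (- m))"
      by (simp add: power_mult_distrib exp_double[symmetric])
    also have "exp (u x t) * exp (- m) = exp (4 * \<kappa>)"
      unfolding exp_add[symmetric] by (simp add: m_def)
    finally show ?thesis .
  qed
  then show ?thesis
    using c by (intro exI[of _ "c\<^sup>2 * exp (4 * \<kappa>)"]) auto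
qed

end

section \<open>The equation with truncated nonlinearity\<close>

text \<open>\<open>t - \<tau>\<close> is half the width of the backward triangle at time \<tau>. An
  exponential weight in time thus gains a factor \<open>1 / l^2\<close> under the Duhamel
  integral.\<close>

lemma weighted_cone_integral:
  fixes l t :: real
  assumes "l > 0" "0 \<le> t"
  shows "(\<lambda>\<tau>. (t - \<tau>) * exp (l * \<tau>)) integrable_on {0..t}"
    and "integral {0..t} (\<lambda>\<tau>. (t - \<tau>) * exp (l * \<tau>)) \<le> exp (l * t) / l\<^sup>2"
proof -
  have "((\<lambda>\<tau>. (t - \<tau>) * exp (l * \<tau>)) has_integral
      ((t - t) / l + 1 / l\<^sup>2) * exp (l * t) - ((t - 0) / l + 1 / l\<^sup>2) * exp (l * 0)) {0..t}"
    by (rule fundamental_theorem_of_calculus[OF assms(2)])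
      (use assms in \<open>auto intro!: derivative_eq_intros simp: has_real_derivative_iff_has_vector_derivative[symmetric]
          field_simps power2_eq_square\<close>)
  then show "(\<lambda>\<tau>. (t - \<tau>) * exp (l * \<tau>)) integrable_on {0..t}"
    and "integral {0..t} (\<lambda>\<tau>. (t - \<tau>) * exp (l * \<tau>)) \<le> exp (l * t) / l\<^sup>2"
    using divide_nonneg_pos[OF assms(2,1)] by (auto simp: has_integral_iff add_nonneg_nonneg intro: order_trans[of _ 0])
qed

text \<open>In the sup norm weighted by \<open>exp (- l * \<tau>)\<close> the Duhamel integral has
  norm at most \<open>2 / l^2\<close>, for all times at once. Large \<open>l\<close> makes the
  truncated problem contractive without splitting time into short intervals.\<close>

lemma duh_diff_bound:
  assumes F: "continuous_on (tri x t) (\<lambda>(z, \<tau>). F z \<tau>)" and H: "continuous_on (tri x t) (\<lambda>(z, \<tau>). H z \<tau>)"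
    and "l > 0" "0 \<le> t" "0 \<le> c"
    and b: "\<And>z \<tau>. (z, \<tau>) \<in> tri x t \<Longrightarrow> \<bar>F z \<tau> - H z \<tau>\<bar> \<le> c * exp (l * \<tau>)"
  shows "\<bar>duh F x t - duh H x t\<bar> \<le> 2 * c * exp (l * t) / l\<^sup>2"
proof -
  obtain F' where F': "continuous_on UNIV (\<lambda>(z, \<tau>). F' z \<tau>)" "\<And>z \<tau>. (z, \<tau>) \<in> tri x t \<Longrightarrow> F' z \<tau> = F z \<tau>"
    using triangle_extension[OF F] by blast
  obtain H' where H': "continuous_on UNIV (\<lambda>(z, \<tau>). H' z \<tau>)" "\<And>z \<tau>. (z, \<tau>) \<in> tri x t \<Longrightarrow> H' z \<tau> = H z \<tau>"
    using triangle_extension[OF H] by blast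
  have eq: "duh F x t = duh F' x t" "duh H x t = duh H' x t"
    by (rule duh_cong, use F' H' in \<open>auto simp: tri_def\<close>)+
  define I where "I G \<tau> = integral {x - t + \<tau>..x + t - \<tau>} (\<lambda>z. G z \<tau>)" for G :: "real \<Rightarrow> real \<Rightarrow> real" and \<tau>
  have Ii: "I F' integrable_on {0..t}" "I H' integrable_on {0..t}"
    unfolding I_def by (intro integrable_continuous_real duh_inner_continuous F' H')+
  have "norm (integral {0..t} (\<lambda>\<tau>. I F' \<tau> - I H' \<tau>)) \<le> integral {0..t} (\<lambda>\<tau>. (2 * c) * ((t - \<tau>) * exp (l * \<tau>)))"
  proof (rule integral_norm_bound_integral)
    show "(\<lambda>\<tau>. I F' \<tau> - I H' \<tau>) integrable_on {0..t}" by (intro integrable_diff Ii)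
    show "(\<lambda>\<tau>. (2 * c) * ((t - \<tau>) * exp (l * \<tau>))) integrable_on {0..t}"
      by (intro integrable_on_mult_right weighted_cone_integral assms)
    fix \<tau> assume \<tau>: "\<tau> \<in> {0..t}"
    have i: "(\<lambda>z. F' z \<tau>) integrable_on {x - t + \<tau>..x + t - \<tau>}" "(\<lambda>z. H' z \<tau>) integrable_on {x - t + \<tau>..x + t - \<tau>}"
      by (intro integrable_continuous_real continuous_slice F' H')+
    have "norm (integral {x - t + \<tau>..x + t - \<tau>} (\<lambda>z. F' z \<tau> - H' z \<tau>)) \<le> integral {x - t + \<tau>..x + t - \<tau>} (\<lambda>z. c * exp (l * \<tau>))"
    proof (rule integral_norm_bound_integral)
      fix z assume "z \<in> {x - t + \<tau>..x + t - \<tau>}"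
      then have "(z, \<tau>) \<in> tri x t" using \<tau> by (auto simp: tri_def)
      then show "norm (F' z \<tau> - H' z \<tau>) \<le> c * exp (l * \<tau>)" using b F' H' by auto
    qed (auto intro: integrable_diff i)
    then show "norm (I F' \<tau> - I H' \<tau>) \<le> (2 * c) * ((t - \<tau>) * exp (l * \<tau>))"
      using \<tau> unfolding I_def integral_diff[OF i, symmetric] by (simp add: algebra_simps)
  qed
  also have "\<dots> \<le> (2 * c) * (exp (l * t) / l\<^sup>2)"
    unfolding integral_mult_right using assms by (intro mult_left_mono weighted_cone_integral) auto
  finally have "\<bar>integral {0..t} (I F') - integral {0..t} (I H')\<bar> \<le> 2 * c * exp (l * t) / l\<^sup>2"
    by (simp add: integral_diff[OF Ii])
  then show ?thesis unfolding eq by (simp add: duh_def I_def[abs_def])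
qed

text \<open>Unchanged up to level \<open>k\<close>, but bounded and Lipschitz on the whole line, so
  that the equation with this nonlinearity has a solution for all times.\<close>

definition trunc_exp :: "real \<Rightarrow> real \<Rightarrow> real" where
  "trunc_exp k v = exp (min v k)"

lemma trunc_exp_lipschitz: "\<bar>trunc_exp k a - trunc_exp k b\<bar> \<le> exp k * \<bar>a - b\<bar>"
proof -
  have "\<bar>trunc_exp k a - trunc_exp k b\<bar> \<le> exp k * \<bar>min a k - min b k\<bar>"
    unfolding trunc_exp_def by (rule exp_diff_le) auto
  also have "\<dots> \<le> exp k * \<bar>a - b\<bar>" by (intro mult_left_mono) auto
  finally show ?thesis .
qed

lemma trunc_exp_bounds: "0 \<le> trunc_exp k v" "trunc_exp k v \<le> exp k"
  by (auto simp: trunc_exp_def)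

lemma continuous_on_trunc_exp [continuous_intros]:
  "continuous_on S f \<Longrightarrow> continuous_on S (\<lambda>x. trunc_exp k (f x))"
  unfolding trunc_exp_def by (intro continuous_intros)

text \<open>Banach's fixed point theorem on bounded continuous functions, for the Duhamel part
  divided by \<open>exp (l * t)\<close>.\<close>

lemma truncated_solution:
  fixes A B :: "real \<Rightarrow> real" and k :: real
  assumes A: "continuous_on UNIV A" and B: "continuous_on UNIV B"
  obtains v where "continuous_on UNIV (\<lambda>(x, t). v x t)"
    "\<And>x t. 0 \<le> t \<Longrightarrow> v x t = A (x + t) + B (x - t) + duh (\<lambda>z \<tau>. trunc_exp k (v z \<tau>)) x t / 2"
proof -
  \<comment> \<open>\<open>l^2 = 2 * exp k\<close> turns the Lipschitz constant \<open>exp k\<close>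
    of the nonlinearity into the contraction constant 1/2.\<close>
  define l where "l = sqrt (2 * exp k)"
  have l: "l > 0" "exp k / l\<^sup>2 = 1/2" by (auto simp: l_def)
  \<comment> \<open>\<open>g\<close> is the rescaled Duhamel part. Free waves and weight are frozen
    at time 0 for negative \<tau>, so that all functions are continuous on the whole plane.\<close>
  define V where "V g z \<tau> = A (z + max 0 \<tau>) + B (z - max 0 \<tau>) + exp (l * max 0 \<tau>) * apply_bcontfun g (z, \<tau>)"
    for g :: "(real \<times> real) \<Rightarrow>\<^sub>C real" and z \<tau> :: real
  define F where "F g z \<tau> = trunc_exp k (V g z \<tau>)" for g z \<tau>
  have Vc: "continuous_on UNIV (\<lambda>(z, \<tau>). V g z \<tau>)" for g
    unfolding V_def split_beta
    by (intro continuous_intros continuous_on_compose2[OF A] continuous_on_compose2[OF B]) auto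
  have Fc: "continuous_on UNIV (\<lambda>(z, \<tau>). F g z \<tau>)" for g
    using continuous_on_trunc_exp[OF Vc[of g], of k] by (simp add: F_def split_beta)
  define \<Phi> where "\<Phi> g p = exp (- l * max 0 (snd p)) * (wduh (F g) (fst p) (max 0 (snd p)) / 2)" for g p
  have \<Phi>c: "continuous_on UNIV (\<Phi> g)" for g
    unfolding \<Phi>_def by (intro continuous_intros continuous_on_UNIV_section[OF wduh_continuous[OF Fc]]) auto
  have diff: "\<bar>exp (- l * t) * (duh G x t / 2) - exp (- l * t) * (duh H x t / 2)\<bar> \<le> c / l\<^sup>2"
    if "continuous_on UNIV (\<lambda>(z, \<tau>). G z \<tau>)" "continuous_on UNIV (\<lambda>(z, \<tau>). H z \<tau>)" "0 \<le> t" "0 \<le> c"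
      "\<And>z \<tau>. 0 \<le> \<tau> \<Longrightarrow> \<bar>G z \<tau> - H z \<tau>\<bar> \<le> c * exp (l * \<tau>)" for G H x t c
  proof -
    have "\<bar>duh G x t - duh H x t\<bar> \<le> 2 * c * exp (l * t) / l\<^sup>2"
      using that l by (intro duh_diff_bound continuous_on_subset[OF that(1)] continuous_on_subset[OF that(2)])
        (auto simp: tri_def)
    then have "exp (- l * t) / 2 * \<bar>duh G x t - duh H x t\<bar> \<le> exp (- l * t) / 2 * (2 * c * exp (l * t) / l\<^sup>2)"
      by (intro mult_left_mono) auto
    also have "\<dots> = c / l\<^sup>2 * (exp (- l * t) * exp (l * t))" by simp
    also have "exp (- l * t) * exp (l * t) = 1" by (simp add: exp_add[symmetric])
    also have "exp (- l * t) / 2 * \<bar>duh G x t - duh H x t\<bar> = \<bar>exp (- l * t) * (duh G x t / 2) - exp (- l * t) * (duh H x t / 2)\<bar>"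
      by (simp add: abs_mult right_diff_distrib[symmetric] diff_divide_distrib[symmetric])
    finally show ?thesis by simp
  qed
  have \<Phi>_duh: "\<Phi> g (x, t) = exp (- l * max 0 t) * (duh (F g) x (max 0 t) / 2)" for g x t
    by (simp add: \<Phi>_def duh_eq_wduh[OF Fc])
  have \<Phi>b: "\<Phi> g \<in> bcontfun" for g
  proof (rule bcontfun_normI[OF \<Phi>c, of _ "exp k / l\<^sup>2"])
    fix p :: "real \<times> real"
    \<comment> \<open>Boundedness is the difference estimate against the zero source: the truncated
      exponential is at most \<open>exp k\<close>, hence at most
      \<open>exp k * exp (l * \<tau>)\<close>.\<close>
    have "\<bar>exp (- l * max 0 (snd p)) * (duh (F g) (fst p) (max 0 (snd p)) / 2) - exp (- l * max 0 (snd p)) * (duh (\<lambda>_ _. 0) (fst p) (max 0 (snd p)) / 2)\<bar> \<le> exp k / l\<^sup>2"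
    proof (rule diff[OF Fc])
      fix z \<tau> :: real assume "0 \<le> \<tau>"
      then have "exp k * 1 \<le> exp k * exp (l * \<tau>)" using l by (intro mult_left_mono) auto
      then show "\<bar>F g z \<tau> - 0\<bar> \<le> exp k * exp (l * \<tau>)"
        unfolding F_def using trunc_exp_bounds[of k "V g z \<tau>"] by linarith
    qed auto
    moreover have "duh (\<lambda>_ _. 0) y s = 0" for y s by (simp add: duh_def)
    ultimately show "norm (\<Phi> g p) \<le> exp k / l\<^sup>2"
      unfolding \<Phi>_duh[of g "fst p" "snd p", unfolded prod.collapse] by simp
  qed
  define \<Psi> where "\<Psi> g = Bcontfun (\<Phi> g)" for g
  have \<Psi>: "apply_bcontfun (\<Psi> g) = \<Phi> g" for g
    unfolding \<Psi>_def by (rule Bcontfun_inverse[OF \<Phi>b])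
  have "dist (\<Psi> g) (\<Psi> h) \<le> 1/2 * dist g h" for g h
  proof (rule dist_bound)
    fix p :: "real \<times> real"
    have "\<bar>exp (- l * max 0 (snd p)) * (duh (F g) (fst p) (max 0 (snd p)) / 2) - exp (- l * max 0 (snd p)) * (duh (F h) (fst p) (max 0 (snd p)) / 2)\<bar> \<le> exp k * dist g h / l\<^sup>2"
    proof (rule diff[OF Fc Fc])
      fix z \<tau> :: real assume \<tau>: "0 \<le> \<tau>"
      have "\<bar>F g z \<tau> - F h z \<tau>\<bar> \<le> exp k * \<bar>V g z \<tau> - V h z \<tau>\<bar>"
        unfolding F_def by (rule trunc_exp_lipschitz)
      also have "\<bar>V g z \<tau> - V h z \<tau>\<bar> = exp (l * \<tau>) * dist (apply_bcontfun g (z, \<tau>)) (apply_bcontfun h (z, \<tau>))"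
        using \<tau> by (simp add: V_def dist_real_def abs_mult right_diff_distrib[symmetric])
      also have "exp k * (exp (l * \<tau>) * dist (apply_bcontfun g (z, \<tau>)) (apply_bcontfun h (z, \<tau>))) \<le> exp k * (exp (l * \<tau>) * dist g h)"
        by (intro mult_left_mono dist_bounded) auto
      finally show "\<bar>F g z \<tau> - F h z \<tau>\<bar> \<le> exp k * dist g h * exp (l * \<tau>)" by (simp add: mult_ac)
    qed auto
    also have "exp k * dist g h / l\<^sup>2 = 1/2 * dist g h" using l(2) by simp
    finally show "dist (apply_bcontfun (\<Psi> g) p) (apply_bcontfun (\<Psi> h) p) \<le> 1/2 * dist g h"
      unfolding \<Psi> dist_real_def \<Phi>_duh[of _ "fst p" "snd p", unfolded prod.collapse] by simp
  qed
  then obtain g where g: "\<Psi> g = g"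
    using banach_fix_type[of "1/2" \<Psi>] by auto
  show thesis
  proof (rule that[of "V g"])
    show "continuous_on UNIV (\<lambda>(x, t). V g x t)" by (rule Vc)
    fix x t :: real assume t: "0 \<le> t"
    have "apply_bcontfun g (x, t) = exp (- l * t) * (duh (F g) x t / 2)"
      using \<Psi>[of g] \<Phi>_duh[of g x t] g t by simp
    then have "exp (l * t) * apply_bcontfun g (x, t) = (exp (l * t) * exp (- l * t)) * (duh (F g) x t / 2)"
      by simp
    also have "exp (l * t) * exp (- l * t) = 1" by (simp add: exp_add[symmetric])
    finally show "V g x t = A (x + t) + B (x - t) + duh (\<lambda>z \<tau>. trunc_exp k (V g z \<tau>)) x t / 2"
      using t by (simp add: V_def F_def[abs_def])
  qed
qed

text \<open>The weighted difference attains its maximum \<open>M\<close> on the compact triangle,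
  and at the maximum point the contraction estimate gives \<open>2 * M \<le> M\<close>. As
  \<open>u \<le> k\<close> on the triangle, its nonlinearity is also the truncated one.\<close>

lemma truncated_unique:
  assumes v: "continuous_on UNIV (\<lambda>(x, t). v x t)"
    "\<And>x t. 0 \<le> t \<Longrightarrow> v x t = A (x + t) + B (x - t) + duh (\<lambda>z \<tau>. trunc_exp k (v z \<tau>)) x t / 2"
    and u: "continuous_on (tri x0 t0) (\<lambda>(x, t). u x t)"
    "\<And>x t. (x, t) \<in> tri x0 t0 \<Longrightarrow> u x t = A (x + t) + B (x - t) + duh (\<lambda>z \<tau>. exp (u z \<tau>)) x t / 2"
    "\<And>x t. (x, t) \<in> tri x0 t0 \<Longrightarrow> u x t \<le> k"
    and xt: "(x, t) \<in> tri x0 t0"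
  shows "u x t = v x t"
proof -
  define l where "l = sqrt (2 * exp k)"
  have l: "l > 0" "exp k / l\<^sup>2 = 1/2" by (auto simp: l_def)
  define d where "d p = exp (- l * snd p) * \<bar>(\<lambda>(x, t). u x t) p - (\<lambda>(x, t). v x t) p\<bar>" for p
  have "continuous_on (tri x0 t0) d"
    unfolding d_def by (intro continuous_intros u(1) continuous_on_subset[OF v(1)]) auto
  then obtain p where p: "p \<in> tri x0 t0" "\<And>q. q \<in> tri x0 t0 \<Longrightarrow> d q \<le> d p"
    using continuous_attains_sup[OF compact_triangle, of x0 t0 d] xt by blast
  define M where "M = d p"
  have M0: "M \<ge> 0" by (simp add: M_def d_def)
  have le: "\<bar>u z \<tau> - v z \<tau>\<bar> \<le> M * exp (l * \<tau>)" if "(z, \<tau>) \<in> tri x0 t0" for z \<tau>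
  proof -
    have "exp (l * \<tau>) * d (z, \<tau>) \<le> exp (l * \<tau>) * M" using p(2)[OF that] by (intro mult_left_mono) (auto simp: M_def)
    moreover have "exp (l * \<tau>) * d (z, \<tau>) = \<bar>u z \<tau> - v z \<tau>\<bar>"
      by (simp add: d_def mult.assoc[symmetric] exp_add[symmetric])
    ultimately show ?thesis unfolding mult.commute[of M] by linarith
  qed
  obtain y s where ys: "p = (y, s)" by (cases p)
  have s: "0 \<le> s" using p(1) by (auto simp: ys tri_def)
  have sub: "tri y s \<subseteq> tri x0 t0" using p(1) by (auto simp: ys tri_def)
  have ex: "exp (u z \<tau>) = trunc_exp k (u z \<tau>)" if "(z, \<tau>) \<in> tri x0 t0" for z \<tau>
    using u(3)[OF that] by (simp add: trunc_exp_def min_def)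
  have "\<bar>duh (\<lambda>z \<tau>. exp (u z \<tau>)) y s - duh (\<lambda>z \<tau>. trunc_exp k (v z \<tau>)) y s\<bar> \<le> 2 * (exp k * M) * exp (l * s) / l\<^sup>2"
  proof (rule duh_diff_bound)
    show "continuous_on (tri y s) (\<lambda>(z, \<tau>). exp (u z \<tau>))"
      using continuous_on_exp[OF continuous_on_subset[OF u(1) sub]] by (simp add: split_beta')
    show "continuous_on (tri y s) (\<lambda>(z, \<tau>). trunc_exp k (v z \<tau>))"
      using continuous_on_trunc_exp[OF continuous_on_subset[OF v(1)], of "tri y s" k] by (simp add: split_beta')
    fix z \<tau> assume "(z, \<tau>) \<in> tri y s"
    then have z: "(z, \<tau>) \<in> tri x0 t0" using sub by auto
    have "\<bar>exp (u z \<tau>) - trunc_exp k (v z \<tau>)\<bar> \<le> exp k * \<bar>u z \<tau> - v z \<tau>\<bar>"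
      unfolding ex[OF z] by (rule trunc_exp_lipschitz)
    also have "\<dots> \<le> exp k * (M * exp (l * \<tau>))" by (intro mult_left_mono le z) auto
    finally show "\<bar>exp (u z \<tau>) - trunc_exp k (v z \<tau>)\<bar> \<le> exp k * M * exp (l * \<tau>)" by (simp add: mult_ac)
  qed (use l s M0 in auto)
  also have "2 * (exp k * M) * exp (l * s) / l\<^sup>2 = 2 * M * exp (l * s) * (exp k / l\<^sup>2)" by simp
  also have "\<dots> = M * exp (l * s)" unfolding l(2) by simp
  finally have "\<bar>duh (\<lambda>z \<tau>. exp (u z \<tau>)) y s - duh (\<lambda>z \<tau>. trunc_exp k (v z \<tau>)) y s\<bar> \<le> M * exp (l * s)" .
  moreover have "duh (\<lambda>z \<tau>. exp (u z \<tau>)) y s - duh (\<lambda>z \<tau>. trunc_exp k (v z \<tau>)) y s = 2 * (u y s - v y s)"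
    using u(2)[of y s] v(2)[OF s, of y] p(1) ys by simp
  ultimately have "2 * \<bar>u y s - v y s\<bar> \<le> M * exp (l * s)" by linarith
  then have "exp (- l * s) * (2 * \<bar>u y s - v y s\<bar>) \<le> exp (- l * s) * (M * exp (l * s))"
    by (intro mult_left_mono) auto
  also have "\<dots> = M * (exp (- l * s) * exp (l * s))" by simp
  also have "exp (- l * s) * exp (l * s) = 1" by (simp add: exp_add[symmetric])
  finally have "2 * M \<le> M" by (simp add: M_def d_def ys)
  then have "M = 0" using M0 by simp
  then show ?thesis using le[OF xt] by simp
qed

section \<open>Linearization in null coordinates\<close>

text \<open>With \<open>\<sigma>\<close>, \<open>l\<close> the null coordinates \<open>(x, t) = (x0 + \<sigma> - l, \<sigma> + l)\<close>, \<open>n\<close> the nonlinear part of the solution,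
  \<open>Q = \<integral> exp (A + n) d\<sigma>\<close> and \<open>\<psi> = exp (- n / 2)\<close>, the equation becomes linear:
  \<open>d\<psi>/dl = - exp B * (Q \<psi>) / 2\<close> and \<open>d(Q \<psi>)/dl = exp A * \<psi>\<close> (Liouville). This bounds the
  derivative of \<open>\<psi>\<close> in terms of \<open>A\<close> and \<open>B\<close> alone.\<close>

lemma liouville_lipschitz:
  assumes A: "continuous_on UNIV A" and B: "continuous_on UNIV B"
    and uc: "continuous_on (tri x0 t0) (\<lambda>(x, t). u x t)"
    and u: "\<And>x t. (x, t) \<in> tri x0 t0 \<Longrightarrow> u x t = A (x + t) + B (x - t) + duh (\<lambda>z \<tau>. exp (u z \<tau>)) x t / 2"
    and \<kappa>: "\<And>y. \<bar>y - x0\<bar> \<le> t0 \<Longrightarrow> A y \<le> \<kappa>" "\<And>y. \<bar>y - x0\<bar> \<le> t0 \<Longrightarrow> B y \<le> \<kappa>"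
    and xt: "(x, t) \<in> tri x0 t0" "(x - h, t + h) \<in> tri x0 t0" "0 \<le> h"
  shows "\<bar>exp (- duh (\<lambda>z \<tau>. exp (u z \<tau>)) (x - h) (t + h) / 4) - exp (- duh (\<lambda>z \<tau>. exp (u z \<tau>)) x t / 4)\<bar>
    \<le> exp (2 * \<kappa>) * t0 / 2 * h"
proof -
  have "continuous_on (tri x0 t0) (\<lambda>(z, \<tau>). exp (u z \<tau>))"
    using continuous_on_exp[OF uc] by (simp add: split_beta')
  then obtain G where G: "continuous_on UNIV (\<lambda>(z, \<tau>). G z \<tau>)"
    and GF: "\<And>z \<tau>. (z, \<tau>) \<in> tri x0 t0 \<Longrightarrow> G z \<tau> = exp (u z \<tau>)"
    using triangle_extension[of x0 t0 "\<lambda>z \<tau>. exp (u z \<tau>)"] by blast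
  have duhG: "duh (\<lambda>z \<tau>. exp (u z \<tau>)) y s = wduh G y s" if "(y, s) \<in> tri x0 t0" for y s
  proof -
    have "duh (\<lambda>z \<tau>. exp (u z \<tau>)) y s = duh G y s"
      by (rule duh_cong) (use that in \<open>auto simp: tri_def intro!: GF[symmetric]\<close>)
    also have "\<dots> = wduh G y s" by (rule duh_eq_wduh[OF G]) (use that in \<open>auto simp: tri_def\<close>)
    finally show ?thesis .
  qed
  \<comment> \<open>\<open>n\<close> is the nonlinear part in null coordinates and \<open>nl\<close>
    its derivative in \<open>l\<close>: in the direction \<open>(-1, 1)\<close> only the null side
    \<open>z - \<tau> = x0 - 2 * l\<close> contributes.\<close>
  define n where "n l \<sigma> = wduh G (x0 + \<sigma> - l) (\<sigma> + l) / 2" for l \<sigma>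
  define nl where "nl l \<sigma> = prim (\<lambda>\<tau>. G (x0 - 2 * l + \<tau>) \<tau>) (\<sigma> + l)" for l \<sigma>
  define E where "E \<sigma> = exp (A (x0 + 2 * \<sigma>))" for \<sigma>
  define H where "H l = exp (B (x0 - 2 * l))" for l
  define f where "f l \<sigma> = E \<sigma> * exp (n l \<sigma>)" for l \<sigma>
  have region: "(x0 + \<sigma> - l, \<sigma> + l) \<in> tri x0 t0 \<longleftrightarrow> 0 \<le> \<sigma> + l \<and> 2 * \<sigma> \<le> t0 \<and> 2 * l \<le> t0" for \<sigma> l
    by (auto simp: tri_def abs_le_iff)
  have nD: "((\<lambda>l. n l \<sigma>) has_real_derivative nl l \<sigma>) (at l)" for l \<sigma>
  proof -
    have "((\<lambda>l. wduh G ((x0 + \<sigma>) + (-1) * l) (\<sigma> + 1 * l)) has_real_derivative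
        prim (\<lambda>\<tau>. (-1 + 1) * G (x0 + \<sigma> + \<sigma> + (-1 + 1) * l - \<tau>) \<tau> - (-1 - 1) * G (x0 + \<sigma> - \<sigma> + (-1 - 1) * l + \<tau>) \<tau>) (\<sigma> + 1 * l)) (at l)"
      by (rule wduh_DERIV[OF G])
    moreover have "prim (\<lambda>\<tau>. 2 * G (x0 - 2 * l + \<tau>) \<tau>) y = 2 * prim (\<lambda>\<tau>. G (x0 - 2 * l + \<tau>) \<tau>) y" for y
      by (simp add: prim_def)
    ultimately show ?thesis
      unfolding n_def nl_def by (auto intro!: derivative_eq_intros simp: algebra_simps)
  qed
  have nc: "continuous_on UNIV (\<lambda>(l, \<sigma>). n l \<sigma>)"
    unfolding n_def split_beta by (intro continuous_intros continuous_on_UNIV_section[OF wduh_continuous[OF G]]) auto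
  have "continuous_on UNIV (\<lambda>(l, \<tau>). G (x0 - 2 * l + \<tau>) \<tau>)"
    unfolding split_beta by (intro continuous_intros continuous_on_UNIV_section[OF G])
  then have nlc: "continuous_on UNIV (\<lambda>(l, \<sigma>). nl l \<sigma>)"
    unfolding nl_def split_beta
    by (intro continuous_on_UNIV_section[OF prim_continuous_param] continuous_intros) (simp add: split_beta)
  have Ec: "continuous_on S E" for S
    unfolding E_def by (intro continuous_intros continuous_on_compose2[OF A]) auto
  have fc: "continuous_on UNIV (\<lambda>(l, \<sigma>). f l \<sigma>)"
    unfolding f_def split_beta
    by (intro continuous_intros continuous_on_compose2[OF Ec] continuous_on_UNIV_section[OF nc]) auto
  have f'c: "continuous_on UNIV (\<lambda>(l, \<sigma>). f l \<sigma> * nl l \<sigma>)"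
    unfolding split_beta
    by (intro continuous_intros continuous_on_UNIV_section[OF fc] continuous_on_UNIV_section[OF nlc])
  have fD: "((\<lambda>l. f l \<sigma>) has_real_derivative f l \<sigma> * nl l \<sigma>) (at l)" for l \<sigma>
    unfolding f_def by (auto intro!: derivative_eq_intros nD)
  have fs: "continuous_on S (f l)" for S l
    by (rule continuous_on_UNIV_section[OF fc]) (auto intro: continuous_intros)
  have fs': "continuous_on S (\<lambda>\<sigma>. f l \<sigma> * nl l \<sigma>)" for S l
    by (rule continuous_on_UNIV_section[OF f'c]) (auto intro: continuous_intros)
  \<comment> \<open>The line of constant \<open>l\<close> meets time 0 at
    \<open>\<sigma> = - l\<close>, where the integral starts.\<close>
  define Q where "Q l \<sigma> = prim (f l) \<sigma> - prim (f l) (- l)" for l \<sigma>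
  have n0: "n l (- l) = 0" for l by (simp add: n_def wduh_def)
  \<comment> \<open>Along this line \<open>B\<close> has the constant argument
    \<open>x0 - 2 * l\<close>, so that \<open>exp u\<close> is \<open>H l\<close> times the
    integrand of \<open>Q\<close>.\<close>
  have nl_Q: "nl l \<sigma> = H l * Q l \<sigma>" if r: "0 \<le> \<sigma> + l" "2 * \<sigma> \<le> t0" "2 * l \<le> t0" for l \<sigma>
  proof -
    have "nl l \<sigma> = integral {0..\<sigma> + l} (\<lambda>\<tau>. G (x0 - 2 * l + \<tau>) \<tau>)"
      unfolding nl_def by (rule prim_nonneg_eq[OF r(1)])
    also have "\<dots> = integral {0..\<sigma> + l} (\<lambda>\<tau>. H l * f l (\<tau> - l))"
    proof (rule integral_cong)
      fix \<tau> assume \<tau>: "\<tau> \<in> {0..\<sigma> + l}"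
      then have p: "(x0 + (\<tau> - l) - l, (\<tau> - l) + l) \<in> tri x0 t0" using r by (subst region) auto
      then have "(x0 - 2 * l + \<tau>, \<tau>) \<in> tri x0 t0" by (simp add: algebra_simps)
      from GF[OF this] u[OF this] duhG[OF this]
      show "G (x0 - 2 * l + \<tau>) \<tau> = H l * f l (\<tau> - l)"
        by (simp add: H_def f_def E_def n_def exp_add[symmetric] algebra_simps)
    qed
    also have "\<dots> = H l * (Q l \<sigma>)"
    proof -
      have "((\<lambda>\<tau>. f l (\<tau> - l)) has_integral (prim (f l) (\<sigma> + l - l) - prim (f l) (0 - l))) {0..\<sigma> + l}"
      proof (rule fundamental_theorem_of_calculus[OF r(1)])
        fix \<tau>
        have "((\<lambda>\<tau>. \<tau> - l) has_real_derivative 1) (at \<tau>)" by (auto intro!: derivative_eq_intros)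
        from DERIV_chain2[OF prim_DERIV[OF fs] this]
        show "((\<lambda>\<tau>. prim (f l) (\<tau> - l)) has_vector_derivative f l (\<tau> - l)) (at \<tau> within {0..\<sigma> + l})"
          by (simp add: has_real_derivative_iff_has_vector_derivative[symmetric] has_field_derivative_at_within)
      qed
      then show ?thesis by (simp add: has_integral_iff Q_def)
    qed
    finally show ?thesis .
  qed
  \<comment> \<open>A Riccati equation: the boundary term at time 0 is \<open>E (- l)\<close>
    because \<open>n\<close> vanishes there, and the integral of \<open>H * Q * f\<close> is
    \<open>H * Q^2 / 2\<close> because \<open>f\<close> is the \<sigma>-derivative of
    \<open>Q\<close>.\<close>
  have QD: "((\<lambda>l. Q l \<sigma>) has_real_derivative E (- l) + H l * (Q l \<sigma>)\<^sup>2 / 2) (at l)"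
    if r: "0 \<le> \<sigma> + l" "2 * \<sigma> \<le> t0" "2 * l \<le> t0" for l \<sigma>
  proof -
    have "((\<lambda>l. prim (f l) \<sigma> - prim (f l) (- l)) has_real_derivative
        (f l \<sigma> * 0 + prim (\<lambda>\<sigma>. f l \<sigma> * nl l \<sigma>) \<sigma>) - (f l (- l) * (- 1) + prim (\<lambda>\<sigma>. f l \<sigma> * nl l \<sigma>) (- l))) (at l)"
      by (intro derivative_intros prim_leibniz[OF fc f'c fD])
    moreover have "prim (\<lambda>\<sigma>. f l \<sigma> * nl l \<sigma>) \<sigma> - prim (\<lambda>\<sigma>. f l \<sigma> * nl l \<sigma>) (- l) = H l * (Q l \<sigma>)\<^sup>2 / 2"
    proof -
      have "prim (\<lambda>\<sigma>. f l \<sigma> * nl l \<sigma>) \<sigma> - prim (\<lambda>\<sigma>. f l \<sigma> * nl l \<sigma>) (- l) = integral {- l..\<sigma>} (\<lambda>\<sigma>. f l \<sigma> * nl l \<sigma>)"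
        by (rule prim_diff) (use r in \<open>auto intro!: integrable_continuous_real fs'\<close>)
      also have "\<dots> = integral {- l..\<sigma>} (\<lambda>s. H l * Q l s * f l s)"
        by (rule integral_cong) (use r in \<open>auto simp: nl_Q\<close>)
      also have "\<dots> = H l * (Q l \<sigma>)\<^sup>2 / 2 - H l * (Q l (- l))\<^sup>2 / 2"
      proof (rule integral_unique[OF fundamental_theorem_of_calculus])
        fix s
        have "(Q l has_real_derivative f l s) (at s)"
          unfolding Q_def by (auto intro!: derivative_eq_intros prim_DERIV fs)
        then have "((\<lambda>s. H l * (Q l s)\<^sup>2 / 2) has_real_derivative H l * Q l s * f l s) (at s)"
          by (auto intro!: derivative_eq_intros)
        then show "((\<lambda>s. H l * (Q l s)\<^sup>2 / 2) has_vector_derivative H l * Q l s * f l s) (at s within {- l..\<sigma>})"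
          by (simp add: has_real_derivative_iff_has_vector_derivative[symmetric] has_field_derivative_at_within)
      qed (use r in auto)
      finally show ?thesis by (simp add: Q_def)
    qed
    moreover have "f l (- l) = E (- l)" by (simp add: f_def n0)
    ultimately show ?thesis
      unfolding Q_def[symmetric] by (auto elim!: DERIV_cong)
  qed
  define \<psi> where "\<psi> l \<sigma> = exp (- n l \<sigma> / 2)" for l \<sigma>
  \<comment> \<open>Moving from \<open>(x, t)\<close> to \<open>(x - h, t + h)\<close> keeps
    \<sigma> and raises \<open>l\<close> by \<open>h\<close>.\<close>
  define \<sigma> where "\<sigma> = (t + (x - x0)) / 2"
  define l1 where "l1 = (t - (x - x0)) / 2"
  define l2 where "l2 = l1 + h"
  have p1: "x0 + \<sigma> - l1 = x" "\<sigma> + l1 = t" and p2: "x0 + \<sigma> - l2 = x - h" "\<sigma> + l2 = t + h"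
    by (simp_all add: \<sigma>_def l1_def l2_def field_simps)
  have r1: "0 \<le> \<sigma> + l1" "2 * \<sigma> \<le> t0" "2 * l1 \<le> t0" and r2: "2 * l2 \<le> t0"
    using region[of \<sigma> l1] region[of \<sigma> l2] xt unfolding p1 p2 by auto
  have reg: "0 \<le> \<sigma> + l \<and> 2 * \<sigma> \<le> t0 \<and> 2 * l \<le> t0" if "l \<in> {-\<sigma>..l2}" for l
    using that r1 r2 by auto
  have \<psi>1: "0 \<le> \<psi> l \<sigma>" "\<psi> l \<sigma> \<le> 1" if "l \<in> {-\<sigma>..l2}" for l
  proof -
    show "0 \<le> \<psi> l \<sigma>" by (simp add: \<psi>_def)
    have p: "(x0 + \<sigma> - l, \<sigma> + l) \<in> tri x0 t0" using reg[OF that] by (simp add: region)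
    have "0 \<le> duh G (x0 + \<sigma> - l) (\<sigma> + l)"
      unfolding duh_def
    proof (intro integral_nonneg integrable_continuous_real duh_inner_continuous continuous_slice G)
      fix \<tau> z assume "\<tau> \<in> {0..\<sigma> + l}" "z \<in> {x0 + \<sigma> - l - (\<sigma> + l) + \<tau>..x0 + \<sigma> - l + (\<sigma> + l) - \<tau>}"
      then have "(z, \<tau>) \<in> tri x0 t0" using reg[OF that] by (auto simp: tri_def abs_le_iff)
      then show "0 \<le> G z \<tau>" by (simp add: GF)
    qed
    also have "\<dots> = wduh G (x0 + \<sigma> - l) (\<sigma> + l)" by (rule duh_eq_wduh[OF G]) (use reg[OF that] in auto)
    finally show "\<psi> l \<sigma> \<le> 1" by (simp add: \<psi>_def n_def)
  qed
  have \<psi>D: "((\<lambda>l. \<psi> l \<sigma>) has_real_derivative - (H l / 2) * (Q l \<sigma> * \<psi> l \<sigma>)) (at l)" if "l \<in> {-\<sigma>..l2}" for l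
  proof -
    have "((\<lambda>l. \<psi> l \<sigma>) has_real_derivative exp (- n l \<sigma> / 2) * (- nl l \<sigma> / 2)) (at l)"
      unfolding \<psi>_def by (auto intro!: derivative_eq_intros nD)
    then show ?thesis using nl_Q[of \<sigma> l] reg[OF that] by (simp add: \<psi>_def mult_ac)
  qed
  \<comment> \<open>The quadratic term of the Riccati equation cancels against the one from the
    derivative of \<psi>; this is what makes the system linear.\<close>
  have Q\<psi>D: "((\<lambda>l. Q l \<sigma> * \<psi> l \<sigma>) has_real_derivative E (- l) * \<psi> l \<sigma>) (at l)" if "l \<in> {-\<sigma>..l2}" for l
  proof -
    have "((\<lambda>l. Q l \<sigma> * \<psi> l \<sigma>) has_real_derivative
        (E (- l) + H l * (Q l \<sigma>)\<^sup>2 / 2) * \<psi> l \<sigma> + (- (H l / 2) * (Q l \<sigma> * \<psi> l \<sigma>)) * Q l \<sigma>) (at l)"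
      by (rule DERIV_mult[OF QD \<psi>D[OF that]]) (use reg[OF that] in auto)
    then show ?thesis by (simp add: algebra_simps power2_eq_square)
  qed
  have t0: "0 \<le> t0" using xt(1) by (auto simp: tri_def)
  have EH: "0 \<le> E (- l)" "E (- l) \<le> exp \<kappa>" "0 \<le> H l" "H l \<le> exp \<kappa>" if "l \<in> {-\<sigma>..l2}" for l
    using reg[OF that] \<kappa> t0 r1 by (auto simp: E_def H_def abs_le_iff)
  \<comment> \<open>\<open>Q\<close> vanishes at \<open>l = - \<sigma>\<close>, that is at time 0,
    and the elapsed time \<open>l + \<sigma>\<close> is at most \<open>t0\<close>. With \<psi> at
    most 1, the bound does not involve the size of \<open>u\<close>.\<close>
  have Q\<psi>: "0 \<le> Q l \<sigma> * \<psi> l \<sigma> \<and> Q l \<sigma> * \<psi> l \<sigma> \<le> exp \<kappa> * t0" if l: "l \<in> {-\<sigma>..l2}" for l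
  proof (cases "l = - \<sigma>")
    case True
    then show ?thesis using t0 by (simp add: Q_def)
  next
    case False
    then have lt: "- \<sigma> < l" using l by auto
    have "\<exists>z>- \<sigma>. z < l \<and> Q l \<sigma> * \<psi> l \<sigma> - Q (- \<sigma>) \<sigma> * \<psi> (- \<sigma>) \<sigma> = (l - (- \<sigma>)) * (E (- z) * \<psi> z \<sigma>)"
      by (rule MVT2[OF lt]) (use l in \<open>auto intro!: Q\<psi>D\<close>)
    then obtain z where z: "- \<sigma> < z" "z < l" "Q l \<sigma> * \<psi> l \<sigma> = (l + \<sigma>) * (E (- z) * \<psi> z \<sigma>)"
      by (auto simp: Q_def)
    have zl: "z \<in> {-\<sigma>..l2}" using z l by auto
    have "E (- z) * \<psi> z \<sigma> \<le> exp \<kappa> * 1" using EH[OF zl] \<psi>1[OF zl] by (intro mult_mono) auto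
    then have "(l + \<sigma>) * (E (- z) * \<psi> z \<sigma>) \<le> t0 * exp \<kappa>"
      using reg[OF l] EH[OF zl] \<psi>1[OF zl] t0 by (intro mult_mono) auto
    moreover have "0 \<le> (l + \<sigma>) * (E (- z) * \<psi> z \<sigma>)"
      using EH[OF zl] \<psi>1[OF zl] lt by auto
    ultimately show ?thesis unfolding z(3) by (simp add: mult.commute)
  qed
  have "\<bar>\<psi> l2 \<sigma> - \<psi> l1 \<sigma>\<bar> \<le> exp (2 * \<kappa>) * t0 / 2 * h"
  proof (cases "h = 0")
    case True then show ?thesis by (simp add: l2_def)
  next
    case False
    then have lt: "l1 < l2" using xt(3) by (simp add: l2_def)
    have "\<exists>z>l1. z < l2 \<and> \<psi> l2 \<sigma> - \<psi> l1 \<sigma> = (l2 - l1) * (- (H z / 2) * (Q z \<sigma> * \<psi> z \<sigma>))"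
    proof (rule MVT2[OF lt])
      fix l assume "l1 \<le> l" "l \<le> l2"
      then show "((\<lambda>l. \<psi> l \<sigma>) has_real_derivative - (H l / 2) * (Q l \<sigma> * \<psi> l \<sigma>)) (at l)"
        using r1 by (intro \<psi>D) auto
    qed
    then obtain z where z: "l1 < z" "z < l2" "\<psi> l2 \<sigma> - \<psi> l1 \<sigma> = h * (- (H z / 2) * (Q z \<sigma> * \<psi> z \<sigma>))"
      by (auto simp: l2_def)
    have zl: "z \<in> {-\<sigma>..l2}" using z r1 by auto
    have "(H z / 2) * (Q z \<sigma> * \<psi> z \<sigma>) \<le> (exp \<kappa> / 2) * (exp \<kappa> * t0)"
      by (rule mult_mono) (use EH[OF zl] Q\<psi>[OF zl] in auto)
    also have "\<dots> = exp (2 * \<kappa>) * t0 / 2" by (simp add: exp_double power2_eq_square)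
    finally have "h * ((H z / 2) * (Q z \<sigma> * \<psi> z \<sigma>)) \<le> h * (exp (2 * \<kappa>) * t0 / 2)"
      using xt(3) by (intro mult_left_mono) auto
    moreover have "0 \<le> h * ((H z / 2) * (Q z \<sigma> * \<psi> z \<sigma>))"
      by (rule mult_nonneg_nonneg[OF xt(3) mult_nonneg_nonneg]) (use EH[OF zl] Q\<psi>[OF zl] in auto)
    ultimately show ?thesis unfolding z(3) by (simp add: mult_ac)
  qed
  moreover have "\<psi> l1 \<sigma> = exp (- duh (\<lambda>z \<tau>. exp (u z \<tau>)) x t / 4)"
    unfolding duhG[OF xt(1)] \<psi>_def n_def p1 by simp
  moreover have "\<psi> l2 \<sigma> = exp (- duh (\<lambda>z \<tau>. exp (u z \<tau>)) (x - h) (t + h) / 4)"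
    unfolding duhG[OF xt(2)] \<psi>_def n_def p2 by simp
  ultimately show ?thesis by simp
qed

lemma duh_reflect: "duh (\<lambda>z \<tau>. F (- z) \<tau>) x t = duh F (- x) t"
proof -
  have "integral {x - t + \<tau>..x + t - \<tau>} (\<lambda>z. F (- z) \<tau>) = integral {- x - t + \<tau>..- x + t - \<tau>} (\<lambda>z. F z \<tau>)" for \<tau>
    using Henstock_Kurzweil_Integration.integral_reflect_real[where b="- x + t - \<tau>" and a="- x - t + \<tau>" and f="\<lambda>z. F z \<tau>"]
    by (simp add: algebra_simps)
  then show ?thesis by (simp add: duh_def)
qed

text \<open>Reflection in space exchanges \<open>A\<close> and \<open>B\<close> and turns motion to
  the right into motion to the left.\<close>

lemma liouville_lipschitz_right:
  assumes A: "continuous_on UNIV A" and B: "continuous_on UNIV B"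
    and uc: "continuous_on (tri x0 t0) (\<lambda>(x, t). u x t)"
    and u: "\<And>x t. (x, t) \<in> tri x0 t0 \<Longrightarrow> u x t = A (x + t) + B (x - t) + duh (\<lambda>z \<tau>. exp (u z \<tau>)) x t / 2"
    and \<kappa>: "\<And>y. \<bar>y - x0\<bar> \<le> t0 \<Longrightarrow> A y \<le> \<kappa>" "\<And>y. \<bar>y - x0\<bar> \<le> t0 \<Longrightarrow> B y \<le> \<kappa>"
    and xt: "(x, t) \<in> tri x0 t0" "(x + h, t + h) \<in> tri x0 t0" "0 \<le> h"
  shows "\<bar>exp (- duh (\<lambda>z \<tau>. exp (u z \<tau>)) (x + h) (t + h) / 4) - exp (- duh (\<lambda>z \<tau>. exp (u z \<tau>)) x t / 4)\<bar>
    \<le> exp (2 * \<kappa>) * t0 / 2 * h"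
proof -
  have tri: "(- z, \<tau>) \<in> tri x0 t0 \<longleftrightarrow> (z, \<tau>) \<in> tri (- x0) t0" for z \<tau>
    by (auto simp: tri_def abs_le_iff)
  note r = duh_reflect[of "\<lambda>z \<tau>. exp (u z \<tau>)"]
  have "\<bar>exp (- duh (\<lambda>z \<tau>. exp (u (- z) \<tau>)) (- x - h) (t + h) / 4) - exp (- duh (\<lambda>z \<tau>. exp (u (- z) \<tau>)) (- x) t / 4)\<bar>
    \<le> exp (2 * \<kappa>) * t0 / 2 * h"
  proof (rule liouville_lipschitz[where A="\<lambda>y. B (- y)" and B="\<lambda>y. A (- y)" and ?x0.0="- x0" and u="\<lambda>z \<tau>. u (- z) \<tau>" and x="- x"])
    show "continuous_on UNIV (\<lambda>y. B (- y))" "continuous_on UNIV (\<lambda>y. A (- y))"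
      by (intro continuous_on_compose2[OF B] continuous_on_compose2[OF A] continuous_intros; simp)+
    have "continuous_on (tri (- x0) t0) (\<lambda>p. (\<lambda>(x, t). u x t) (- fst p, snd p))"
      by (intro continuous_on_compose2[OF uc] continuous_intros) (auto simp: tri)
    then show "continuous_on (tri (- x0) t0) (\<lambda>(x, t). u (- x) t)" by (simp add: split_beta')
    fix y s assume "(y, s) \<in> tri (- x0) t0"
    then show "u (- y) s = B (- (y + s)) + A (- (y - s)) + duh (\<lambda>z \<tau>. exp (u (- z) \<tau>)) y s / 2"
    proof -
      have e: "- (y + s) = - y - s" "- (y - s) = - y + s" by simp_all
      show ?thesis
        using u[of "- y" s] \<open>(y, s) \<in> tri (- x0) t0\<close> unfolding r tri e by linarith
    qed
  next
    fix y assume "\<bar>y - - x0\<bar> \<le> t0"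
    then show "B (- y) \<le> \<kappa>" "A (- y) \<le> \<kappa>" by (auto intro!: \<kappa>)
  qed (use xt tri[of "-x" t] tri[of "- x - h" "t + h"] in \<open>auto simp: add.commute\<close>)
  moreover have "- (- x - h) = x + h" by simp
  ultimately show ?thesis unfolding r minus_minus by argo
qed

section \<open>Regularity of bounded free waves and Duhamel integrals\<close>

lemma bounded_measurable_integrable:
  fixes a :: "real \<Rightarrow> real"
  assumes "a \<in> borel_measurable lebesgue" "\<And>x. \<bar>a x\<bar> \<le> M" "S \<in> lmeasurable"
  shows "set_integrable lebesgue S a" "a integrable_on S" "(LINT x:S|lebesgue. a x) = integral S a"
proof -
  have m: "set_borel_measurable lebesgue S a"
    unfolding set_borel_measurable_def using assms(1,3)
    by (intro borel_measurable_scaleR borel_measurable_indicator) (auto simp: fmeasurable_def)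
  show i: "set_integrable lebesgue S a"
    by (rule set_integrable_bound_real[OF set_integrable_const[OF assms(3), of M] m]) (use assms(2) in auto)
  show "a integrable_on S" "(LINT x:S|lebesgue. a x) = integral S a"
    using set_lebesgue_integral_eq_integral[OF i] by auto
qed

lemma continuous_measurable_lebesgue: "continuous_on UNIV (g :: real \<Rightarrow> real) \<Longrightarrow> g \<in> borel_measurable lebesgue"
  by (simp add: borel_measurable_continuous_onI measurable_completion)

text \<open>Continuous functions that converge almost everywhere are clipped to
  \<open>[-M, M]\<close>, so that dominated convergence applies and the bound \<open>M\<close> is
  kept.\<close>

lemma L1_approximation:
  fixes a :: "real \<Rightarrow> real"
  assumes a: "a \<in> borel_measurable lebesgue" "\<And>x. \<bar>a x\<bar> \<le> M" and e: "e > 0"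
  obtains g where "continuous_on UNIV g" "\<And>x. \<bar>g x\<bar> \<le> M" "integral {c..d} (\<lambda>x. \<bar>a x - g x\<bar>) < e"
proof -
  have "a measurable_on UNIV"
    by (rule lebesgue_measurable_imp_measurable_on[OF a(1)]) simp
  then obtain N g where N: "negligible N" and g: "\<And>n. continuous_on UNIV (g n)"
    "\<And>x. x \<notin> N \<Longrightarrow> (\<lambda>n. g n x) \<longlonglongrightarrow> a x"
    unfolding measurable_on_def by auto
  have M: "0 \<le> M" using a(2)[of 0] by linarith
  define h where "h n x = max (- M) (min M (g n x))" for n x
  have hc: "continuous_on UNIV (h n)" for n unfolding h_def by (intro continuous_intros g)
  have hb: "\<bar>h n x\<bar> \<le> M" for n x using M by (auto simp: h_def)
  have hl: "(\<lambda>n. h n x) \<longlonglongrightarrow> a x" if "x \<notin> N" for x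
  proof -
    have "(\<lambda>n. h n x) \<longlonglongrightarrow> max (- M) (min M (a x))"
      unfolding h_def by (intro tendsto_intros g(2) that)
    moreover have "max (- M) (min M (a x)) = a x" using a(2)[of x] by (auto simp: abs_le_iff)
    ultimately show ?thesis by simp
  qed
  define f where "f n x = \<bar>a x - h n x\<bar>" for n x
  have fm: "f n \<in> borel_measurable lebesgue" for n
    unfolding f_def by (intro borel_measurable_abs borel_measurable_diff a continuous_measurable_lebesgue hc)
  have fb: "\<bar>f n x\<bar> \<le> 2 * M" for n x using a(2)[of x] hb[of n x] by (auto simp: f_def)
  have "(\<lambda>n. LINT x:{c..d}|lebesgue. f n x) \<longlonglongrightarrow> (LINT x:{c..d}|lebesgue. 0)"
    unfolding set_lebesgue_integral_def
  proof (rule integral_dominated_convergence[where w="\<lambda>x. indicator {c..d} x *\<^sub>R (2 * M)"])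
    show "integrable lebesgue (\<lambda>x. indicator {c..d} x *\<^sub>R (2 * M))"
      using set_integrable_const[of "{c..d}" "2 * M"] by (simp add: set_integrable_def)
    show "(\<lambda>x. indicator {c..d} x *\<^sub>R f n x) \<in> borel_measurable lebesgue" for n
      by (intro borel_measurable_scaleR borel_measurable_indicator fm) auto
    show "AE x in lebesgue. (\<lambda>n. indicator {c..d} x *\<^sub>R f n x) \<longlonglongrightarrow> indicator {c..d} x *\<^sub>R 0"
    proof (rule AE_I')
      show "N \<in> null_sets lebesgue" using N by (simp add: negligible_iff_null_sets)
      have "(\<lambda>n. indicator {c..d} x *\<^sub>R f n x) \<longlonglongrightarrow> indicator {c..d} x *\<^sub>R \<bar>a x - a x\<bar>" if "x \<notin> N" for x
        unfolding f_def by (intro tendsto_intros hl that)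
      then show "{x \<in> space lebesgue. \<not> (\<lambda>n. indicator {c..d} x *\<^sub>R f n x) \<longlonglongrightarrow> indicator {c..d} x *\<^sub>R 0} \<subseteq> N"
        by auto
    qed
    show "AE x in lebesgue. norm (indicator {c..d} x *\<^sub>R f n x) \<le> indicator {c..d} x *\<^sub>R (2 * M)" for n
      using fb[of n] by (intro always_eventually) (auto simp: indicator_def)
  qed auto
  then have "(\<lambda>n. integral {c..d} (f n)) \<longlonglongrightarrow> 0"
    using bounded_measurable_integrable(3)[OF fm fb, of "{c..d}"] by (simp add: set_lebesgue_integral_def)
  then have "\<forall>\<^sub>F n in sequentially. integral {c..d} (f n) < e" by (rule order_tendstoD) (rule e)
  then obtain n where "integral {c..d} (f n) < e" by (auto simp: eventually_sequentially)
  then have "integral {c..d} (\<lambda>x. \<bar>a x - h n x\<bar>) < e" by (simp add: f_def[abs_def])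
  then show thesis by (rule that[OF hc hb])
qed

lemma uniformly_continuous_shift:
  fixes g :: "real \<Rightarrow> real"
  assumes g: "continuous_on UNIV g" and e: "e > 0"
  obtains \<delta> where "0 < \<delta>" "\<delta> \<le> 1" "\<And>x y. \<bar>x\<bar> \<le> R \<Longrightarrow> \<bar>x - y\<bar> < \<delta> \<Longrightarrow> \<bar>g x - g y\<bar> < e"
proof -
  have "uniformly_continuous_on {-R-1..R+1} g"
    by (intro compact_uniformly_continuous continuous_on_subset[OF g]) auto
  then obtain d where d: "d > 0" "\<And>x y. x \<in> {-R-1..R+1} \<Longrightarrow> y \<in> {-R-1..R+1} \<Longrightarrow> dist y x < d \<Longrightarrow> dist (g y) (g x) < e"
    unfolding uniformly_continuous_on_def using e by metis
  show thesis
  proof (rule that[of "min d 1"])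
    fix x y assume "\<bar>x\<bar> \<le> R" "\<bar>x - y\<bar> < min d 1"
    then have "x \<in> {-R-1..R+1}" "y \<in> {-R-1..R+1}" "dist x y < d" by (auto simp: dist_real_def abs_le_iff)
    then show "\<bar>g x - g y\<bar> < e" using d(2)[of y x] by (simp add: dist_real_def)
  qed (use d in auto)
qed

lemma borel_measurable_shift:
  fixes a :: "real \<Rightarrow> real"
  assumes "a \<in> borel_measurable lebesgue" shows "(\<lambda>x. a (x + h)) \<in> borel_measurable lebesgue"
  using borel_measurable_affine[OF assms, of 1 h] by (simp add: add.commute)

lemma integral_shift_le:
  fixes f :: "real \<Rightarrow> real"
  assumes f: "f \<in> borel_measurable lebesgue" "\<And>x. \<bar>f x\<bar> \<le> M" "\<And>x. 0 \<le> f x" and "c \<le> c' + h" "d' + h \<le> d"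
  shows "integral {c'..d'} (\<lambda>x. f (x + h)) \<le> integral {c..d} f"
proof -
  have "integral {c'..d'} (\<lambda>x. f (x + h)) = integral {c' + h..d' + h} f"
    using integral_shift_Icc_real[of "c'" "d'" f h] by (simp add: o_def add.commute)
  also have "\<dots> \<le> integral {c..d} f"
    by (rule integral_subset_le) (use assms bounded_measurable_integrable(2)[OF f(1,2)] in auto)
  finally show ?thesis .
qed

text \<open>The usual density argument. Shifts by at most 1 stay inside the enlarged interval on
  which \<open>g\<close> approximates \<open>a\<close>.\<close>

lemma L1_translation_continuous:
  fixes a :: "real \<Rightarrow> real"
  assumes a: "a \<in> borel_measurable lebesgue" "\<And>x. \<bar>a x\<bar> \<le> M"
  shows "((\<lambda>h. integral {-R..R} (\<lambda>x. \<bar>a (x + h) - a x\<bar>)) \<longlongrightarrow> 0) (at 0)"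
proof (rule tendstoI)
  fix e :: real assume e: "e > 0"
  define R' where "R' = \<bar>R\<bar>"
  \<comment> \<open>Three contributions of at most \<open>e / 4\<close> each: the approximation
    error at \<open>x\<close>, the same at \<open>x + h\<close>, and the oscillation of
    \<open>g\<close> integrated over an interval of length at most \<open>2 * R'\<close>.\<close>
  obtain g where g: "continuous_on UNIV g" "\<And>x. \<bar>g x\<bar> \<le> M" "integral {-R-1..R+1} (\<lambda>x. \<bar>a x - g x\<bar>) < e / 4"
    using L1_approximation[OF a, of "e/4" "-R-1" "R+1"] e by (auto simp: )
  obtain \<delta> where \<delta>: "0 < \<delta>" "\<delta> \<le> 1" "\<And>x y. \<bar>x\<bar> \<le> R' \<Longrightarrow> \<bar>x - y\<bar> < \<delta> \<Longrightarrow> \<bar>g x - g y\<bar> < e / (8 * (R' + 1))"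
    by (rule uniformly_continuous_shift[OF g(1), of "e / (8 * (R' + 1))" R']) (use e in \<open>auto simp: R'_def add_nonneg_pos\<close>)
  define f where "f x = \<bar>a x - g x\<bar>" for x
  have gm: "g \<in> borel_measurable lebesgue" by (rule continuous_measurable_lebesgue[OF g(1)])
  have f: "f \<in> borel_measurable lebesgue" "\<And>x. \<bar>f x\<bar> \<le> 2 * M" "\<And>x. 0 \<le> f x"
  proof -
    show "f \<in> borel_measurable lebesgue"
      unfolding f_def by (intro borel_measurable_abs borel_measurable_diff a gm)
    show "\<bar>f x\<bar> \<le> 2 * M" for x using a(2)[of x] g(2)[of x] by (auto simp: f_def)
  qed (simp add: f_def)
  have "norm (integral {-R..R} (\<lambda>x. \<bar>a (x + h) - a x\<bar>)) < e" if h: "\<bar>h\<bar> < \<delta>" for h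
  proof -
    have i: "f integrable_on {-R..R}" "(\<lambda>x. f (x + h)) integrable_on {-R..R}"
      by (rule bounded_measurable_integrable(2)[OF f(1,2)], simp,
          rule bounded_measurable_integrable(2)[OF borel_measurable_shift[OF f(1)] f(2)], simp)
    have c: "(\<lambda>x. e / (8 * (R' + 1))) integrable_on {-R..R}" by auto
    have "norm (integral {-R..R} (\<lambda>x. \<bar>a (x + h) - a x\<bar>)) \<le> integral {-R..R} (\<lambda>x. f (x + h) + f x + e / (8 * (R' + 1)))"
    proof (rule integral_norm_bound_integral)
      have m: "(\<lambda>x. \<bar>a (x + h) - a x\<bar>) \<in> borel_measurable lebesgue"
        by (intro borel_measurable_abs borel_measurable_diff borel_measurable_shift[OF a(1)] a(1))
      have "\<bar>\<bar>a (x + h) - a x\<bar>\<bar> \<le> 2 * M" for x using a(2)[of x] a(2)[of "x + h"] by auto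
      then show "(\<lambda>x. \<bar>a (x + h) - a x\<bar>) integrable_on {-R..R}"
        by (rule bounded_measurable_integrable(2)[OF m]) simp
      show "(\<lambda>x. f (x + h) + f x + e / (8 * (R' + 1))) integrable_on {-R..R}"
        by (intro integrable_add i c)
      fix x assume "x \<in> {-R..R}"
      then have "\<bar>x\<bar> \<le> R'" by (auto simp: R'_def)
      then have "\<bar>g x - g (x + h)\<bar> < e / (8 * (R' + 1))" using h by (intro \<delta>) auto
      then show "norm \<bar>a (x + h) - a x\<bar> \<le> f (x + h) + f x + e / (8 * (R' + 1))"
        by (simp add: f_def abs_le_iff) (smt (verit))
    qed
    also have "\<dots> = integral {-R..R} (\<lambda>x. f (x + h)) + integral {-R..R} f + integral {-R..R} (\<lambda>x. e / (8 * (R' + 1)))"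
      by (subst integral_add[OF integrable_add[OF i(2,1)] c], subst integral_add[OF i(2,1)]) simp
    finally have 1: "norm (integral {-R..R} (\<lambda>x. \<bar>a (x + h) - a x\<bar>)) \<le> \<dots>" .
    have 2: "integral {-R..R} (\<lambda>x. f (x + h)) \<le> integral {-R-1..R+1} f"
      by (rule integral_shift_le[OF f]) (use h \<delta> in auto)
    have 3: "integral {-R..R} f \<le> integral {-R-1..R+1} f"
      by (rule integral_subset_le) (use f bounded_measurable_integrable(2)[OF f(1,2)] in auto)
    have 4: "integral {-R..R} (\<lambda>x. e / (8 * (R' + 1))) \<le> e / 4"
    proof (cases "0 \<le> R")
      case True
      then have "integral {-R..R} (\<lambda>x. e / (8 * (R' + 1))) = (e / 4) * (R / (R + 1))"
        by (simp add: R'_def field_simps)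
      also have "\<dots> \<le> (e / 4) * 1" using True e by (intro mult_left_mono) auto
      finally show ?thesis by simp
    next
      case False then show ?thesis using e by simp
    qed
    have "integral {-R-1..R+1} f < e / 4" using g(3) by (simp add: f_def[abs_def])
    with 1 2 3 4 e show ?thesis by linarith
  qed
  then show "\<forall>\<^sub>F h in at 0. dist (integral {-R..R} (\<lambda>x. \<bar>a (x + h) - a x\<bar>)) 0 < e"
    unfolding eventually_at using \<delta>(1) by (auto simp: dist_real_def intro!: exI[of _ \<delta>])
qed

text \<open>After the shift the integrals over the common part cancel, and two boundary layers of
  width \<open>h\<close> remain. This controls the L1 norm of the difference quotients of a monotone
  function by its total increment.\<close>

lemma monotone_increment_integral:
  fixes \<Phi> :: "real \<Rightarrow> real"
  assumes "continuous_on UNIV \<Phi>" "mono \<Phi>" "c \<le> d" "0 \<le> h"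
  shows "integral {c..d} (\<lambda>x. \<Phi> (x + h) - \<Phi> x) \<le> h * (\<Phi> (d + h) - \<Phi> c)"
proof -
  have i: "\<Phi> integrable_on {u..v}" for u v
    by (rule integrable_continuous_real[OF continuous_on_subset[OF assms(1)]]) auto
  have ih: "(\<lambda>x. \<Phi> (x + h)) integrable_on {c..d}"
    by (intro integrable_continuous_real continuous_on_compose2[OF assms(1)] continuous_intros) auto
  have "integral {c..d} (\<lambda>x. \<Phi> (x + h) - \<Phi> x) = integral {c + h..d + h} \<Phi> - integral {c..d} \<Phi>"
    using integral_shift_Icc_real[of c d \<Phi> h] by (simp add: integral_diff[OF ih i] o_def add.commute)
  also have eq: "\<dots> = integral {d..d + h} \<Phi> - integral {c..c + h} \<Phi>"
    using Henstock_Kurzweil_Integration.integral_combine[of c "c + h" "d + h" \<Phi>]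
      Henstock_Kurzweil_Integration.integral_combine[of c d "d + h" \<Phi>] i assms by simp
  finally have 1: "integral {c..d} (\<lambda>x. \<Phi> (x + h) - \<Phi> x) = integral {d..d + h} \<Phi> - integral {c..c + h} \<Phi>" .
  have 2: "integral {d..d + h} \<Phi> \<le> integral {d..d + h} (\<lambda>x. \<Phi> (d + h))"
    by (rule integral_le[OF i]) (use assms in \<open>auto dest: monoD\<close>)
  have 3: "integral {c..c + h} \<Phi> \<ge> integral {c..c + h} (\<lambda>x. \<Phi> c)"
    by (rule integral_le[OF _ i]) (use assms in \<open>auto dest: monoD\<close>)
  have "integral {d..d + h} (\<lambda>x. \<Phi> (d + h)) = h * \<Phi> (d + h)" "integral {c..c + h} (\<lambda>x. \<Phi> c) = h * \<Phi> c"
    using assms(4) by auto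
  with 1 2 3 show ?thesis unfolding right_diff_distrib by linarith
qed

text \<open>\<open>a\<close> is approximated by a continuous \<open>g\<close>. The quotient of the
  primitive of \<open>a - g\<close> is dominated by that of the increasing primitive \<Phi> of
  \<open>\<bar>a x - g x\<bar>\<close>, whose integral is bounded by the increment of \<Phi>,
  uniformly in \<open>h\<close>. Differentiation almost everywhere is thereby avoided.\<close>

lemma L1_difference_quotient:
  fixes a A :: "real \<Rightarrow> real"
  assumes a: "a \<in> borel_measurable lebesgue" "\<And>x. \<bar>a x\<bar> \<le> M"
    and A: "\<And>x y. x \<le> y \<Longrightarrow> A y - A x = integral {x..y} a" and Ac: "continuous_on UNIV A"
  shows "((\<lambda>h. integral {-R..R} (\<lambda>x. \<bar>(A (x + h) - A x) / h - a x\<bar>)) \<longlongrightarrow> 0) (at 0)"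
proof (cases "0 \<le> R")
  case False
  then show ?thesis by simp
next
  case R: True
  have Am: "A \<in> borel_measurable lebesgue" by (rule continuous_measurable_lebesgue[OF Ac])
  have M: "0 \<le> M" using a(2)[of 0] by linarith
  show ?thesis
  proof (rule tendstoI)
    fix e :: real assume e: "e > 0"
    obtain g where g: "continuous_on UNIV g" "\<And>x. \<bar>g x\<bar> \<le> M" "integral {-R-1..R+1} (\<lambda>x. \<bar>a x - g x\<bar>) < e / 4"
      using L1_approximation[OF a, of "e/4" "-R-1" "R+1"] e by auto
    obtain \<delta> where \<delta>: "0 < \<delta>" "\<delta> \<le> 1" "\<And>x y. \<bar>x\<bar> \<le> R \<Longrightarrow> \<bar>x - y\<bar> < \<delta> \<Longrightarrow> \<bar>g x - g y\<bar> < e / (8 * (R + 1))"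
      by (rule uniformly_continuous_shift[OF g(1), of "e / (8 * (R + 1))" R]) (use e R in \<open>auto\<close>)
    define f where "f x = \<bar>a x - g x\<bar>" for x
    have gm: "g \<in> borel_measurable lebesgue" by (rule continuous_measurable_lebesgue[OF g(1)])
    have f: "f \<in> borel_measurable lebesgue" "\<And>x. \<bar>f x\<bar> \<le> 2 * M" "\<And>x. 0 \<le> f x"
    proof -
      show "f \<in> borel_measurable lebesgue"
        unfolding f_def by (intro borel_measurable_abs borel_measurable_diff a gm)
      show "\<bar>f x\<bar> \<le> 2 * M" for x using a(2)[of x] g(2)[of x] by (auto simp: f_def)
    qed (simp add: f_def)
    have fi: "f integrable_on {u..v}" for u v by (rule bounded_measurable_integrable(2)[OF f(1,2)]) simp
    have ai: "a integrable_on {u..v}" for u v by (rule bounded_measurable_integrable(2)[OF a]) simp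
    have gi: "g integrable_on {u..v}" for u v by (rule bounded_measurable_integrable(2)[OF gm g(2)]) simp
    define \<Phi> where "\<Phi> = prim f"
    have \<Phi>c: "continuous_on UNIV \<Phi>" unfolding \<Phi>_def by (rule prim_continuous[OF fi])
    have \<Phi>d: "\<Phi> y - \<Phi> x = integral {x..y} f" if "x \<le> y" for x y
      unfolding \<Phi>_def by (rule prim_diff[OF fi that])
    have \<Phi>m: "mono \<Phi>"
      by (rule monoI) (use \<Phi>d integral_nonneg[OF fi] f(3) in \<open>smt (verit)\<close>)
    \<comment> \<open>The point \<open>x'\<close> will be the end of \<open>[x, y]\<close> from
      which the quotient is formed: \<open>x\<close> for positive and \<open>y\<close> for negative
      increments.\<close>
    have quot: "\<bar>(A y - A x) / (y - x) - a x'\<bar> \<le> (\<Phi> y - \<Phi> x) / (y - x) + f x' + e / (8 * (R + 1))"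
      if xy: "x < y" "\<And>s. x \<le> s \<Longrightarrow> s \<le> y \<Longrightarrow> \<bar>g x' - g s\<bar> < e / (8 * (R + 1))" for x y x'
    proof -
      let ?k = "e / (8 * (R + 1))"
      have "norm (integral {x..y} (\<lambda>s. a s - g x')) \<le> integral {x..y} (\<lambda>s. f s + ?k)"
      proof (rule integral_norm_bound_integral)
        fix s assume "s \<in> {x..y}"
        then have "\<bar>g x' - g s\<bar> < ?k" using xy by auto
        then show "norm (a s - g x') \<le> f s + ?k" unfolding f_def real_norm_def by (smt (verit))
      qed (use fi ai in \<open>auto intro!: integrable_add integrable_diff\<close>)
      also have "integral {x..y} (\<lambda>s. f s + ?k) = (\<Phi> y - \<Phi> x) + ?k * (y - x)"
        using xy by (subst integral_add) (auto simp: fi \<Phi>d)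
      also have "integral {x..y} (\<lambda>s. a s - g x') = (A y - A x) - g x' * (y - x)"
        using xy by (subst integral_diff) (auto simp: ai A)
      finally have "\<bar>(A y - A x) - g x' * (y - x)\<bar> / (y - x) \<le> ((\<Phi> y - \<Phi> x) + ?k * (y - x)) / (y - x)"
        using xy by (intro divide_right_mono) auto
      moreover have "\<bar>(A y - A x) - g x' * (y - x)\<bar> / (y - x) = \<bar>(A y - A x) / (y - x) - g x'\<bar>"
      proof -
        have "(A y - A x) / (y - x) - g x' = ((A y - A x) - g x' * (y - x)) / (y - x)"
          using xy by (simp add: diff_divide_distrib)
        then show ?thesis using xy by (simp add: abs_divide)
      qed
      moreover have "((\<Phi> y - \<Phi> x) + ?k * (y - x)) / (y - x) = (\<Phi> y - \<Phi> x) / (y - x) + ?k"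
        using xy by (simp add: add_divide_distrib)
      ultimately show ?thesis unfolding f_def by linarith
    qed
    have "norm (integral {-R..R} (\<lambda>x. \<bar>(A (x + h) - A x) / h - a x\<bar>)) < e" if h: "\<bar>h\<bar> < \<delta>" "h \<noteq> 0" for h
    proof -
      \<comment> \<open>\<open>max\<close> and \<open>min\<close> make the difference nonnegative
        for both signs of \<open>h\<close>.\<close>
      define p where "p x = (\<Phi> (x + max h 0) - \<Phi> (x + min h 0)) / \<bar>h\<bar>" for x
      have pc: "p integrable_on {-R..R}"
        unfolding p_def using h by (intro integrable_continuous_real continuous_intros continuous_on_compose2[OF \<Phi>c]) auto
      have c: "(\<lambda>x. e / (8 * (R + 1))) integrable_on {-R..R}" by auto
      have "norm (integral {-R..R} (\<lambda>x. \<bar>(A (x + h) - A x) / h - a x\<bar>)) \<le> integral {-R..R} (\<lambda>x. p x + f x + e / (8 * (R + 1)))"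
      proof (rule integral_norm_bound_integral)
        have m: "(\<lambda>x. \<bar>(A (x + h) - A x) / h - a x\<bar>) \<in> borel_measurable lebesgue"
          by (intro borel_measurable_abs borel_measurable_diff borel_measurable_divide borel_measurable_shift[OF Am] a(1) Am borel_measurable_const)
        have "\<bar>(A (x + h) - A x) / h - a x\<bar> \<le> p x + f x + e / (8 * (R + 1))" if x: "x \<in> {-R..R}" for x
        proof (cases "h > 0")
          case True
          have "\<bar>(A (x + h) - A x) / (x + h - x) - a x\<bar> \<le> (\<Phi> (x + h) - \<Phi> x) / (x + h - x) + f x + e / (8 * (R + 1))"
            by (rule quot) (use True h x \<delta>(3)[of x] in \<open>auto simp: abs_le_iff\<close>)
          then show ?thesis using True by (simp add: p_def max_def min_def)
        next
          case False
          then have hn: "h < 0" using h by auto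
          have "\<bar>(A x - A (x + h)) / (x - (x + h)) - a x\<bar> \<le> (\<Phi> x - \<Phi> (x + h)) / (x - (x + h)) + f x + e / (8 * (R + 1))"
            by (rule quot) (use hn h x \<delta>(3)[of x] in \<open>auto simp: abs_le_iff\<close>)
          moreover have "(A x - A (x + h)) / (x - (x + h)) = (A (x + h) - A x) / h"
            using hn by (simp add: field_simps)
          ultimately show ?thesis using hn by (simp add: p_def max_def min_def)
        qed
        then show "\<And>x. x \<in> {-R..R} \<Longrightarrow> norm \<bar>(A (x + h) - A x) / h - a x\<bar> \<le> p x + f x + e / (8 * (R + 1))" by simp
        have lipA: "\<bar>A y - A x\<bar> \<le> M * \<bar>y - x\<bar>" for x y
        proof -
          have *: "\<bar>A y - A x\<bar> \<le> M * (y - x)" if "x \<le> y" for x y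
          proof -
            have "norm (integral {x..y} a) \<le> integral {x..y} (\<lambda>x. M)"
              by (rule integral_norm_bound_integral[OF ai]) (use a(2) in auto)
            then show ?thesis using that by (simp add: A mult.commute)
          qed
          show ?thesis using *[of x y] *[of y x] by (cases "x \<le> y") (auto simp: abs_minus_commute)
        qed
        have "\<bar>(A (x + h) - A x) / h\<bar> \<le> M" for x
          using lipA[of "x + h" x] h by (simp add: abs_divide field_simps)
        then have "\<bar>\<bar>(A (x + h) - A x) / h - a x\<bar>\<bar> \<le> 2 * M" for x
          using a(2)[of x] by (smt (verit))
        then show "(\<lambda>x. \<bar>(A (x + h) - A x) / h - a x\<bar>) integrable_on {-R..R}"
          by (rule bounded_measurable_integrable(2)[OF m]) simp
        show "(\<lambda>x. p x + f x + e / (8 * (R + 1))) integrable_on {-R..R}" by (intro integrable_add pc fi c)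
      qed
      also have "\<dots> = integral {-R..R} p + integral {-R..R} f + integral {-R..R} (\<lambda>x. e / (8 * (R + 1)))"
        by (subst integral_add[OF integrable_add[OF pc fi] c], subst integral_add[OF pc fi]) simp
      finally have 1: "norm (integral {-R..R} (\<lambda>x. \<bar>(A (x + h) - A x) / h - a x\<bar>)) \<le> \<dots>" .
      have 2: "integral {-R..R} p \<le> integral {-R-1..R+1} f"
      proof -
        have "integral {-R..R} (\<lambda>x. \<Phi> (x + max h 0) - \<Phi> (x + min h 0)) \<le> \<bar>h\<bar> * (\<Phi> (R + 1) - \<Phi> (-R - 1))"
        proof -
          have "integral {-R..R} (\<lambda>x. \<Phi> (x + max h 0) - \<Phi> (x + min h 0))
              = integral {-R + min h 0..R + min h 0} (\<lambda>x. \<Phi> (x + \<bar>h\<bar>) - \<Phi> x)"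
            using integral_shift_Icc_real[of "-R" R "\<lambda>x. \<Phi> (x + \<bar>h\<bar>) - \<Phi> x" "min h 0"]
            by (simp add: o_def max_def min_def add.commute abs_if split: if_splits)
          also have "\<dots> \<le> \<bar>h\<bar> * (\<Phi> (R + min h 0 + \<bar>h\<bar>) - \<Phi> (-R + min h 0))"
            by (rule monotone_increment_integral[OF \<Phi>c \<Phi>m]) (use R in auto)
          also have "\<dots> \<le> \<bar>h\<bar> * (\<Phi> (R + 1) - \<Phi> (-R - 1))"
            using h \<delta>(2) by (intro mult_left_mono diff_mono monoD[OF \<Phi>m]) auto
          finally show ?thesis .
        qed
        then have "integral {-R..R} (\<lambda>x. \<Phi> (x + max h 0) - \<Phi> (x + min h 0)) / \<bar>h\<bar> \<le> \<Phi> (R + 1) - \<Phi> (-R - 1)"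
          using h by (simp add: field_simps)
        then show ?thesis unfolding p_def integral_divide using R by (simp add: \<Phi>d)
      qed
      have 3: "integral {-R..R} f \<le> integral {-R-1..R+1} f"
        by (rule integral_subset_le) (use f fi in auto)
      have 4: "integral {-R..R} (\<lambda>x. e / (8 * (R + 1))) \<le> e / 4"
      proof -
        have "integral {-R..R} (\<lambda>x. e / (8 * (R + 1))) = (e / 4) * (R / (R + 1))"
          using R by (simp add: field_simps)
        also have "\<dots> \<le> (e / 4) * 1" using R e by (intro mult_left_mono) auto
        finally show ?thesis by simp
      qed
      have "integral {-R-1..R+1} f < e / 4" using g(3) by (simp add: f_def[abs_def])
      with 1 2 3 4 e show ?thesis by linarith
    qed
    then show "\<forall>\<^sub>F h in at 0. dist (integral {-R..R} (\<lambda>x. \<bar>(A (x + h) - A x) / h - a x\<bar>)) 0 < e"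
      unfolding eventually_at using \<delta>(1) by (auto simp: dist_real_def intro!: exI[of _ \<delta>])
  qed
qed

section \<open>Weak derivatives of primitives\<close>

lemma test_function_bounded:
  assumes "test_function S \<phi>"
  obtains C where "continuous_on UNIV \<phi>" "continuous_on UNIV (deriv \<phi>)" "\<And>x. \<bar>\<phi> x\<bar> \<le> C" "\<And>x. \<bar>deriv \<phi> x\<bar> \<le> C"
    "\<And>x. (\<phi> has_real_derivative deriv \<phi> x) (at x)"
proof -
  have sm: "smooth \<phi>" using assms by (simp add: test_function_def smooth_def)
  define K where "K = closure {x. \<phi> x \<noteq> 0}"
  have K: "compact K" using assms by (simp add: test_function_def K_def)
  have tK: "test_function K \<phi>" using assms by (auto simp: test_function_def K_def)
  have c: "continuous_on T \<phi>" "continuous_on T (deriv \<phi>)" for T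
    using smooth_cont[OF sm] smooth_cont[OF smooth_deriv[OF sm]] by auto
  have "bounded (\<phi> ` K)" "bounded (deriv \<phi> ` K)"
    by (intro compact_imp_bounded compact_continuous_image c K)+
  then obtain C1 C2 where C: "\<And>x. x \<in> K \<Longrightarrow> \<bar>\<phi> x\<bar> \<le> C1" "\<And>x. x \<in> K \<Longrightarrow> \<bar>deriv \<phi> x\<bar> \<le> C2"
    by (auto simp: bounded_iff)
  have "\<bar>\<phi> x\<bar> \<le> max 0 (max C1 C2)" "\<bar>deriv \<phi> x\<bar> \<le> max 0 (max C1 C2)" for x
    using C[of x] test_function_deriv_zero[OF tK, of x] by (cases "x \<in> K"; force)+
  then show thesis using that c smooth_DERIV[OF sm] by blast
qed

lemma set_integral_test_function:
  assumes \<phi>: "test_function (ball x0 r) \<phi>" and v: "set_integrable lebesgue {x0 - r..x0 + r} v"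
    and \<psi>: "\<psi> = \<phi> \<or> \<psi> = deriv \<phi>"
  shows "(LINT x:ball x0 r|lebesgue. v x * \<psi> x) = integral {x0 - r..x0 + r} (\<lambda>x. v x * \<psi> x)"
    and "(\<lambda>x. v x * \<psi> x) integrable_on {x0 - r..x0 + r}"
proof -
  obtain C where C: "continuous_on UNIV \<phi>" "continuous_on UNIV (deriv \<phi>)" "\<And>x. \<bar>\<phi> x\<bar> \<le> C" "\<And>x. \<bar>deriv \<phi> x\<bar> \<le> C"
    using test_function_bounded[OF \<phi>] by metis
  have \<psi>c: "continuous_on UNIV \<psi>" "\<And>x. \<bar>\<psi> x\<bar> \<le> C" using \<psi> C by auto
  have z: "\<psi> x = 0" if "x \<notin> ball x0 r" for x using \<psi> test_function_deriv_zero[OF \<phi> that] by auto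
  have i: "set_integrable lebesgue {x0 - r..x0 + r} (\<lambda>x. v x * \<psi> x)"
    by (rule set_integrable_mult_bounded(1)[OF v continuous_measurable_lebesgue[OF \<psi>c(1)] \<psi>c(2)])
  have "(LINT x:ball x0 r|lebesgue. v x * \<psi> x) = (LINT x:{x0 - r..x0 + r}|lebesgue. v x * \<psi> x)"
    unfolding set_lebesgue_integral_def using z
    by (intro Bochner_Integration.integral_cong) (auto simp: indicator_def dist_real_def abs_le_iff abs_less_iff)
  then show "(LINT x:ball x0 r|lebesgue. v x * \<psi> x) = integral {x0 - r..x0 + r} (\<lambda>x. v x * \<psi> x)"
    and "(\<lambda>x. v x * \<psi> x) integrable_on {x0 - r..x0 + r}"
    using set_lebesgue_integral_eq_integral[OF i] by auto
qed

lemma C1_by_parts: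
  fixes F g \<phi> :: "real \<Rightarrow> real"
  assumes \<phi>: "test_function (ball x0 r) \<phi>" and r: "0 \<le> r"
    and F: "\<And>x. x \<in> {x0 - r..x0 + r} \<Longrightarrow> (F has_real_derivative g x) (at x within {x0 - r..x0 + r})"
  shows "((\<lambda>x. F x * deriv \<phi> x + g x * \<phi> x) has_integral 0) {x0 - r..x0 + r}"
proof -
  obtain C where "\<And>x. (\<phi> has_real_derivative deriv \<phi> x) (at x)"
    using test_function_bounded[OF \<phi>] by metis
  note D = this[THEN has_field_derivative_at_within]
  have "((\<lambda>x. F x * deriv \<phi> x + g x * \<phi> x) has_integral F (x0 + r) * \<phi> (x0 + r) - F (x0 - r) * \<phi> (x0 - r)) {x0 - r..x0 + r}"
  proof (rule fundamental_theorem_of_calculus)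
    fix x assume "x \<in> {x0 - r..x0 + r}"
    then show "((\<lambda>x. F x * \<phi> x) has_vector_derivative F x * deriv \<phi> x + g x * \<phi> x) (at x within {x0 - r..x0 + r})"
      unfolding has_real_derivative_iff_has_vector_derivative[symmetric]
      using DERIV_mult[OF F D, of x] by (simp add: algebra_simps)
  qed (use r in auto)
  moreover have "\<phi> (x0 + r) = 0" "\<phi> (x0 - r) = 0"
    using r by (auto intro!: test_function_deriv_zero(1)[OF \<phi>] simp: dist_real_def)
  ultimately show ?thesis by simp
qed

lemma weak_deriv_C1:
  assumes F: "\<And>x. (F has_real_derivative g x) (at x)" and g: "continuous_on UNIV g"
  shows "weak_deriv_on (ball x0 r) F g"
  unfolding weak_deriv_on_def
proof (intro allI impI)
  fix \<phi> assume \<phi>: "test_function (ball x0 r) \<phi>"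
  have Fc: "continuous_on UNIV F" using F by (meson DERIV_isCont continuous_at_imp_continuous_on)
  have i: "set_integrable lebesgue {x0 - r..x0 + r} F" "set_integrable lebesgue {x0 - r..x0 + r} g"
    by (intro absolutely_integrable_continuous_real continuous_on_subset[OF Fc] continuous_on_subset[OF g]; simp)+
  note e1 = set_integral_test_function[OF \<phi> i(1), of "deriv \<phi>", simplified]
    and e2 = set_integral_test_function[OF \<phi> i(2), of "\<phi>", simplified]
  show "(LINT x:ball x0 r|lebesgue. F x * deriv \<phi> x) = - (LINT x:ball x0 r|lebesgue. g x * \<phi> x)"
  proof (cases "0 \<le> r")
    case True
    have "((\<lambda>x. F x * deriv \<phi> x + g x * \<phi> x) has_integral 0) {x0 - r..x0 + r}"
      by (rule C1_by_parts[OF \<phi> True]) (use F has_field_derivative_at_within in blast)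
    then have "integral {x0 - r..x0 + r} (\<lambda>x. F x * deriv \<phi> x) + integral {x0 - r..x0 + r} (\<lambda>x. g x * \<phi> x) = 0"
      by (subst integral_add[OF e1(2) e2(2), symmetric]) (simp add: has_integral_iff)
    then show ?thesis unfolding e1(1) e2(1) by linarith
  qed (simp add: e1 e2)
qed

text \<open>Integration by parts holds for the primitive \<open>G\<close> of a continuous L1
  approximation of \<open>a\<close>, and \<open>A - G\<close> is uniformly as small as the L1
  error.\<close>

lemma weak_deriv_primitive:
  fixes a A :: "real \<Rightarrow> real"
  assumes a: "a \<in> borel_measurable lebesgue" "\<And>x. \<bar>a x\<bar> \<le> M"
    and A: "\<And>x y. x \<le> y \<Longrightarrow> A y - A x = integral {x..y} a" and Ac: "continuous_on UNIV A"
  shows "weak_deriv_on (ball x0 r) A a"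
  unfolding weak_deriv_on_def
proof (intro allI impI)
  fix \<phi> assume \<phi>: "test_function (ball x0 r) \<phi>"
  define c where "c = x0 - r"
  define d where "d = x0 + r"
  have i: "set_integrable lebesgue {c..d} A" "set_integrable lebesgue {c..d} a"
    using bounded_measurable_integrable(1)[OF a] absolutely_integrable_continuous_real[OF continuous_on_subset[OF Ac]] by auto
  note e1 = set_integral_test_function[OF \<phi> i(1)[unfolded c_def d_def], of "deriv \<phi>", simplified, folded c_def d_def]
    and e2 = set_integral_test_function[OF \<phi> i(2)[unfolded c_def d_def], of "\<phi>", simplified, folded c_def d_def]
  show "(LINT x:ball x0 r|lebesgue. A x * deriv \<phi> x) = - (LINT x:ball x0 r|lebesgue. a x * \<phi> x)"
  proof (cases "0 \<le> r")
    case False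
    then show ?thesis by (simp add: e1 e2 c_def d_def)
  next
    case r: True
    obtain C where C: "continuous_on UNIV \<phi>" "continuous_on UNIV (deriv \<phi>)" "\<And>x. \<bar>\<phi> x\<bar> \<le> C" "\<And>x. \<bar>deriv \<phi> x\<bar> \<le> C"
      using test_function_bounded[OF \<phi>] by metis
    have C0: "0 \<le> C" using C(3)[of 0] by linarith
    define I where "I = integral {c..d} (\<lambda>x. A x * deriv \<phi> x) + integral {c..d} (\<lambda>x. a x * \<phi> x)"
    have "\<bar>I\<bar> \<le> 0 + e" if e: "e > 0" for e
    proof -
      \<comment> \<open>\<open>C * (d - c)\<close> accounts for the uniform error of
        \<open>A\<close> against \<open>deriv \<phi>\<close>, and \<open>C\<close> for the L1 error
        of \<open>a\<close> against \<phi>; the 1 makes \<open>k\<close> positive.\<close>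
      define k where "k = C * (d - c) + C + 1"
      have k: "k > 0" using C0 r by (auto simp: k_def c_def d_def intro: add_nonneg_pos)
      obtain g where g: "continuous_on UNIV g" "\<And>x. \<bar>g x\<bar> \<le> M" "integral {c..d} (\<lambda>x. \<bar>a x - g x\<bar>) < e / k"
        using L1_approximation[OF a, of "e / k" c d] e k by auto
      have gi: "g integrable_on {u..v}" for u v
        by (rule integrable_continuous_real[OF continuous_on_subset[OF g(1)]]) auto
      have ai: "a integrable_on {u..v}" for u v by (rule bounded_measurable_integrable(2)[OF a]) simp
      have agm: "(\<lambda>x. \<bar>a x - g x\<bar>) \<in> borel_measurable lebesgue"
        by (intro borel_measurable_abs borel_measurable_diff a(1) continuous_measurable_lebesgue[OF g(1)])
      have agb: "\<bar>\<bar>a x - g x\<bar>\<bar> \<le> 2 * M" for x using a(2)[of x] g(2)[of x] by auto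
      have agi: "(\<lambda>x. \<bar>a x - g x\<bar>) integrable_on {u..v}" for u v
        by (rule bounded_measurable_integrable(2)[OF agm agb]) simp
      define G where "G x = A c + integral {c..x} g" for x
      have GD: "(G has_real_derivative g x) (at x within {c..d})" if "x \<in> {c..d}" for x
        unfolding G_def using integral_has_real_derivative[OF continuous_on_subset[OF g(1)] that]
        by (auto intro!: derivative_eq_intros)
      have Gc: "continuous_on {c..d} G"
        using GD by (meson DERIV_continuous continuous_on_eq_continuous_within)
      have AG: "\<bar>A x - G x\<bar> \<le> e / k" if x: "x \<in> {c..d}" for x
      proof -
        have "A x - G x = integral {c..x} (\<lambda>s. a s - g s)"
          using A[of c x] x by (simp add: G_def integral_diff[OF ai gi])
        moreover have "norm (integral {c..x} (\<lambda>s. a s - g s)) \<le> integral {c..x} (\<lambda>s. \<bar>a s - g s\<bar>)"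
          by (rule integral_norm_bound_integral) (use ai gi agi in \<open>auto intro: integrable_diff\<close>)
        moreover have "integral {c..x} (\<lambda>s. \<bar>a s - g s\<bar>) \<le> integral {c..d} (\<lambda>s. \<bar>a s - g s\<bar>)"
          by (rule integral_subset_le) (use x agi in auto)
        ultimately show ?thesis using g(3) by simp
      qed
      have z: "((\<lambda>x. G x * deriv \<phi> x + g x * \<phi> x) has_integral 0) {c..d}"
        unfolding c_def d_def by (rule C1_by_parts[OF \<phi> r]) (use GD in \<open>simp add: c_def d_def\<close>)
      have s: "((\<lambda>x. A x * deriv \<phi> x + a x * \<phi> x) has_integral I) {c..d}"
        unfolding I_def by (intro has_integral_add integrable_integral e1(2) e2(2))
      have "((\<lambda>x. (A x * deriv \<phi> x + a x * \<phi> x) - (G x * deriv \<phi> x + g x * \<phi> x)) has_integral I - 0) {c..d}"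
        by (rule has_integral_diff[OF s z])
      then have I: "integral {c..d} (\<lambda>x. (A x - G x) * deriv \<phi> x + (a x - g x) * \<phi> x) = I"
        and Ii: "(\<lambda>x. (A x - G x) * deriv \<phi> x + (a x - g x) * \<phi> x) integrable_on {c..d}"
        by (simp_all add: has_integral_iff algebra_simps)
      have ci: "(\<lambda>x. e / k * C) integrable_on {c..d}" "(\<lambda>x. \<bar>a x - g x\<bar> * C) integrable_on {c..d}"
        using agi by (auto intro: integrable_on_mult_left)
      have "norm (integral {c..d} (\<lambda>x. (A x - G x) * deriv \<phi> x + (a x - g x) * \<phi> x)) \<le> integral {c..d} (\<lambda>x. e / k * C + \<bar>a x - g x\<bar> * C)"
      proof (rule integral_norm_bound_integral[OF Ii integrable_add[OF ci]])
        fix x assume x: "x \<in> {c..d}"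
        have "\<bar>(A x - G x) * deriv \<phi> x + (a x - g x) * \<phi> x\<bar> \<le> \<bar>A x - G x\<bar> * \<bar>deriv \<phi> x\<bar> + \<bar>a x - g x\<bar> * \<bar>\<phi> x\<bar>"
          by (metis abs_mult abs_triangle_ineq)
        also have "\<dots> \<le> e / k * C + \<bar>a x - g x\<bar> * C"
          using AG[OF x] C k e by (intro add_mono mult_mono) auto
        finally show "norm ((A x - G x) * deriv \<phi> x + (a x - g x) * \<phi> x) \<le> e / k * C + \<bar>a x - g x\<bar> * C" by simp
      qed
      also have "\<dots> = e / k * C * (d - c) + integral {c..d} (\<lambda>x. \<bar>a x - g x\<bar>) * C"
        using r by (subst integral_add[OF ci]) (simp add: c_def d_def)
      also have "\<dots> \<le> e / k * C * (d - c) + e / k * C"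
        using g(3) C0 by (intro add_left_mono mult_right_mono) auto
      also have "\<dots> = e / k * (C * (d - c) + C)" by (simp only: distrib_left mult.assoc)
      also have "\<dots> \<le> e / k * k" using e k by (intro mult_left_mono) (auto simp: k_def)
      also have "\<dots> = e" using k by simp
      finally show ?thesis unfolding I by simp
    qed
    then have "\<bar>I\<bar> \<le> 0" by (rule field_le_epsilon)
    then show ?thesis unfolding e1(1) e2(1) I_def by linarith
  qed
qed

text \<open>For bounded functions \<open>(f x)^2 \<le> C * \<bar>f x\<bar>\<close>, so that
  convergence in L1 implies convergence in L2. It is through this estimate that bounded derivatives
  of the data yield the regularity of the free waves.\<close>

lemma L2_sq_le_L1:
  assumes f: "f \<in> borel_measurable lebesgue" "\<And>x. \<bar>f x\<bar> \<le> C" and S: "S \<subseteq> {-R..R}"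
  shows "L2_sq S f \<le> ennreal (C * integral {-R..R} (\<lambda>x. \<bar>f x\<bar>))"
proof -
  have C: "0 \<le> C" using f(2)[of 0] by linarith
  have m: "(\<lambda>x. \<bar>f x\<bar>) \<in> borel_measurable lebesgue" and b: "\<And>x. \<bar>\<bar>f x\<bar>\<bar> \<le> C" using f by auto
  note i = bounded_measurable_integrable[OF m b, of "{-R..R}", simplified]
  have i': "set_integrable lebesgue {-R..R} (\<lambda>x. C * \<bar>f x\<bar>)" using i(1) by simp
  have "L2_sq S f \<le> (\<integral>\<^sup>+x. ennreal (indicator {-R..R} x *\<^sub>R (C * \<bar>f x\<bar>)) \<partial>lebesgue)"
    unfolding L2_sq_def
  proof (rule nn_integral_mono)
    fix x
    have "(f x)\<^sup>2 \<le> C * \<bar>f x\<bar>"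
      using mult_right_mono[OF f(2)[of x], of "\<bar>f x\<bar>"] by (simp add: power2_eq_square)
    then show "ennreal ((f x)\<^sup>2) * indicator S x \<le> ennreal (indicator {-R..R} x *\<^sub>R (C * \<bar>f x\<bar>))"
      using S by (auto simp: indicator_def intro!: ennreal_leI)
  qed
  also have "\<dots> = ennreal (LINT x:{-R..R}|lebesgue. C * \<bar>f x\<bar>)"
    unfolding set_lebesgue_integral_def
    by (rule nn_integral_eq_integral) (use i' C in \<open>auto simp: set_integrable_def\<close>)
  also have "(LINT x:{-R..R}|lebesgue. C * \<bar>f x\<bar>) = C * integral {-R..R} (\<lambda>x. \<bar>f x\<bar>)"
    using i(3) by simp
  finally show ?thesis .
qed

lemma L2_sq_le_sup:
  assumes "\<And>x. x \<in> S \<Longrightarrow> \<bar>f x\<bar> \<le> e" "0 \<le> e" "0 \<le> R" and S: "S \<subseteq> {-R..R}"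
  shows "L2_sq S f \<le> ennreal (e\<^sup>2 * (2 * R))"
proof -
  have "L2_sq S f \<le> (\<integral>\<^sup>+x. ennreal (e\<^sup>2) * indicator {-R..R} x \<partial>lebesgue)"
    unfolding L2_sq_def
    by (rule nn_integral_mono) (use S assms in \<open>auto simp: indicator_def intro!: ennreal_leI power2_le_iff_abs_le[THEN iffD2]\<close>)
  also have "\<dots> = ennreal (e\<^sup>2) * ennreal (2 * R)"
    using assms by (subst nn_integral_cmult_indicator) auto
  also have "\<dots> = ennreal (e\<^sup>2 * (2 * R))" using assms by (simp add: ennreal_mult)
  finally show ?thesis .
qed

lemma ball_subset_Icc: "r \<le> t0 \<Longrightarrow> ball (x0::real) r \<subseteq> {-(\<bar>x0\<bar> + t0)..\<bar>x0\<bar> + t0}"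
  by (auto simp: dist_real_def)

lemma L2_onI:
  assumes "f \<in> borel_measurable lebesgue" "S \<in> sets lebesgue" "L2_sq S f < \<infinity>"
  shows "L2_on S f"
  using assms unfolding L2_on_def set_borel_measurable_def
  by (auto intro!: borel_measurable_scaleR borel_measurable_indicator)

lemma time_shift_filterlim:
  assumes "c \<noteq> 0" shows "filterlim (\<lambda>\<tau>. c * (\<tau> - t)) (at 0) (at (t::real) within S)"
proof -
  have "((\<lambda>\<tau>. c * (\<tau> - t)) \<longlongrightarrow> c * (t - t)) (at t within S)" by (intro tendsto_intros)
  then show ?thesis
    using assms by (auto simp: filterlim_at eventually_at_filter)
qed

lemma C_L2_translation:
  fixes a :: "real \<Rightarrow> real"
  assumes a: "a \<in> borel_measurable lebesgue" "\<And>x. \<bar>a x\<bar> \<le> M" and c: "c \<noteq> 0"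
  shows "C_L2 x0 t0 (\<lambda>x t. a (x + c * t))"
  unfolding C_L2_def
proof (intro conjI ballI)
  fix t assume t: "t \<in> {0..<t0}"
  have "L2_sq (ball x0 (t0 - t)) (\<lambda>x. a (x + c * t)) \<le> ennreal (M * integral {-(\<bar>x0\<bar> + t0)..\<bar>x0\<bar> + t0} (\<lambda>x. \<bar>a (x + c * t)\<bar>))"
    by (rule L2_sq_le_L1[OF borel_measurable_shift[OF a(1)] a(2) ball_subset_Icc]) (use t in auto)
  also have "\<dots> < \<infinity>" by simp
  finally show "L2_on (ball x0 (t0 - t)) (\<lambda>x. a (x + c * t))"
    by (intro L2_onI borel_measurable_shift[OF a(1)]) auto
next
  fix s t assume s: "s \<in> {0..<t0}" and t: "t \<in> {0..s}"
  \<comment> \<open>Absorbing the fixed time into \<open>b\<close> reduces continuity at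
    \<open>t\<close> to continuity of translations at shift 0.\<close>
  define b where "b x = a (x + c * t)" for x
  have b: "b \<in> borel_measurable lebesgue" "\<And>x. \<bar>b x\<bar> \<le> M"
    using borel_measurable_shift[OF a(1), of "c * t"] a(2) by (auto simp: b_def[abs_def])
  define R where "R = \<bar>x0\<bar> + t0"
  have "((\<lambda>\<tau>. integral {-R..R} (\<lambda>x. \<bar>b (x + c * (\<tau> - t)) - b x\<bar>)) \<longlongrightarrow> 0) (at t within {0..s})"
    by (rule filterlim_compose[OF L1_translation_continuous[OF b] time_shift_filterlim[OF c]])
  from tendsto_mult_left[OF this, of "2 * M"]
  have "((\<lambda>\<tau>. ennreal (2 * M * integral {-R..R} (\<lambda>x. \<bar>b (x + c * (\<tau> - t)) - b x\<bar>))) \<longlongrightarrow> ennreal 0) (at t within {0..s})"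
    by (intro tendsto_ennrealI) simp
  then have lim: "((\<lambda>\<tau>. ennreal (2 * M * integral {-R..R} (\<lambda>x. \<bar>b (x + c * (\<tau> - t)) - b x\<bar>))) \<longlongrightarrow> 0) (at t within {0..s})" by simp
  have le: "L2_sq (ball x0 (t0 - s)) (\<lambda>x. a (x + c * \<tau>) - a (x + c * t)) \<le> ennreal (2 * M * integral {-R..R} (\<lambda>x. \<bar>b (x + c * (\<tau> - t)) - b x\<bar>))" for \<tau>
  proof -
    have eq: "(\<lambda>x. a (x + c * \<tau>) - a (x + c * t)) = (\<lambda>x. b (x + c * (\<tau> - t)) - b x)"
      by (auto simp: b_def algebra_simps)
    show ?thesis
      unfolding eq
    proof (rule L2_sq_le_L1)
      show "(\<lambda>x. b (x + c * (\<tau> - t)) - b x) \<in> borel_measurable lebesgue"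
        by (intro borel_measurable_diff borel_measurable_shift[OF b(1)] b(1))
      show "\<bar>b (x + c * (\<tau> - t)) - b x\<bar> \<le> 2 * M" for x using b(2)[of x] b(2)[of "x + c * (\<tau> - t)"] by linarith
      show "ball x0 (t0 - s) \<subseteq> {-R..R}" unfolding R_def by (rule ball_subset_Icc) (use s in auto)
    qed
  qed
  show "((\<lambda>\<tau>. L2_sq (ball x0 (t0 - s)) (\<lambda>x. a (x + c * \<tau>) - a (x + c * t))) \<longlongrightarrow> 0) (at t within {0..s})"
    by (rule tendsto_sandwich[OF _ _ tendsto_const lim]) (use le in auto)
qed

lemma L2_time_deriv_translation:
  fixes a A :: "real \<Rightarrow> real"
  assumes a: "a \<in> borel_measurable lebesgue" "\<And>x. \<bar>a x\<bar> \<le> M"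
    and A: "\<And>x y. x \<le> y \<Longrightarrow> A y - A x = integral {x..y} a" and Ac: "continuous_on UNIV A" and c: "c \<noteq> 0"
  shows "L2_time_deriv x0 t0 (\<lambda>x t. A (x + c * t)) (\<lambda>x t. c * a (x + c * t))"
  unfolding L2_time_deriv_def
proof (intro ballI)
  fix s t assume s: "s \<in> {0..<t0}" and t: "t \<in> {0..s}"
  define b where "b x = a (x + c * t)" for x
  define B where "B x = A (x + c * t)" for x
  have b: "b \<in> borel_measurable lebesgue" "\<And>x. \<bar>b x\<bar> \<le> M"
    using borel_measurable_shift[OF a(1), of "c * t"] a(2) by (auto simp: b_def[abs_def])
  have Bc: "continuous_on UNIV B" unfolding B_def by (intro continuous_on_compose2[OF Ac] continuous_intros) auto
  have B: "B y - B x = integral {x..y} b" if "x \<le> y" for x y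
    using A[of "x + c * t" "y + c * t"] that integral_shift_Icc_real[of x y a "c * t"]
    by (simp add: B_def b_def[abs_def] o_def add.commute)
  define R where "R = \<bar>x0\<bar> + t0"
  define q where "q h x = (B (x + h) - B x) / h - b x" for h x
  have "((\<lambda>\<tau>. integral {-R..R} (\<lambda>x. \<bar>q (c * (\<tau> - t)) x\<bar>)) \<longlongrightarrow> 0) (at t within {0..s})"
    unfolding q_def by (rule filterlim_compose[OF L1_difference_quotient[OF b B Bc] time_shift_filterlim[OF c]])
  from tendsto_mult_left[OF this, of "\<bar>c\<bar> * (2 * M) * \<bar>c\<bar>"]
  have "((\<lambda>\<tau>. ennreal (\<bar>c\<bar> * (2 * M) * \<bar>c\<bar> * integral {-R..R} (\<lambda>x. \<bar>q (c * (\<tau> - t)) x\<bar>))) \<longlongrightarrow> ennreal 0) (at t within {0..s})"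
    by (intro tendsto_ennrealI) simp
  then have lim: "((\<lambda>\<tau>. ennreal (\<bar>c\<bar> * (2 * M) * \<bar>c\<bar> * integral {-R..R} (\<lambda>x. \<bar>q (c * (\<tau> - t)) x\<bar>))) \<longlongrightarrow> 0) (at t within {0..s})" by simp
  have le: "L2_sq (ball x0 (t0 - s)) (\<lambda>x. (A (x + c * \<tau>) - A (x + c * t)) / (\<tau> - t) - c * a (x + c * t))
      \<le> ennreal (\<bar>c\<bar> * (2 * M) * \<bar>c\<bar> * integral {-R..R} (\<lambda>x. \<bar>q (c * (\<tau> - t)) x\<bar>))" if \<tau>: "\<tau> \<noteq> t" for \<tau>
  proof -
    define h where "h = c * (\<tau> - t)"
    have h: "h \<noteq> 0" using c \<tau> by (simp add: h_def)
    have e1: "A (x + c * \<tau>) = B (x + h)" for x by (simp add: B_def h_def algebra_simps)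
    \<comment> \<open>The time quotient is \<open>c\<close> times the space quotient with increment
      \<open>h\<close>, and the same holds for the limits.\<close>
    have eq: "(\<lambda>x. (A (x + c * \<tau>) - A (x + c * t)) / (\<tau> - t) - c * a (x + c * t)) = (\<lambda>x. c * q h x)"
      unfolding e1 using c \<tau> by (auto simp: q_def b_def B_def[symmetric] h_def field_simps)
    have lip: "\<bar>B y - B x\<bar> \<le> M * \<bar>y - x\<bar>" for x y
    proof -
      have bi: "b integrable_on {x..y}" for x y by (rule bounded_measurable_integrable(2)[OF b]) simp
      have *: "\<bar>B y - B x\<bar> \<le> M * (y - x)" if "x \<le> y" for x y
      proof -
        have "norm (integral {x..y} b) \<le> integral {x..y} (\<lambda>x. M)"
          by (rule integral_norm_bound_integral[OF bi]) (use b(2) in auto)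
        then show ?thesis using that by (simp add: B mult.commute)
      qed
      show ?thesis using *[of x y] *[of y x] by (cases "x \<le> y") (auto simp: abs_minus_commute)
    qed
    have "L2_sq (ball x0 (t0 - s)) (\<lambda>x. c * q h x) \<le> ennreal (\<bar>c\<bar> * (2 * M) * integral {-R..R} (\<lambda>x. \<bar>c * q h x\<bar>))"
    proof (rule L2_sq_le_L1)
      have Bm: "B \<in> borel_measurable lebesgue" by (rule continuous_measurable_lebesgue[OF Bc])
      show "(\<lambda>x. c * q h x) \<in> borel_measurable lebesgue"
        unfolding q_def by (intro borel_measurable_times borel_measurable_const borel_measurable_diff borel_measurable_divide borel_measurable_shift[OF Bm] Bm b(1))
      show "\<bar>c * q h x\<bar> \<le> \<bar>c\<bar> * (2 * M)" for x
      proof -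
        have "\<bar>(B (x + h) - B x) / h\<bar> \<le> M" using lip[of "x + h" x] h by (simp add: abs_divide field_simps)
        then have "\<bar>q h x\<bar> \<le> 2 * M" using b(2)[of x] unfolding q_def by linarith
        then show ?thesis unfolding abs_mult by (intro mult_left_mono) auto
      qed
      show "ball x0 (t0 - s) \<subseteq> {-R..R}" unfolding R_def by (rule ball_subset_Icc) (use s in auto)
    qed
    also have "integral {-R..R} (\<lambda>x. \<bar>c * q h x\<bar>) = \<bar>c\<bar> * integral {-R..R} (\<lambda>x. \<bar>q h x\<bar>)"
      by (simp add: abs_mult)
    finally show ?thesis unfolding eq h_def by (simp add: mult.assoc)
  qed
  then have ev: "\<forall>\<^sub>F \<tau> in at t within {0..s}. L2_sq (ball x0 (t0 - s)) (\<lambda>x. (A (x + c * \<tau>) - A (x + c * t)) / (\<tau> - t) - c * a (x + c * t))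
      \<le> ennreal (\<bar>c\<bar> * (2 * M) * \<bar>c\<bar> * integral {-R..R} (\<lambda>x. \<bar>q (c * (\<tau> - t)) x\<bar>))"
    by (simp add: eventually_at_filter)
  show "((\<lambda>\<tau>. L2_sq (ball x0 (t0 - s)) (\<lambda>x. (A (x + c * \<tau>) - A (x + c * t)) / (\<tau> - t) - c * a (x + c * t))) \<longlongrightarrow> 0) (at t within {0..s})"
    by (rule tendsto_sandwich[OF _ ev tendsto_const lim]) auto
qed

lemma C_L2_add:
  assumes f: "C_L2 x0 t0 f" and g: "C_L2 x0 t0 g"
  shows "C_L2 x0 t0 (\<lambda>x t. f x t + g x t)"
  unfolding C_L2_def
proof (intro conjI ballI)
  fix t assume t: "t \<in> {0..<t0}"
  have m: "L2_on (ball x0 (t0 - t)) (\<lambda>x. f x t)" "L2_on (ball x0 (t0 - t)) (\<lambda>x. g x t)"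
    using f g t by (auto simp: C_L2_def)
  have "L2_sq (ball x0 (t0 - t)) (\<lambda>x. f x t + g x t) \<le> 2 * L2_sq (ball x0 (t0 - t)) (\<lambda>x. f x t) + 2 * L2_sq (ball x0 (t0 - t)) (\<lambda>x. g x t)"
    by (rule L2_sq_add_le) (use m in \<open>auto simp: L2_on_def\<close>)
  also have "\<dots> < \<infinity>" using m by (auto simp: L2_on_def ennreal_mult_less_top)
  finally show "L2_on (ball x0 (t0 - t)) (\<lambda>x. f x t + g x t)"
    using m unfolding L2_on_def set_borel_measurable_def scaleR_add_right by (auto intro: borel_measurable_add)
next
  fix s t assume s: "s \<in> {0..<t0}" and t: "t \<in> {0..s}"
  let ?B = "ball x0 (t0 - s)"
  have m: "set_borel_measurable lebesgue ?B (\<lambda>x. h x \<tau> - h x t)" if "C_L2 x0 t0 h" "\<tau> \<in> {0..s}" for h \<tau>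
  proof -
    have "L2_on ?B (\<lambda>x. h x \<tau>)" "L2_on ?B (\<lambda>x. h x t)"
      using that s t by (auto intro!: C_L2_measurable)
    then show ?thesis
      unfolding L2_on_def set_borel_measurable_def scaleR_right_diff_distrib by (auto intro: borel_measurable_diff)
  qed
  have "((\<lambda>\<tau>. 2 * L2_sq ?B (\<lambda>x. f x \<tau> - f x t) + 2 * L2_sq ?B (\<lambda>x. g x \<tau> - g x t)) \<longlongrightarrow> 2 * 0 + 2 * 0) (at t within {0..s})"
    using f g s t by (intro tendsto_add ennreal_tendsto_cmult) (auto simp: C_L2_def)
  then have lim: "((\<lambda>\<tau>. 2 * L2_sq ?B (\<lambda>x. f x \<tau> - f x t) + 2 * L2_sq ?B (\<lambda>x. g x \<tau> - g x t)) \<longlongrightarrow> 0) (at t within {0..s})" by simp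
  have "L2_sq ?B (\<lambda>x. f x \<tau> + g x \<tau> - (f x t + g x t)) \<le> 2 * L2_sq ?B (\<lambda>x. f x \<tau> - f x t) + 2 * L2_sq ?B (\<lambda>x. g x \<tau> - g x t)"
    if "\<tau> \<in> {0..s}" for \<tau>
    using L2_sq_add_le[OF m[OF f that] m[OF g that]] by (simp add: algebra_simps)
  then have ev: "\<forall>\<^sub>F \<tau> in at t within {0..s}. L2_sq ?B (\<lambda>x. f x \<tau> + g x \<tau> - (f x t + g x t)) \<le> 2 * L2_sq ?B (\<lambda>x. f x \<tau> - f x t) + 2 * L2_sq ?B (\<lambda>x. g x \<tau> - g x t)"
    by (auto simp: eventually_at_filter)
  show "((\<lambda>\<tau>. L2_sq ?B (\<lambda>x. f x \<tau> + g x \<tau> - (f x t + g x t))) \<longlongrightarrow> 0) (at t within {0..s})"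
    by (rule tendsto_sandwich[OF _ ev tendsto_const lim]) auto
qed

lemma L2_time_deriv_add:
  assumes f: "C_L2 x0 t0 f" "C_L2 x0 t0 ft" "L2_time_deriv x0 t0 f ft"
    and g: "C_L2 x0 t0 g" "C_L2 x0 t0 gt" "L2_time_deriv x0 t0 g gt"
  shows "L2_time_deriv x0 t0 (\<lambda>x t. f x t + g x t) (\<lambda>x t. ft x t + gt x t)"
  unfolding L2_time_deriv_def
proof (intro ballI)
  fix s t assume s: "s \<in> {0..<t0}" and t: "t \<in> {0..s}"
  let ?B = "ball x0 (t0 - s)"
  have m: "set_borel_measurable lebesgue ?B (\<lambda>x. (h x \<tau> - h x t) / (\<tau> - t) - ht x t)"
    if "C_L2 x0 t0 h" "C_L2 x0 t0 ht" "\<tau> \<in> {0..s}" for h ht \<tau>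
  proof -
    have "L2_on ?B (\<lambda>x. h x \<tau>)" "L2_on ?B (\<lambda>x. h x t)" "L2_on ?B (\<lambda>x. ht x t)"
      using that s t by (auto intro!: C_L2_measurable)
    then have "(\<lambda>x. (1 / (\<tau> - t)) * (indicator ?B x *\<^sub>R h x \<tau> - indicator ?B x *\<^sub>R h x t) - indicator ?B x *\<^sub>R ht x t) \<in> borel_measurable lebesgue"
      unfolding L2_on_def set_borel_measurable_def
      by (intro borel_measurable_diff borel_measurable_times borel_measurable_const) auto
    moreover have "(\<lambda>x. (1 / (\<tau> - t)) * (indicator ?B x *\<^sub>R h x \<tau> - indicator ?B x *\<^sub>R h x t) - indicator ?B x *\<^sub>R ht x t)
        = (\<lambda>x. indicator ?B x *\<^sub>R ((h x \<tau> - h x t) / (\<tau> - t) - ht x t))"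
      by (auto simp: indicator_def)
    ultimately show ?thesis unfolding set_borel_measurable_def by argo
  qed
  let ?qf = "\<lambda>\<tau> x. (f x \<tau> - f x t) / (\<tau> - t) - ft x t" and ?qg = "\<lambda>\<tau> x. (g x \<tau> - g x t) / (\<tau> - t) - gt x t"
  let ?q = "\<lambda>\<tau> x. (f x \<tau> + g x \<tau> - (f x t + g x t)) / (\<tau> - t) - (ft x t + gt x t)"
  have "((\<lambda>\<tau>. 2 * L2_sq ?B (?qf \<tau>) + 2 * L2_sq ?B (?qg \<tau>)) \<longlongrightarrow> 2 * 0 + 2 * 0) (at t within {0..s})"
    using f g s t by (intro tendsto_add ennreal_tendsto_cmult) (auto simp: L2_time_deriv_def)
  then have lim: "((\<lambda>\<tau>. 2 * L2_sq ?B (?qf \<tau>) + 2 * L2_sq ?B (?qg \<tau>)) \<longlongrightarrow> 0) (at t within {0..s})" by simp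
  have "L2_sq ?B (?q \<tau>) \<le> 2 * L2_sq ?B (?qf \<tau>) + 2 * L2_sq ?B (?qg \<tau>)" if "\<tau> \<in> {0..s}" for \<tau>
  proof -
    have "?q \<tau> = (\<lambda>x. ?qf \<tau> x + ?qg \<tau> x)" by (auto simp: add_divide_distrib diff_divide_distrib)
    then show ?thesis using L2_sq_add_le[OF m[OF f(1,2) that] m[OF g(1,2) that]] by simp
  qed
  then have ev: "\<forall>\<^sub>F \<tau> in at t within {0..s}. L2_sq ?B (?q \<tau>) \<le> 2 * L2_sq ?B (?qf \<tau>) + 2 * L2_sq ?B (?qg \<tau>)"
    by (auto simp: eventually_at_filter)
  show "((\<lambda>\<tau>. L2_sq ?B (?q \<tau>)) \<longlongrightarrow> 0) (at t within {0..s})"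
    by (rule tendsto_sandwich[OF _ ev tendsto_const lim]) auto
qed

lemma weak_deriv_on_add:
  assumes S: "S \<in> lmeasurable" and L: "L2_on S f" "L2_on S g" "L2_on S f'" "L2_on S g'"
    and f: "weak_deriv_on S f f'" and g: "weak_deriv_on S g g'"
  shows "weak_deriv_on S (\<lambda>x. f x + g x) (\<lambda>x. f' x + g' x)"
  unfolding weak_deriv_on_def
proof (intro allI impI)
  fix \<phi> assume \<phi>: "test_function S \<phi>"
  obtain C where C: "continuous_on UNIV \<phi>" "continuous_on UNIV (deriv \<phi>)" "\<And>x. \<bar>\<phi> x\<bar> \<le> C" "\<And>x. \<bar>deriv \<phi> x\<bar> \<le> C"
    using test_function_bounded[OF \<phi>] by metis
  have i: "set_integrable lebesgue S (\<lambda>x. h x * \<phi> x)" "set_integrable lebesgue S (\<lambda>x. h x * deriv \<phi> x)" if "L2_on S h" for h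
    using set_integrable_mult_bounded(1)[OF L2_on_integrable(1)[OF that S] continuous_measurable_lebesgue[OF C(1)] C(3)]
      set_integrable_mult_bounded(1)[OF L2_on_integrable(1)[OF that S] continuous_measurable_lebesgue[OF C(2)] C(4)] by auto
  show "(LINT x:S|lebesgue. (f x + g x) * deriv \<phi> x) = - (LINT x:S|lebesgue. (f' x + g' x) * \<phi> x)"
    unfolding distrib_right
    using f g \<phi> set_integral_add(2)[OF i(2)[OF L(1)] i(2)[OF L(2)]] set_integral_add(2)[OF i(1)[OF L(3)] i(1)[OF L(4)]]
    by (simp add: weak_deriv_on_def)
qed

text \<open>The regularity part of \<open>solution_on_cone\<close> with the derivatives as explicit
  arguments, so that sums can be formed.\<close>

definition regular_on_cone where
  "regular_on_cone x0 t0 f fx ft \<longleftrightarrow> C_L2 x0 t0 f \<and> C_L2 x0 t0 fx \<and> C_L2 x0 t0 ft \<and>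
     (\<forall>t\<in>{0..<t0}. weak_deriv_on (ball x0 (t0 - t)) (\<lambda>x. f x t) (\<lambda>x. fx x t)) \<and> L2_time_deriv x0 t0 f ft"

lemma regular_add:
  assumes "regular_on_cone x0 t0 f fx ft" "regular_on_cone x0 t0 g gx gt"
  shows "regular_on_cone x0 t0 (\<lambda>x t. f x t + g x t) (\<lambda>x t. fx x t + gx x t) (\<lambda>x t. ft x t + gt x t)"
proof -
  have "weak_deriv_on (ball x0 (t0 - t)) (\<lambda>x. f x t + g x t) (\<lambda>x. fx x t + gx x t)" if "t \<in> {0..<t0}" for t
    by (rule weak_deriv_on_add) (use assms that in \<open>auto simp: regular_on_cone_def C_L2_def\<close>)
  then show ?thesis
    using assms C_L2_add L2_time_deriv_add unfolding regular_on_cone_def by blast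
qed

section \<open>Regularity of continuously differentiable functions\<close>

lemma uniformly_continuous_in_time:
  fixes f :: "real \<Rightarrow> real \<Rightarrow> real"
  assumes f: "continuous_on UNIV (\<lambda>(x, t). f x t)" and e: "e > 0"
  obtains \<delta> where "\<delta> > 0" "\<And>x \<tau>. x \<in> {-R..R} \<Longrightarrow> \<bar>\<tau> - t\<bar> < \<delta> \<Longrightarrow> \<bar>f x \<tau> - f x t\<bar> < e"
proof -
  have "uniformly_continuous_on ({-R..R} \<times> {t-1..t+1}) (\<lambda>(x, t). f x t)"
    by (intro compact_uniformly_continuous continuous_on_subset[OF f] compact_Times) auto
  then obtain d where d: "d > 0" "\<And>p q. p \<in> {-R..R} \<times> {t-1..t+1} \<Longrightarrow> q \<in> {-R..R} \<times> {t-1..t+1} \<Longrightarrow> dist q p < d \<Longrightarrow>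
      dist ((\<lambda>(x, t). f x t) q) ((\<lambda>(x, t). f x t) p) < e"
    unfolding uniformly_continuous_on_def using e by blast
  show thesis
  proof (rule that[of "min d 1"])
    fix x \<tau> assume "x \<in> {-R..R}" "\<bar>\<tau> - t\<bar> < min d 1"
    moreover from this have "\<tau> \<in> {t-1..t+1}" by (simp add: abs_le_iff) linarith
    ultimately show "\<bar>f x \<tau> - f x t\<bar> < e"
      using d(2)[of "(x, t)" "(x, \<tau>)"] by (auto simp: dist_Pair_Pair dist_real_def)
  qed (use d in auto)
qed

lemma L2_sq_uniform_limit:
  assumes f: "\<And>e. e > 0 \<Longrightarrow> \<forall>\<^sub>F \<tau> in F. \<forall>x\<in>S. \<bar>f \<tau> x\<bar> \<le> e" and R: "0 \<le> R" "S \<subseteq> {-R..R}"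
  shows "((\<lambda>\<tau>. L2_sq S (f \<tau>)) \<longlongrightarrow> 0) F"
proof (rule order_tendstoI)
  fix a :: ennreal assume "0 < a"
  then obtain b where b: "0 < b" "ennreal b < a"
  proof -
    obtain c where c: "0 < c" "c < a" using dense[OF \<open>0 < a\<close>] by blast
    then have "c < \<infinity>" using less_le_trans[of c a \<infinity>] by simp
    then show thesis using c that[of "enn2real c"] by (simp add: enn2real_positive_iff)
  qed
  \<comment> \<open>The square of \<open>e\<close> times the length \<open>2 * R\<close> stays below
    \<open>b\<close>; the added 1 avoids a division by 0.\<close>
  define e where "e = sqrt (b / (2 * R + 1))"
  have e: "e > 0" using b R by (simp add: e_def)
  have "e\<^sup>2 * (2 * R + 1) = b" using b R by (simp add: e_def)
  then have "e\<^sup>2 * (2 * R) + e\<^sup>2 = b" by (simp only: distrib_left mult_1_right)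
  then have eb: "e\<^sup>2 * (2 * R) \<le> b" using zero_le_power2[of e] by linarith
  show "\<forall>\<^sub>F \<tau> in F. L2_sq S (f \<tau>) < a"
    using f[OF e]
  proof eventually_elim
    case (elim \<tau>)
    have "L2_sq S (f \<tau>) \<le> ennreal (e\<^sup>2 * (2 * R))"
      by (rule L2_sq_le_sup[OF _ _ R]) (use elim e in auto)
    also have "\<dots> \<le> ennreal b" using eb by (intro ennreal_leI)
    also have "\<dots> < a" by (rule b)
    finally show ?case .
  qed
qed simp

lemma C_L2_continuous:
  assumes f: "continuous_on UNIV (\<lambda>(x, t). f x t)"
  shows "C_L2 x0 t0 f"
  unfolding C_L2_def
proof (intro conjI ballI)
  fix t assume t: "t \<in> {0..<t0}"
  define R where "R = \<bar>x0\<bar> + t0"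
  have R: "0 \<le> R" "ball x0 (t0 - t) \<subseteq> {-R..R}" using t ball_subset_Icc[of "t0 - t" t0 x0] by (auto simp: R_def)
  have fc: "continuous_on UNIV (\<lambda>x. f x t)"
    by (rule continuous_on_UNIV_section[OF f]) (auto intro: continuous_intros)
  have "bounded ((\<lambda>x. f x t) ` {-R..R})"
    by (intro compact_imp_bounded compact_continuous_image continuous_on_subset[OF fc]) auto
  then obtain C where C: "\<And>x. x \<in> {-R..R} \<Longrightarrow> \<bar>f x t\<bar> \<le> C" by (auto simp: bounded_iff simp del: atLeastAtMost_iff)
  have "L2_sq (ball x0 (t0 - t)) (\<lambda>x. f x t) \<le> ennreal (C\<^sup>2 * (2 * R))"
  proof (rule L2_sq_le_sup[OF _ _ R])
    have "\<bar>f 0 t\<bar> \<le> C" using C R by simp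
    then show "0 \<le> C" by linarith
  qed (use C R in auto)
  also have "\<dots> < \<infinity>" by simp
  finally show "L2_on (ball x0 (t0 - t)) (\<lambda>x. f x t)"
    by (intro L2_onI continuous_measurable_lebesgue[OF fc]) auto
next
  fix s t assume s: "s \<in> {0..<t0}" and t: "t \<in> {0..s}"
  define R where "R = \<bar>x0\<bar> + t0"
  have R: "0 \<le> R" "ball x0 (t0 - s) \<subseteq> {-R..R}" using s ball_subset_Icc[of "t0 - s" t0 x0] by (auto simp: R_def)
  show "((\<lambda>\<tau>. L2_sq (ball x0 (t0 - s)) (\<lambda>x. f x \<tau> - f x t)) \<longlongrightarrow> 0) (at t within {0..s})"
  proof (rule L2_sq_uniform_limit[OF _ R])
    fix e :: real assume e: "e > 0"
    obtain \<delta> where \<delta>: "\<delta> > 0" "\<And>x \<tau>. x \<in> {-R..R} \<Longrightarrow> \<bar>\<tau> - t\<bar> < \<delta> \<Longrightarrow> \<bar>f x \<tau> - f x t\<bar> < e"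
      by (rule uniformly_continuous_in_time[OF f e, where R=R and t=t]) (rule that)
    have "\<bar>f x \<tau> - f x t\<bar> \<le> e" if "x \<in> ball x0 (t0 - s)" "\<bar>\<tau> - t\<bar> < \<delta>" for x \<tau>
      using \<delta>(2)[OF subsetD[OF R(2) that(1)] that(2)] by simp
    then show "\<forall>\<^sub>F \<tau> in at t within {0..s}. \<forall>x\<in>ball x0 (t0 - s). \<bar>f x \<tau> - f x t\<bar> \<le> e"
      unfolding eventually_at dist_real_def using \<delta>(1) by blast
  qed
qed

lemma L2_time_deriv_C1:
  assumes ft: "continuous_on UNIV (\<lambda>(x, t). ft x t)"
    and D: "\<And>x t. ((\<lambda>t. f x t) has_real_derivative ft x t) (at t)"
  shows "L2_time_deriv x0 t0 f ft"
  unfolding L2_time_deriv_def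
proof (intro ballI)
  fix s t assume s: "s \<in> {0..<t0}" and t: "t \<in> {0..s}"
  define R where "R = \<bar>x0\<bar> + t0"
  have R: "0 \<le> R" "ball x0 (t0 - s) \<subseteq> {-R..R}" using s ball_subset_Icc[of "t0 - s" t0 x0] by (auto simp: R_def)
  show "((\<lambda>\<tau>. L2_sq (ball x0 (t0 - s)) (\<lambda>x. (f x \<tau> - f x t) / (\<tau> - t) - ft x t)) \<longlongrightarrow> 0) (at t within {0..s})"
  proof (rule L2_sq_uniform_limit[OF _ R])
    fix e :: real assume e: "e > 0"
    obtain \<delta> where \<delta>: "\<delta> > 0" "\<And>x \<tau>. x \<in> {-R..R} \<Longrightarrow> \<bar>\<tau> - t\<bar> < \<delta> \<Longrightarrow> \<bar>ft x \<tau> - ft x t\<bar> < e"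
      by (rule uniformly_continuous_in_time[OF ft e, where R=R and t=t]) (rule that)
    have "\<bar>(f x \<tau> - f x t) / (\<tau> - t) - ft x t\<bar> \<le> e"
      if x: "x \<in> ball x0 (t0 - s)" and \<tau>: "\<bar>\<tau> - t\<bar> < \<delta>" "\<tau> \<noteq> t" for x \<tau>
    proof -
      \<comment> \<open>The mean value theorem on either side of \<open>t\<close>; by uniform
        continuity of \<open>ft\<close> the quotient is then close to \<open>ft x t\<close> for all
        \<open>x\<close> at once.\<close>
      have "\<exists>z. \<bar>z - t\<bar> < \<delta> \<and> (f x \<tau> - f x t) / (\<tau> - t) = ft x z"
      proof (cases "t < \<tau>")
        case True
        have "\<exists>z>t. z < \<tau> \<and> f x \<tau> - f x t = (\<tau> - t) * ft x z" by (rule MVT2[OF True D])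
        then obtain z where "z > t" "z < \<tau>" "f x \<tau> - f x t = (\<tau> - t) * ft x z" by blast
        then show ?thesis using \<tau> True by (intro exI[of _ z]) auto
      next
        case False
        then have lt: "\<tau> < t" using \<tau> by simp
        have "\<exists>z>\<tau>. z < t \<and> f x t - f x \<tau> = (t - \<tau>) * ft x z" by (rule MVT2[OF lt D])
        then obtain z where z: "z > \<tau>" "z < t" "f x t - f x \<tau> = (t - \<tau>) * ft x z" by blast
        have "f x \<tau> - f x t = (\<tau> - t) * ft x z" using z(3) by (simp add: algebra_simps)
        then show ?thesis using z \<tau> lt by (intro exI[of _ z]) auto
      qed
      then obtain z where "\<bar>z - t\<bar> < \<delta>" "(f x \<tau> - f x t) / (\<tau> - t) = ft x z" by blast
      then show ?thesis
        using \<delta>(2)[OF subsetD[OF R(2) x], of z] by (auto intro: less_imp_le)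
    qed
    then show "\<forall>\<^sub>F \<tau> in at t within {0..s}. \<forall>x\<in>ball x0 (t0 - s). \<bar>(f x \<tau> - f x t) / (\<tau> - t) - ft x t\<bar> \<le> e"
      unfolding eventually_at dist_real_def using \<delta>(1) by blast
  qed
qed

lemma regular_C1:
  assumes "continuous_on UNIV (\<lambda>(x, t). f x t)" "continuous_on UNIV (\<lambda>(x, t). fx x t)" "continuous_on UNIV (\<lambda>(x, t). ft x t)"
    and "\<And>x t. ((\<lambda>x. f x t) has_real_derivative fx x t) (at x)" "\<And>x t. ((\<lambda>t. f x t) has_real_derivative ft x t) (at t)"
  shows "regular_on_cone x0 t0 f fx ft"
  unfolding regular_on_cone_def
proof (intro conjI ballI)
  have "continuous_on UNIV (\<lambda>x. fx x t)" for t
    by (rule continuous_on_UNIV_section[OF assms(2)]) (auto intro: continuous_intros)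
  then show "weak_deriv_on (ball x0 (t0 - t)) (\<lambda>x. f x t) (\<lambda>x. fx x t)" for t
    by (intro weak_deriv_C1 assms(4))
qed (use assms in \<open>auto intro: C_L2_continuous L2_time_deriv_C1\<close>)

lemma regular_wduh:
  assumes G: "continuous_on UNIV (\<lambda>(z, \<tau>). G z \<tau>)"
  obtains fx ft where "regular_on_cone x0 t0 (\<lambda>x t. wduh G x t / 2) fx ft"
proof -
  \<comment> \<open>The derivatives of \<open>wduh\<close> in the directions \<open>(1, 0)\<close>
    and \<open>(0, 1)\<close>, halved.\<close>
  define fx where "fx x t = prim (\<lambda>\<tau>. G (x + t - \<tau>) \<tau> - G (x - t + \<tau>) \<tau>) t / 2" for x t
  define ft where "ft x t = prim (\<lambda>\<tau>. G (x + t - \<tau>) \<tau> + G (x - t + \<tau>) \<tau>) t / 2" for x t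
  have "continuous_on UNIV (\<lambda>(p, \<tau>). G (fst p + snd p - \<tau>) \<tau> - G (fst p - snd p + \<tau>) \<tau>)"
    unfolding split_beta by (intro continuous_intros continuous_on_UNIV_section[OF G])
  then have "continuous_on UNIV (\<lambda>p. prim (\<lambda>\<tau>. G (fst p + snd p - \<tau>) \<tau> - G (fst p - snd p + \<tau>) \<tau>) (snd p))"
    by (rule continuous_on_UNIV_section[OF prim_continuous_param]) (auto intro: continuous_intros)
  then have fx: "continuous_on UNIV (\<lambda>(x, t). fx x t)"
    unfolding fx_def split_beta' by (intro continuous_intros) auto
  have "continuous_on UNIV (\<lambda>(p, \<tau>). G (fst p + snd p - \<tau>) \<tau> + G (fst p - snd p + \<tau>) \<tau>)"
    unfolding split_beta by (intro continuous_intros continuous_on_UNIV_section[OF G])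
  then have "continuous_on UNIV (\<lambda>p. prim (\<lambda>\<tau>. G (fst p + snd p - \<tau>) \<tau> + G (fst p - snd p + \<tau>) \<tau>) (snd p))"
    by (rule continuous_on_UNIV_section[OF prim_continuous_param]) (auto intro: continuous_intros)
  then have ft: "continuous_on UNIV (\<lambda>(x, t). ft x t)"
    unfolding ft_def split_beta' by (intro continuous_intros) auto
  have Dx: "((\<lambda>x. wduh G x t / 2) has_real_derivative fx x t) (at x)" for x t
    using wduh_DERIV[OF G, of 0 1 t 0 x] unfolding fx_def
    by (auto intro!: DERIV_cdivide simp: add.commute)
  have Dt: "((\<lambda>t. wduh G x t / 2) has_real_derivative ft x t) (at t)" for x t
    using wduh_DERIV[OF G, of x 0 0 1 t] unfolding ft_def
    by (auto intro!: DERIV_cdivide simp: add.commute)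
  have "continuous_on UNIV (\<lambda>(x, t). wduh G x t / 2)"
    using wduh_continuous[OF G] unfolding split_beta by (intro continuous_intros) auto
  from regular_C1[OF this fx ft Dx Dt] show thesis by (rule that)
qed

text \<open>\<open>c = 1\<close> and \<open>c = -1\<close> give the two free waves. The argument
  \<open>x + c * t\<close> makes the time derivative \<open>c\<close> times the space
  derivative.\<close>

lemma regular_translation:
  fixes a A :: "real \<Rightarrow> real"
  assumes a: "a \<in> borel_measurable lebesgue" "\<And>x. \<bar>a x\<bar> \<le> M"
    and A: "\<And>x y. x \<le> y \<Longrightarrow> A y - A x = integral {x..y} a" and Ac: "continuous_on UNIV A" and c: "c \<noteq> 0"
  shows "regular_on_cone x0 t0 (\<lambda>x t. A (x + c * t)) (\<lambda>x t. a (x + c * t)) (\<lambda>x t. c * a (x + c * t))"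
  unfolding regular_on_cone_def
proof (intro conjI ballI)
  show "C_L2 x0 t0 (\<lambda>x t. A (x + c * t))"
    by (rule C_L2_continuous) (auto intro!: continuous_on_compose2[OF Ac] continuous_intros simp: split_beta)
  show "C_L2 x0 t0 (\<lambda>x t. a (x + c * t))" by (rule C_L2_translation[OF a c])
  have "(\<lambda>x. c * a x) \<in> borel_measurable lebesgue" "\<And>x. \<bar>c * a x\<bar> \<le> \<bar>c\<bar> * M"
    using a by (auto simp: abs_mult intro: mult_left_mono)
  from C_L2_translation[OF this c] show "C_L2 x0 t0 (\<lambda>x t. c * a (x + c * t))" .
  show "L2_time_deriv x0 t0 (\<lambda>x t. A (x + c * t)) (\<lambda>x t. c * a (x + c * t))"
    by (rule L2_time_deriv_translation[OF a A Ac c])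
  fix t
  show "weak_deriv_on (ball x0 (t0 - t)) (\<lambda>x. A (x + c * t)) (\<lambda>x. a (x + c * t))"
  proof (rule weak_deriv_primitive)
    show "(\<lambda>x. a (x + c * t)) \<in> borel_measurable lebesgue" by (rule borel_measurable_shift[OF a(1)])
    show "A (y + c * t) - A (x + c * t) = integral {x..y} (\<lambda>x. a (x + c * t))" if "x \<le> y" for x y
      using A[of "x + c * t" "y + c * t"] that integral_shift_Icc_real[of x y a "c * t"] by (simp add: o_def add.commute)
    show "continuous_on UNIV (\<lambda>x. A (x + c * t))" by (intro continuous_on_compose2[OF Ac] continuous_intros) auto
  qed (rule a)
qed

section \<open>From weak derivatives to increments of the data\<close>

lemma bump_average_tendsto:
  assumes u0: "continuous_on UNIV u0"
  shows "((\<lambda>\<delta>. integral {a..a + \<delta>} (\<lambda>x. u0 x * bump a (a + \<delta>) 1 x) / integral UNIV (bump a (a + \<delta>) 1)) \<longlongrightarrow> u0 a) (at_right 0)"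
proof (rule tendstoI)
  fix e :: real assume e: "e > 0"
  have "isCont u0 a" using u0 by (simp add: continuous_on_eq_continuous_at)
  then obtain d where d: "d > 0" "\<And>x. \<bar>x - a\<bar> < d \<Longrightarrow> \<bar>u0 x - u0 a\<bar> < e / 2"
    using e unfolding continuous_at_eps_delta by (metis dist_real_def half_gt_zero)
  have "dist (integral {a..a + \<delta>} (\<lambda>x. u0 x * bump a (a + \<delta>) 1 x) / integral UNIV (bump a (a + \<delta>) 1)) (u0 a) < e"
    if \<delta>: "0 < \<delta>" "\<delta> < d" for \<delta>
  proof -
    define \<kappa> where "\<kappa> = integral UNIV (bump a (a + \<delta>) 1)"
    have \<kappa>: "\<kappa> > 0" "integral {a..a + \<delta>} (bump a (a + \<delta>) 1) = \<kappa>"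
      using bump_integral[of a "a + \<delta>" 1 a "a + \<delta>"] \<delta> by (auto simp: \<kappa>_def)
    have bi: "bump a (a + \<delta>) 1 integrable_on {a..a + \<delta>}"
      by (rule integrable_continuous_real[OF smooth_cont[OF smooth_bump]])
    have ui: "(\<lambda>x. u0 x * bump a (a + \<delta>) 1 x) integrable_on {a..a + \<delta>}"
      by (intro integrable_continuous_real continuous_intros continuous_on_subset[OF u0] smooth_cont[OF smooth_bump]) auto
    have di: "(\<lambda>x. u0 x * bump a (a + \<delta>) 1 x - u0 a * bump a (a + \<delta>) 1 x) integrable_on {a..a + \<delta>}"
      by (intro integrable_diff ui integrable_on_mult_right bi)
    have "norm (integral {a..a + \<delta>} (\<lambda>x. u0 x * bump a (a + \<delta>) 1 x - u0 a * bump a (a + \<delta>) 1 x)) \<le> integral {a..a + \<delta>} (\<lambda>x. e / 2 * bump a (a + \<delta>) 1 x)"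
    proof (rule integral_norm_bound_integral[OF di integrable_on_mult_right[OF bi]])
      fix x assume "x \<in> {a..a + \<delta>}"
      then have "\<bar>u0 x - u0 a\<bar> < e / 2" using \<delta> by (intro d) auto
      then have "\<bar>u0 x - u0 a\<bar> * bump a (a + \<delta>) 1 x \<le> e / 2 * bump a (a + \<delta>) 1 x"
        by (intro mult_right_mono bump_nonneg) auto
      then show "norm (u0 x * bump a (a + \<delta>) 1 x - u0 a * bump a (a + \<delta>) 1 x) \<le> e / 2 * bump a (a + \<delta>) 1 x"
        by (simp add: left_diff_distrib[symmetric] abs_mult bump_nonneg)
    qed
    then have "\<bar>integral {a..a + \<delta>} (\<lambda>x. u0 x * bump a (a + \<delta>) 1 x) - u0 a * \<kappa>\<bar> \<le> e / 2 * \<kappa>"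
      using integral_diff[OF ui integrable_on_mult_right[OF bi, of "u0 a"]] \<kappa> by simp
    moreover have "integral {a..a + \<delta>} (\<lambda>x. u0 x * bump a (a + \<delta>) 1 x) / \<kappa> - u0 a
        = (integral {a..a + \<delta>} (\<lambda>x. u0 x * bump a (a + \<delta>) 1 x) - u0 a * \<kappa>) / \<kappa>"
      using \<kappa> by (simp add: diff_divide_distrib)
    ultimately have "\<bar>integral {a..a + \<delta>} (\<lambda>x. u0 x * bump a (a + \<delta>) 1 x) / \<kappa> - u0 a\<bar> \<le> e / 2"
      using \<kappa> by (simp add: abs_divide pos_divide_le_eq)
    then show ?thesis using e by (simp add: dist_real_def \<kappa>_def)
  qed
  then show "\<forall>\<^sub>F \<delta> in at_right 0. dist (integral {a..a + \<delta>} (\<lambda>x. u0 x * bump a (a + \<delta>) 1 x) / integral UNIV (bump a (a + \<delta>) 1)) (u0 a) < e"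
    unfolding eventually_at_right_field using d(1) by (intro exI[of _ d]) auto
qed

text \<open>The test function has as derivative a bump just right of \<open>a\<close> minus a
  balancing bump just right of \<open>b\<close>, and is constant in between. As the bumps contract,
  continuity of \<open>u0\<close> turns the averages into point values.\<close>

lemma weak_deriv_UNIV_increment:
  assumes u0: "continuous_on UNIV u0" and w: "w \<in> borel_measurable lebesgue" "\<And>x. \<bar>w x\<bar> \<le> M"
    and wd: "weak_deriv_on UNIV u0 w" and ab: "a \<le> b"
  shows "u0 b - u0 a = integral {a..b} w"
proof (cases "a = b")
  case True then show ?thesis by simp
next
  case False
  then have ab: "a < b" using ab by simp
  have M: "0 \<le> M" using w(2)[of 0] by linarith
  define J where "J c \<delta> = integral {c..c + \<delta>} (\<lambda>x. u0 x * bump c (c + \<delta>) 1 x) / integral UNIV (bump c (c + \<delta>) 1)" for c \<delta>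
  \<comment> \<open>On the two ramps of width \<delta>,
    \<open>\<bar>\<phi> x\<bar> \<le> 2 * \<kappa>\<close> costs \<open>4 * M * \<delta>\<close>
    after division by \<kappa>; replacing \<open>a + \<delta>\<close> by \<open>a\<close> in the
    integral of \<open>w\<close> costs another \<open>M * \<delta>\<close>. The 6 is rounded
    up.\<close>
  have key: "\<bar>(J a \<delta> - J b \<delta>) + integral {a..b} w\<bar> \<le> 6 * M * \<delta>" if \<delta>: "0 < \<delta>" "\<delta> < b - a" for \<delta>
  proof -
    define \<kappa> where "\<kappa> = integral UNIV (bump a (a + \<delta>) 1)"
    define \<kappa>' where "\<kappa>' = integral UNIV (bump b (b + \<delta>) 1)"
    have \<kappa>: "\<kappa> > 0" "\<kappa>' > 0"
      using bump_integral(2)[of a "a + \<delta>" 1 a "a + \<delta>"] bump_integral(2)[of b "b + \<delta>" 1 b "b + \<delta>"] \<delta> by (auto simp: \<kappa>_def \<kappa>'_def)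
    have a\<delta>: "a < a + \<delta>" "b < b + \<delta>" "(0::real) < 1" "{min a b..max (a + \<delta>) (b + \<delta>)} \<subseteq> UNIV" using \<delta> by auto
    obtain \<phi> where \<phi>: "test_function UNIV \<phi>" "smooth \<phi>"
      "deriv \<phi> = (\<lambda>x. bump a (a + \<delta>) 1 x - \<kappa> / \<kappa>' * bump b (b + \<delta>) 1 x)"
      "\<And>x. \<bar>\<phi> x\<bar> \<le> 2 * \<kappa>" "\<And>x. x \<notin> {min a b..max (a + \<delta>) (b + \<delta>)} \<Longrightarrow> \<phi> x = 0"
      "\<And>x. a + \<delta> \<le> x \<Longrightarrow> x \<le> b \<Longrightarrow> \<phi> x = \<kappa>"
      by (rule bump_combination_primitive[OF a\<delta>(1,3,2,3,4), folded \<kappa>_def \<kappa>'_def]) (rule that)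
    have \<phi>0: "\<phi> x = 0" if "x \<notin> {a..b + \<delta>}" for x using \<phi>(5)[of x] that ab \<delta> by (auto simp: min_def max_def)
    have eq: "(LINT x:UNIV|lebesgue. f x) = integral {c..d} f"
      if "set_integrable lebesgue {c..d} f" "\<And>x. x \<notin> {c..d} \<Longrightarrow> f x = 0" for f :: "real \<Rightarrow> real" and c d
    proof -
      have "(LINT x:UNIV|lebesgue. f x) = (LINT x:{c..d}|lebesgue. f x)"
        unfolding set_lebesgue_integral_def using that(2)
        by (intro Bochner_Integration.integral_cong) (auto simp: indicator_def)
      then show ?thesis using set_lebesgue_integral_eq_integral[OF that(1)] by simp
    qed
    have ub: "set_integrable lebesgue {c..d} (\<lambda>x. u0 x * bump c' d' 1 x)" for c d c' d'
      by (intro absolutely_integrable_continuous_real continuous_intros continuous_on_subset[OF u0] smooth_cont[OF smooth_bump]) auto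
    have ub': "set_integrable lebesgue UNIV (\<lambda>x. u0 x * bump c d 1 x)" for c d
    proof -
      have "(\<lambda>x. indicator {c..d} x *\<^sub>R (u0 x * bump c d 1 x)) = (\<lambda>x. indicator UNIV x *\<^sub>R (u0 x * bump c d 1 x))"
        by (intro ext) (auto simp: indicator_def intro!: bump_eq_0)
      then show ?thesis using ub[of c d c d] unfolding set_integrable_def by simp
    qed
    have ueq: "(LINT x:UNIV|lebesgue. u0 x * bump c d 1 x) = integral {c..d} (\<lambda>x. u0 x * bump c d 1 x)" for c d
      by (rule eq[OF ub]) (auto intro!: bump_eq_0)
    have "(LINT x:UNIV|lebesgue. u0 x * deriv \<phi> x) =
        (LINT x:UNIV|lebesgue. u0 x * bump a (a + \<delta>) 1 x) - (LINT x:UNIV|lebesgue. \<kappa> / \<kappa>' * (u0 x * bump b (b + \<delta>) 1 x))"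
      unfolding \<phi>(3) by (subst set_integral_diff(2)[symmetric]) (use ub' in \<open>auto simp: algebra_simps intro!: set_integrable_mult_right\<close>)
    also have "(LINT x:UNIV|lebesgue. u0 x * bump a (a + \<delta>) 1 x) = \<kappa> * J a \<delta>"
      using \<kappa> by (simp add: ueq J_def \<kappa>_def)
    also have "(LINT x:UNIV|lebesgue. \<kappa> / \<kappa>' * (u0 x * bump b (b + \<delta>) 1 x)) = \<kappa> / \<kappa>' * (\<kappa>' * J b \<delta>)"
      using \<kappa> by (simp add: ueq J_def \<kappa>'_def)
    finally have 1: "(LINT x:UNIV|lebesgue. u0 x * deriv \<phi> x) = \<kappa> * (J a \<delta> - J b \<delta>)"
      using \<kappa> by (simp add: right_diff_distrib)
    have \<phi>m: "\<phi> \<in> borel_measurable lebesgue" by (rule continuous_measurable_lebesgue[OF smooth_cont[OF \<phi>(2)]])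
    have wi: "set_integrable lebesgue {c..d} w" "w integrable_on {c..d}" for c d
      using bounded_measurable_integrable(1,2)[OF w, of "{c..d}"] by auto
    have wp: "set_integrable lebesgue {c..d} (\<lambda>x. w x * \<phi> x)" for c d
      by (rule set_integrable_mult_bounded(1)[OF wi(1) \<phi>m \<phi>(4)])
    have wpi: "(\<lambda>x. w x * \<phi> x) integrable_on {c..d}" for c d by (rule set_lebesgue_integral_eq_integral[OF wp])
    have 2: "(LINT x:UNIV|lebesgue. w x * \<phi> x) = integral {a..b + \<delta>} (\<lambda>x. w x * \<phi> x)"
      by (rule eq[OF wp]) (use \<phi>0 in auto)
    have "\<kappa> * (J a \<delta> - J b \<delta>) = - integral {a..b + \<delta>} (\<lambda>x. w x * \<phi> x)"
      using wd \<phi>(1) unfolding weak_deriv_on_def 1[symmetric] 2[symmetric] by blast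
    also have "integral {a..b + \<delta>} (\<lambda>x. w x * \<phi> x) = integral {a..a + \<delta>} (\<lambda>x. w x * \<phi> x) + integral {a + \<delta>..b} (\<lambda>x. w x * \<phi> x) + integral {b..b + \<delta>} (\<lambda>x. w x * \<phi> x)"
      using Henstock_Kurzweil_Integration.integral_combine[OF _ _ wpi, of a "a + \<delta>" "b + \<delta>"]
        Henstock_Kurzweil_Integration.integral_combine[OF _ _ wpi, of "a + \<delta>" b "b + \<delta>"] \<delta> by simp
    also have "integral {a + \<delta>..b} (\<lambda>x. w x * \<phi> x) = integral {a + \<delta>..b} (\<lambda>x. w x * \<kappa>)"
      by (rule integral_cong) (use \<phi>(6) in auto)
    also have "integral {a + \<delta>..b} (\<lambda>x. w x * \<kappa>) = \<kappa> * integral {a + \<delta>..b} w"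
      by simp
    finally have 3: "\<kappa> * (J a \<delta> - J b \<delta>) + \<kappa> * integral {a + \<delta>..b} w
        = - (integral {a..a + \<delta>} (\<lambda>x. w x * \<phi> x) + integral {b..b + \<delta>} (\<lambda>x. w x * \<phi> x))" by linarith
    have small: "\<bar>integral {c..c + \<delta>} (\<lambda>x. w x * \<phi> x)\<bar> \<le> M * (2 * \<kappa>) * \<delta>" for c
    proof -
      have "norm (integral {c..c + \<delta>} (\<lambda>x. w x * \<phi> x)) \<le> integral {c..c + \<delta>} (\<lambda>x. M * (2 * \<kappa>))"
        by (rule integral_norm_bound_integral[OF wpi]) (use w(2) \<phi>(4) M in \<open>auto simp: abs_mult intro!: mult_mono\<close>)
      then show ?thesis using \<delta> by (simp add: mult_ac)
    qed
    have 4: "\<bar>\<kappa> * (J a \<delta> - J b \<delta>) + \<kappa> * integral {a + \<delta>..b} w\<bar> \<le> 4 * M * \<delta> * \<kappa>"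
      unfolding 3 using small[of a] small[of b] by (simp add: algebra_simps abs_le_iff)
    have wsmall: "\<bar>integral {a..a + \<delta>} w\<bar> \<le> M * \<delta>"
    proof -
      have "norm (integral {a..a + \<delta>} w) \<le> integral {a..a + \<delta>} (\<lambda>x. M)"
        by (rule integral_norm_bound_integral[OF wi(2)]) (use w(2) in auto)
      then show ?thesis using \<delta> by (simp add: mult.commute)
    qed
    have "integral {a..b} w = integral {a..a + \<delta>} w + integral {a + \<delta>..b} w"
      by (rule Henstock_Kurzweil_Integration.integral_combine[OF _ _ wi(2), symmetric]) (use \<delta> in auto)
    moreover have "\<bar>(J a \<delta> - J b \<delta>) + integral {a + \<delta>..b} w\<bar> \<le> 4 * M * \<delta>"
    proof -
      have "\<kappa> * \<bar>(J a \<delta> - J b \<delta>) + integral {a + \<delta>..b} w\<bar> \<le> \<kappa> * (4 * M * \<delta>)"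
        using 4 \<kappa> by (simp add: distrib_left[symmetric] abs_mult mult.commute)
      then show ?thesis using \<kappa> by simp
    qed
    moreover have "0 \<le> M * \<delta>" using M \<delta> by simp
    ultimately show ?thesis using wsmall by (simp add: algebra_simps)
  qed
  have "((\<lambda>\<delta>. \<bar>(J a \<delta> - J b \<delta>) + integral {a..b} w\<bar>) \<longlongrightarrow> \<bar>(u0 a - u0 b) + integral {a..b} w\<bar>) (at_right 0)"
    unfolding J_def by (intro tendsto_intros bump_average_tendsto u0)
  moreover have "((\<lambda>\<delta>. 6 * M * \<delta>) \<longlongrightarrow> 6 * M * 0) (at_right 0)" by (intro tendsto_intros)
  moreover have "\<forall>\<^sub>F \<delta> in at_right 0. \<bar>(J a \<delta> - J b \<delta>) + integral {a..b} w\<bar> \<le> 6 * M * \<delta>"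
    unfolding eventually_at_right_field using key ab by (intro exI[of _ "b - a"]) auto
  ultimately have "\<bar>(u0 a - u0 b) + integral {a..b} w\<bar> \<le> 6 * M * 0"
    by (intro tendsto_le[OF _ _ _, of "at_right 0"]) auto
  then show ?thesis by simp
qed

text \<open>The regularity lemmas for translations ask for bounds at every point. Changing a
  function on a null set affects neither its integrals nor its role as a weak derivative.\<close>

lemma L_inf_truncate:
  assumes "L_inf v"
  obtains w M where "w \<in> borel_measurable lebesgue" "\<And>x. \<bar>w x\<bar> \<le> M" "AE x in lebesgue. w x = v x"
proof -
  obtain M where v: "v \<in> borel_measurable lebesgue" "AE x in lebesgue. \<bar>v x\<bar> \<le> M"
    using assms by (auto simp: L_inf_def)
  define w where "w x = max (- \<bar>M\<bar>) (min \<bar>M\<bar> (v x))" for x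
  show thesis
  proof (rule that[of w "\<bar>M\<bar>"])
    show "w \<in> borel_measurable lebesgue"
      unfolding w_def by (intro borel_measurable_max borel_measurable_min borel_measurable_const v)
    show "\<bar>w x\<bar> \<le> \<bar>M\<bar>" for x by (auto simp: w_def)
    show "AE x in lebesgue. w x = v x"
      using v(2) by eventually_elim (auto simp: w_def)
  qed
qed

lemma integral_AE_eq:
  fixes f g :: "real \<Rightarrow> real"
  assumes "AE x in lebesgue. f x = g x" shows "integral S f = integral S g"
proof -
  have "{x. f x \<noteq> g x} \<in> null_sets lebesgue" using assms by (simp add: completion.AE_iff_null_sets)
  then have "negligible {x. f x \<noteq> g x}" by (simp add: negligible_iff_null_sets)
  then show ?thesis by (rule integral_spike) auto
qed

lemma wave_parts_Lipschitz:
  assumes u0: "continuous_on UNIV u0" and u1: "L2_locu u1" and W: "W1_inf u0" "L_inf u1"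
  obtains a b M where "a \<in> borel_measurable lebesgue" "\<And>x. \<bar>a x\<bar> \<le> M"
    "\<And>x y. x \<le> y \<Longrightarrow> wave_plus u0 u1 y - wave_plus u0 u1 x = integral {x..y} a"
    "b \<in> borel_measurable lebesgue" "\<And>x. \<bar>b x\<bar> \<le> M"
    "\<And>x y. x \<le> y \<Longrightarrow> wave_minus u0 u1 y - wave_minus u0 u1 x = integral {x..y} b"
proof -
  obtain v' where v': "weak_deriv_on UNIV u0 v'" "L_inf v'" using W by (auto simp: W1_inf_def)
  obtain w M where w: "w \<in> borel_measurable lebesgue" "\<And>x. \<bar>w x\<bar> \<le> M" "AE x in lebesgue. w x = v' x"
    by (rule L_inf_truncate[OF v'(2)]) (rule that)
  obtain v N where v: "v \<in> borel_measurable lebesgue" "\<And>x. \<bar>v x\<bar> \<le> N" "AE x in lebesgue. v x = u1 x"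
    by (rule L_inf_truncate[OF W(2)]) (rule that)
  have "weak_deriv_on UNIV u0 w"
    unfolding weak_deriv_on_def
  proof (intro allI impI)
    fix \<phi> assume \<phi>: "test_function UNIV \<phi>"
    have m: "v' \<in> borel_measurable lebesgue" using v' by (simp add: L_inf_def)
    have \<phi>m: "\<phi> \<in> borel_measurable lebesgue"
      using test_function_bounded[OF \<phi>] continuous_measurable_lebesgue by metis
    have "(LINT x:UNIV|lebesgue. w x * \<phi> x) = (LINT x:UNIV|lebesgue. v' x * \<phi> x)"
      unfolding set_lebesgue_integral_def
    proof (rule integral_cong_AE)
      show "(\<lambda>x. indicator UNIV x *\<^sub>R (w x * \<phi> x)) \<in> borel_measurable lebesgue"
        "(\<lambda>x. indicator UNIV x *\<^sub>R (v' x * \<phi> x)) \<in> borel_measurable lebesgue"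
        using borel_measurable_times[OF w(1) \<phi>m] borel_measurable_times[OF m \<phi>m] by simp_all
      show "AE x in lebesgue. indicator UNIV x *\<^sub>R (w x * \<phi> x) = indicator UNIV x *\<^sub>R (v' x * \<phi> x)"
        using w(3) by eventually_elim simp
    qed
    then show "(LINT x:UNIV|lebesgue. u0 x * deriv \<phi> x) = - (LINT x:UNIV|lebesgue. w x * \<phi> x)"
      using v'(1) \<phi> by (simp add: weak_deriv_on_def)
  qed
  from weak_deriv_UNIV_increment[OF u0 w(1,2) this]
  have U: "u0 y - u0 x = integral {x..y} w" if "x \<le> y" for x y using that by blast
  have P: "prim u1 y - prim u1 x = integral {x..y} v" if "x \<le> y" for x y
    using prim_diff[OF L2_locu_integrable(2)[OF u1] that] integral_AE_eq[OF v(3)] by simp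
  have wi: "w integrable_on {x..y}" and vi: "v integrable_on {x..y}" for x y
    by (rule bounded_measurable_integrable(2)[OF w(1,2)] bounded_measurable_integrable(2)[OF v(1,2)]; simp)+
  show thesis
  proof (rule that[of "\<lambda>x. (w x + v x) / 2" "M + N" "\<lambda>x. (w x - v x) / 2"])
    show "(\<lambda>x. (w x + v x) / 2) \<in> borel_measurable lebesgue" "(\<lambda>x. (w x - v x) / 2) \<in> borel_measurable lebesgue"
      by (intro borel_measurable_divide borel_measurable_add borel_measurable_diff borel_measurable_const w(1) v(1))+
    show "\<bar>(w x + v x) / 2\<bar> \<le> M + N" "\<bar>(w x - v x) / 2\<bar> \<le> M + N" for x
      using w(2)[of x] v(2)[of x] by (auto simp: abs_le_iff)
    show "wave_plus u0 u1 y - wave_plus u0 u1 x = integral {x..y} (\<lambda>x. (w x + v x) / 2)" if "x \<le> y" for x y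
      using U[OF that] P[OF that] unfolding integral_divide integral_add[OF wi vi] wave_plus_def by argo
    show "wave_minus u0 u1 y - wave_minus u0 u1 x = integral {x..y} (\<lambda>x. (w x - v x) / 2)" if "x \<le> y" for x y
      using U[OF that] P[OF that] unfolding integral_divide integral_diff[OF wi vi] wave_minus_def by argo
  qed
qed

section \<open>The lower bound\<close>

text \<open>As long as \<open>v \<le> k\<close>, the truncated nonlinearity is the exponential. The
  regularity is that of two translated Lipschitz functions plus a continuously differentiable
  Duhamel part.\<close>

lemma truncated_solution_on_cone:
  assumes u0: "continuous_on UNIV u0" and u1: "L2_locu u1" and W: "W1_inf u0" "L_inf u1"
    and v: "continuous_on UNIV (\<lambda>(x, t). v x t)"
    "\<And>x t. 0 \<le> t \<Longrightarrow> v x t = wave_plus u0 u1 (x + t) + wave_minus u0 u1 (x - t) + duh (\<lambda>z \<tau>. trunc_exp k (v z \<tau>)) x t / 2"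
    and k: "\<And>x t. 0 \<le> t \<Longrightarrow> \<bar>x - x0\<bar> < t0 - t \<Longrightarrow> v x t \<le> k"
  shows "\<exists>w. solution_on_cone u0 u1 w x0 t0"
proof -
  let ?A = "wave_plus u0 u1" and ?B = "wave_minus u0 u1"
  obtain a b M where a: "a \<in> borel_measurable lebesgue" "\<And>x. \<bar>a x\<bar> \<le> M" "\<And>x y. x \<le> y \<Longrightarrow> ?A y - ?A x = integral {x..y} a"
    and b: "b \<in> borel_measurable lebesgue" "\<And>x. \<bar>b x\<bar> \<le> M" "\<And>x y. x \<le> y \<Longrightarrow> ?B y - ?B x = integral {x..y} b"
    by (rule wave_parts_Lipschitz[OF u0 u1 W]) (rule that)
  note c = wave_continuous[OF u0 u1]
  define G where "G z \<tau> = trunc_exp k (v z \<tau>)" for z \<tau>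
  have G: "continuous_on UNIV (\<lambda>(z, \<tau>). G z \<tau>)"
    using continuous_on_trunc_exp[OF v(1), of k] by (simp add: G_def split_beta)
  obtain fx ft where f: "regular_on_cone x0 t0 (\<lambda>x t. wduh G x t / 2) fx ft"
    by (rule regular_wduh[OF G]) (rule that)
  \<comment> \<open>For nonnegative times \<open>w\<close> is \<open>v\<close>, but written with
    \<open>wduh\<close>, which is differentiable across time 0; the factors \<open>1\<close> and
    \<open>-1\<close> fit \<open>regular_translation\<close>.\<close>
  define w where "w x t = ?A (x + 1 * t) + ?B (x + (-1) * t) + wduh G x t / 2" for x t
  have "\<exists>wx wt. regular_on_cone x0 t0 w wx wt"
    unfolding w_def
    using regular_add[OF regular_add[OF regular_translation[OF a c(1), of 1] regular_translation[OF b c(2), of "-1"]] f] by auto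
  then obtain wx wt where reg: "regular_on_cone x0 t0 w wx wt" by blast
  have wv: "w x t = v x t" if "0 \<le> t" for x t
    using v(2)[OF that, of x] duh_eq_wduh[OF G that, of x] unfolding G_def[abs_def] w_def by simp
  have "duhamel u0 u1 w x t" if t: "t \<in> {0..<t0}" and x: "x \<in> ball x0 (t0 - t)" for x t
  proof -
    have "(LINT z:{x - t + \<tau>..x + t - \<tau>}|lebesgue. exp (w z \<tau>)) = integral {x - t + \<tau>..x + t - \<tau>} (\<lambda>z. G z \<tau>)"
      if \<tau>: "\<tau> \<in> {0..t}" for \<tau>
    proof -
      have "exp (w z \<tau>) = G z \<tau>" if "z \<in> {x - t + \<tau>..x + t - \<tau>}" for z
      proof -
        have "\<bar>z - x\<bar> \<le> t - \<tau>" using that by (auto simp: abs_le_iff)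
        moreover have "\<bar>x - x0\<bar> < t0 - t" using x by (simp add: dist_real_def)
        ultimately have "v z \<tau> \<le> k" using \<tau> by (intro k) auto
        then show ?thesis using wv[of \<tau> z] \<tau> by (simp add: G_def trunc_exp_def min_def)
      qed
      then have "(LINT z:{x - t + \<tau>..x + t - \<tau>}|lebesgue. exp (w z \<tau>)) = (LINT z:{x - t + \<tau>..x + t - \<tau>}|lebesgue. G z \<tau>)"
        unfolding set_lebesgue_integral_def by (intro Bochner_Integration.integral_cong) (auto simp: indicator_def)
      then show ?thesis by (simp add: continuous_LINT[OF continuous_slice[OF G]])
    qed
    then have "(LINT \<tau>:{0..t}|lebesgue. (LINT z:{x - t + \<tau>..x + t - \<tau>}|lebesgue. exp (w z \<tau>)))
        = (LINT \<tau>:{0..t}|lebesgue. integral {x - t + \<tau>..x + t - \<tau>} (\<lambda>z. G z \<tau>))"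
      unfolding set_lebesgue_integral_def by (intro Bochner_Integration.integral_cong) (auto simp: indicator_def)
    also have "\<dots> = duh G x t"
      unfolding duh_def by (rule continuous_LINT[OF duh_inner_continuous[OF G]])
    finally have e: "(LINT \<tau>:{0..t}|lebesgue. (LINT z:{x - t + \<tau>..x + t - \<tau>}|lebesgue. exp (w z \<tau>))) = duh G x t" .
    have t0: "0 \<le> t" using t by simp
    show ?thesis
      unfolding duhamel_def e using free_wave_eq[OF u1 t0, of u0 x] v(2)[OF t0, of x] wv[OF t0, of x]
      by (simp add: G_def[abs_def])
  qed
  then have "solution_on_cone u0 u1 w x0 t0"
    using reg unfolding solution_on_cone_def C_H1_def regular_on_cone_def by blast
  then show ?thesis by blast
qed

context blowup
begin

text \<open>A bound \<open>c\<close> up to the tip makes the truncation at \<open>c + 1\<close>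
  inactive, so that \<open>u\<close> coincides with the global function \<open>v\<close> below the
  tip. Continuity of \<open>v\<close> carries the bound to the closed triangle and, with one unit to
  spare, to a neighbourhood of it. The neighbourhood contains a larger cone, on which
  \<open>v\<close> solves the original equation, so that \<open>(x, T x)\<close> would belong to the
  domain.\<close>

lemma unbounded_below_tip:
  assumes W: "W1_inf u0" "L_inf u1" and xt: "(x, t) \<in> D"
    and bound: "\<And>y s. 0 \<le> s \<Longrightarrow> \<bar>y - x\<bar> < T x - s \<Longrightarrow> u y s \<le> c"
  shows False
proof -
  have T0: "0 < T x" using less_T[OF xt] D_nonneg[OF xt] by simp
  obtain v where v: "continuous_on UNIV (\<lambda>(x, t). v x t)"
    "\<And>x t. 0 \<le> t \<Longrightarrow> v x t = A (x + t) + B (x - t) + duh (\<lambda>z \<tau>. trunc_exp (c + 1) (v z \<tau>)) x t / 2"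
    by (rule truncated_solution[OF wave_continuous[OF u0 u1], where k="c + 1"]) (rule that)
  have uv: "u y s = v y s" if ys: "0 \<le> s" "\<bar>y - x\<bar> < T x - s" for y s
  proof (rule truncated_unique[OF v])
    have inD: "(y, s) \<in> D" by (rule domain_cone[OF xt ys])
    show "continuous_on (tri y s) (\<lambda>(x, t). u x t)"
      by (rule continuous_on_subset[OF continuous_on_D triangle_subset_D[OF inD]])
    show "(y, s) \<in> tri y s" using ys by (simp add: tri_def)
    fix z \<tau> assume z: "(z, \<tau>) \<in> tri y s"
    then show "u z \<tau> = A (z + \<tau>) + B (z - \<tau>) + duh (\<lambda>z \<tau>. exp (u z \<tau>)) z \<tau> / 2"
      using triangle_subset_D[OF inD] by (intro duhamel_D) auto
    have "u z \<tau> \<le> c" using z ys by (intro bound) (auto simp: tri_def)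
    then show "u z \<tau> \<le> c + 1" by simp
  qed
  have vc: "v y s \<le> c" if ys: "(y, s) \<in> tri x (T x)" for y s
  proof -
    \<comment> \<open>Points of the closed triangle are approached along the segment from
      \<open>(x, 0)\<close>; for \<open>r < 1\<close> it stays in the open region where
      \<open>u\<close> is bounded.\<close>
    have "((\<lambda>r. (\<lambda>(x, t). v x t) (x + r * (y - x), r * s)) \<longlongrightarrow> (\<lambda>(x, t). v x t) (x + 1 * (y - x), 1 * s)) (at_left 1)"
    proof (rule isCont_tendsto_compose[where g="\<lambda>(x, t). v x t"])
      show "isCont (\<lambda>(x, t). v x t) (x + 1 * (y - x), 1 * s)"
        using v(1)[unfolded continuous_on_eq_continuous_at[OF open_UNIV]] by blast
    qed (intro tendsto_intros)
    moreover have "\<forall>\<^sub>F r in at_left 1. (\<lambda>(x, t). v x t) (x + r * (y - x), r * s) \<le> c"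
      unfolding eventually_at_left_field
    proof (intro exI[of _ 0] conjI allI impI)
      fix r :: real assume r: "0 < r" "r < 1"
      have "r * \<bar>y - x\<bar> \<le> r * (T x - s)" using ys r by (intro mult_left_mono) (auto simp: tri_def)
      also have "\<dots> < T x - r * s" using r T0 by (simp add: right_diff_distrib)
      finally have 1: "\<bar>x + r * (y - x) - x\<bar> < T x - r * s" using r by (simp add: abs_mult)
      have 2: "0 \<le> r * s" using ys r by (simp add: tri_def)
      show "(\<lambda>(x, t). v x t) (x + r * (y - x), r * s) \<le> c"
        using bound[OF 2 1] uv[OF 2 1] by simp
    qed simp
    ultimately have "(\<lambda>(x, t). v x t) (x + 1 * (y - x), 1 * s) \<le> c"
      by (rule tendsto_upperbound) simp
    then show ?thesis by simp
  qed
  define U where "U = {p. (\<lambda>(x, t). v x t) p < c + 1}"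
  have U: "open U" unfolding U_def by (intro open_Collect_less v(1) continuous_intros)
  have "v z \<tau> < c + 1" if "(z, \<tau>) \<in> tri x (T x)" for z \<tau> using vc[OF that] by simp
  then have sub: "tri x (T x) \<subseteq> U" by (auto simp: U_def)
  have "(x, 0) \<in> tri x (T x)" using T0 by (simp add: tri_def)
  then have ne: "tri x (T x) \<noteq> {}" by blast
  obtain e where e: "e > 0" "{p. infdist p (tri x (T x)) \<le> e} \<subseteq> U"
    by (rule compact_in_open_separated[OF ne compact_triangle U sub]) (rule that)
  \<comment> \<open>The cone of height \<open>T x + \<epsilon>\<close> stays within distance
    \<open>2 * \<epsilon>\<close> of the triangle: a point is lowered in time by \<epsilon> or, if
    it is too close to time 0, projected to time 0 and clipped to the base.\<close>
  define \<epsilon> where "\<epsilon> = e / 2"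
  have \<epsilon>: "\<epsilon> > 0" using e by (simp add: \<epsilon>_def)
  have vk: "v z \<tau> \<le> c + 1" if z: "0 \<le> \<tau>" "\<bar>z - x\<bar> < T x + \<epsilon> - \<tau>" for z \<tau>
  proof -
    have "\<exists>q\<in>tri x (T x). dist (z, \<tau>) q \<le> e"
    proof (cases "\<epsilon> \<le> \<tau>")
      case True
      then have "(z, \<tau> - \<epsilon>) \<in> tri x (T x)" using z by (auto simp: tri_def)
      moreover have "dist (z, \<tau>) (z, \<tau> - \<epsilon>) \<le> e" using \<epsilon> by (simp add: dist_Pair_Pair dist_real_def \<epsilon>_def)
      ultimately show ?thesis by blast
    next
      case False
      define z' where "z' = max (x - T x) (min (x + T x) z)"
      have "(z', 0) \<in> tri x (T x)" using T0 by (auto simp: tri_def z'_def abs_le_iff)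
      moreover have "dist (z, \<tau>) (z', 0) \<le> \<bar>z - z'\<bar> + \<bar>\<tau>\<bar>"
        using sqrt_sum_squares_le_sum_abs[of "z - z'" \<tau>] by (simp add: dist_Pair_Pair dist_real_def)
      moreover have "\<bar>z - z'\<bar> \<le> \<epsilon>" using z T0 \<epsilon> by (auto simp: z'_def max_def min_def abs_le_iff)
      ultimately show ?thesis using False z by (intro bexI[of _ "(z', 0)"]) (auto simp: \<epsilon>_def)
    qed
    then obtain q where "q \<in> tri x (T x)" "dist (z, \<tau>) q \<le> e" by blast
    then have "infdist (z, \<tau>) (tri x (T x)) \<le> e" by (meson infdist_le order_trans)
    then have "(z, \<tau>) \<in> U" using e by auto
    then show ?thesis by (simp add: U_def)
  qed
  have "\<exists>w. solution_on_cone u0 u1 w x (T x + \<epsilon>)"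
    by (rule truncated_solution_on_cone[OF u0 u1 W v vk])
  then have "(x, T x) \<in> D"
    unfolding max_domain_def using \<epsilon> T0 by (auto intro!: exI[of _ "T x + \<epsilon>"])
  from less_T[OF this] show False by simp
qed

text \<open>\<open>N\<close> is half of the Duhamel integral and \<psi> is
  \<open>exp (- N / 2)\<close>, hence the divisor 4.\<close>

definition psi :: "real \<Rightarrow> real \<Rightarrow> real" where
  "psi x t = exp (- duh (\<lambda>z \<tau>. exp (u z \<tau>)) x t / 4)"

lemma psi_null_lines:
  assumes xs: "(x, s) \<in> D" and \<kappa>: "\<And>y. \<bar>y - x\<bar> \<le> s \<Longrightarrow> A y \<le> \<kappa>" "\<And>y. \<bar>y - x\<bar> \<le> s \<Longrightarrow> B y \<le> \<kappa>"
    and y: "(y, t) \<in> tri x s" and h: "0 \<le> h"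
  shows "(y - h, t + h) \<in> tri x s \<Longrightarrow> \<bar>psi (y - h) (t + h) - psi y t\<bar> \<le> exp (2 * \<kappa>) * s / 2 * h"
    and "(y + h, t + h) \<in> tri x s \<Longrightarrow> \<bar>psi (y + h) (t + h) - psi y t\<bar> \<le> exp (2 * \<kappa>) * s / 2 * h"
proof -
  have c: "continuous_on (tri x s) (\<lambda>(x, t). u x t)"
    by (rule continuous_on_subset[OF continuous_on_D triangle_subset_D[OF xs]])
  have d: "u y t = A (y + t) + B (y - t) + duh (\<lambda>z \<tau>. exp (u z \<tau>)) y t / 2" if "(y, t) \<in> tri x s" for y t
    using triangle_subset_D[OF xs] that by (intro duhamel_D) auto
  show "(y - h, t + h) \<in> tri x s \<Longrightarrow> \<bar>psi (y - h) (t + h) - psi y t\<bar> \<le> exp (2 * \<kappa>) * s / 2 * h"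
    unfolding psi_def by (rule liouville_lipschitz[OF wave_continuous[OF u0 u1] c d \<kappa> y _ h])
  show "(y + h, t + h) \<in> tri x s \<Longrightarrow> \<bar>psi (y + h) (t + h) - psi y t\<bar> \<le> exp (2 * \<kappa>) * s / 2 * h"
    unfolding psi_def by (rule liouville_lipschitz_right[OF wave_continuous[OF u0 u1] c d \<kappa> y _ h])
qed

text \<open>If the claim fails at time \<open>t\<close>, the Lipschitz bound keeps \<psi> above a
  positive constant on the axis up to the tip, and then in the whole light cone near the tip, so
  that \<open>u\<close> is bounded there. The rest of the light cone is a compact subset of the
  domain because the point is non-characteristic. This contradicts
  \<open>unbounded_below_tip\<close>.\<close>

lemma psi_vanishes:
  assumes W: "W1_inf u0" "L_inf u1" and xt: "(x, t) \<in> D" and nc: "non_characteristic u0 u1 x"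
    and \<kappa>: "\<And>y. \<bar>y - x\<bar> \<le> T x \<Longrightarrow> \<bar>A y\<bar> \<le> \<kappa>" "\<And>y. \<bar>y - x\<bar> \<le> T x \<Longrightarrow> \<bar>B y\<bar> \<le> \<kappa>"
  shows "psi x t \<le> exp (2 * \<kappa>) * T x / 2 * (T x - t)"
proof (rule ccontr)
  define C where "C = exp (2 * \<kappa>) * T x / 2"
  assume "\<not> psi x t \<le> exp (2 * \<kappa>) * T x / 2 * (T x - t)"
  then have \<eta>0: "0 < psi x t - C * (T x - t)" by (simp add: C_def)
  define \<eta> where "\<eta> = psi x t - C * (T x - t)"
  have tT: "0 \<le> t" "t < T x" using less_T[OF xt] D_nonneg[OF xt] by auto
  then have C0: "C > 0" by (simp add: C_def)
  have inD: "(x, s) \<in> D" if "0 \<le> s" "s < T x" for s by (rule in_domainI[OF xt that])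
  have Cs: "exp (2 * \<kappa>) * s / 2 * h \<le> C * h" if "0 \<le> h" "s < T x" for s h
    unfolding C_def using that by (intro mult_right_mono divide_right_mono mult_left_mono) auto
  have \<kappa>': "A y \<le> \<kappa>" "B y \<le> \<kappa>" if "\<bar>y - x\<bar> \<le> s" "s < T x" for y s
    using \<kappa>[of y] that by auto
  have axis: "\<eta> \<le> psi x s" if s: "t \<le> s" "s < T x" for s
  proof -
    \<comment> \<open>The Lipschitz bound is available along null lines only; the axis is climbed by
      one step to the left and one step back to the right.\<close>
    define h where "h = (s - t) / 2"
    have h: "0 \<le> h" "t + h + h = s" using s by (auto simp: h_def)
    have xs: "(x, s) \<in> D" using inD s tT by auto
    have p: "(x, t) \<in> tri x s" "(x - h, t + h) \<in> tri x s" "(x - h + h, t + h + h) \<in> tri x s"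
      using h tT by (auto simp: tri_def)
    have ks: "\<And>y. \<bar>y - x\<bar> \<le> s \<Longrightarrow> A y \<le> \<kappa>" "\<And>y. \<bar>y - x\<bar> \<le> s \<Longrightarrow> B y \<le> \<kappa>"
      using \<kappa>' s(2) by blast+
    have "\<bar>psi (x - h) (t + h) - psi x t\<bar> \<le> C * h"
      using psi_null_lines(1)[OF xs ks p(1) h(1) p(2)] Cs[OF h(1) s(2)] by linarith
    moreover have "\<bar>psi (x - h + h) (t + h + h) - psi (x - h) (t + h)\<bar> \<le> C * h"
      using psi_null_lines(2)[OF xs ks p(2) h(1) p(3)] Cs[OF h(1) s(2)] by linarith
    ultimately have "psi x t - 2 * (C * h) \<le> psi x s" using h by simp
    moreover have "2 * (C * h) = C * (s - t)" by (simp add: h_def)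
    moreover have "C * (s - t) \<le> C * (T x - t)" using C0 s by (intro mult_left_mono) auto
    ultimately show ?thesis by (simp add: \<eta>_def)
  qed
  \<comment> \<open>A point beside the axis is joined to it by a single null segment, upwards in
    time.\<close>
  have side: "psi x (s + \<bar>y - x\<bar>) - C * \<bar>y - x\<bar> \<le> psi y s" if s: "0 \<le> s" "s + \<bar>y - x\<bar> < T x" for y s
  proof -
    define h where "h = \<bar>y - x\<bar>"
    have h: "0 \<le> h" by (simp add: h_def)
    have xs: "(x, s + h) \<in> D" using inD s h by (simp add: h_def)
    have sT: "s + h < T x" using s by (simp add: h_def)
    have p: "(y, s) \<in> tri x (s + h)" "(x, s + h) \<in> tri x (s + h)" using s by (auto simp: tri_def h_def)
    have ks: "\<And>y. \<bar>y - x\<bar> \<le> s + h \<Longrightarrow> A y \<le> \<kappa>" "\<And>y. \<bar>y - x\<bar> \<le> s + h \<Longrightarrow> B y \<le> \<kappa>"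
      using \<kappa>' sT by blast+
    have "\<bar>psi x (s + h) - psi y s\<bar> \<le> C * h"
    proof (cases "x \<le> y")
      case True
      then have "x = y - h" by (simp add: h_def)
      then show ?thesis
        using psi_null_lines(1)[OF xs ks p(1) h] p(2) Cs[OF h sT] by auto
    next
      case False
      then have "x = y + h" by (simp add: h_def)
      then show ?thesis
        using psi_null_lines(2)[OF xs ks p(1) h] p(2) Cs[OF h sT] by auto
    qed
    then show ?thesis by (simp add: h_def)
  qed
  \<comment> \<open>The first bound leaves \<open>\<eta> / 2\<close> after the sideways step; the
    second ensures that the axis is met no earlier than at time \<open>t\<close>.\<close>
  define \<delta> where "\<delta> = min (\<eta> / (2 * C)) (T x - t)"
  have \<delta>: "\<delta> > 0" "C * \<delta> \<le> \<eta> / 2" "\<delta> \<le> T x - t"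
  proof -
    show "\<delta> > 0" using \<eta>0 C0 tT by (simp add: \<delta>_def \<eta>_def)
    have "C * \<delta> \<le> C * (\<eta> / (2 * C))" using C0 by (intro mult_left_mono) (auto simp: \<delta>_def)
    then show "C * \<delta> \<le> \<eta> / 2" using C0 by simp
  qed (simp add: \<delta>_def)
  obtain \<delta>0 where \<delta>0: "0 < \<delta>0" "\<delta>0 < 1" "cone x (T x) \<delta>0 \<subseteq> D" using nc by (auto simp: non_characteristic_def)
  \<comment> \<open>Cutting off the tip leaves a compact set. Since \<open>\<delta>0 < 1\<close>,
    the cone of the non-characteristic point contains it, including its points on the sides of the
    light cone.\<close>
  define K where "K = tri x (T x) \<inter> {p. snd p \<le> T x - \<delta>}"
  have "compact K" unfolding K_def
    by (intro compact_Int_closed compact_triangle closed_Collect_le continuous_intros)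
  moreover have KD: "K \<subseteq> D"
  proof
    fix p assume "p \<in> K"
    then obtain y s where p: "p = (y, s)" "0 \<le> s" "\<bar>y - x\<bar> \<le> T x - s" "s \<le> T x - \<delta>"
      by (auto simp: K_def tri_def)
    have "\<delta>0 * \<bar>y - x\<bar> \<le> 1 * \<bar>y - x\<bar>" using \<delta>0 by (intro mult_right_mono) auto
    then have "(y, s) \<in> cone x (T x) \<delta>0" using p \<delta>(1) unfolding cone_def by auto
    then show "p \<in> D" using \<delta>0 p by auto
  qed
  ultimately have "bounded ((\<lambda>(x, t). u x t) ` K)"
    by (intro compact_imp_bounded compact_continuous_image continuous_on_subset[OF continuous_on_D])
  then obtain b where b: "\<And>y s. (y, s) \<in> K \<Longrightarrow> u y s \<le> b"
    by (force simp: bounded_iff abs_le_iff)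
  show False
  proof (rule unbounded_below_tip[OF W xt])
    fix y s assume s: "0 \<le> s" "\<bar>y - x\<bar> < T x - s"
    \<comment> \<open>\<open>2 * \<kappa>\<close> bounds the two free waves, and
      \<open>N = - 2 * ln \<psi>\<close> is bounded by \<open>- 2 * ln (\<eta> / 2)\<close>.\<close>
    show "u y s \<le> max b (2 * \<kappa> - 2 * ln (\<eta> / 2))"
    proof (cases "s \<le> T x - \<delta>")
      case True
      then have "(y, s) \<in> K" using s by (auto simp: K_def tri_def)
      then show ?thesis using b by (simp add: le_max_iff_disj)
    next
      case False
      then have yd: "\<bar>y - x\<bar> < \<delta>" "t \<le> s + \<bar>y - x\<bar>" using s \<delta>(3) by auto
      have "C * \<bar>y - x\<bar> \<le> C * \<delta>" using C0 yd by (intro mult_left_mono) auto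
      moreover have "\<eta> \<le> psi x (s + \<bar>y - x\<bar>)" using yd s by (intro axis) auto
      moreover have "psi x (s + \<bar>y - x\<bar>) - C * \<bar>y - x\<bar> \<le> psi y s" using s by (intro side) auto
      ultimately have "\<eta> / 2 \<le> psi y s" using \<delta>(2) by linarith
      then have "ln (\<eta> / 2) \<le> ln (psi y s)" using \<eta>0 by (intro ln_mono) (auto simp: \<eta>_def)
      then have "duh (\<lambda>z \<tau>. exp (u z \<tau>)) y s / 2 \<le> - 2 * ln (\<eta> / 2)" by (simp add: psi_def)
      moreover have "(y, s) \<in> D" by (rule domain_cone[OF xt s])
      then have "u y s = A (y + s) + B (y - s) + duh (\<lambda>z \<tau>. exp (u z \<tau>)) y s / 2" by (rule duhamel_D)
      moreover have "\<bar>A (y + s)\<bar> \<le> \<kappa>" "\<bar>B (y - s)\<bar> \<le> \<kappa>" using s by (auto intro!: \<kappa>)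
      ultimately show ?thesis by linarith
    qed
  qed
qed

text \<open>A graph point over \<open>y\<close> is either at horizontal distance at least
  \<open>(T x - t) / 2\<close>, or \<open>T y \<ge> T x - \<bar>y - x\<bar>\<close> puts it at least
  that far above \<open>t\<close>.\<close>

lemma infdist_graph_ge:
  assumes "(x, t) \<in> D" shows "(T x - t) / 2 \<le> infdist (x, t) (blowup_graph u0 u1)"
proof -
  have t: "0 \<le> t" "t < T x" using less_T[OF assms] D_nonneg[OF assms] by auto
  have "(T x - t) / 2 \<le> dist (x, t) (y, T y)" for y
  proof (cases "\<bar>y - x\<bar> < (T x - t) / 2")
    case False
    have "\<bar>x - y\<bar> \<le> dist (x, t) (y, T y)"
      using dist_fst_le[of "(x, t)" "(y, T y)"] by (simp add: dist_real_def)
    then show ?thesis using False by (simp add: abs_minus_commute)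
  next
    case True
    define s where "s = T x - \<bar>y - x\<bar>"
    have "s \<le> T y"
    proof (rule dense_le_bounded)
      show "(t + T x) / 2 < s" using True by (simp add: s_def field_simps)
      fix r assume "(t + T x) / 2 < r" "r < s"
      then have "(y, r) \<in> D" using t by (intro domain_cone[OF assms]) (auto simp: s_def)
      then show "r \<le> T y" by (rule less_imp_le[OF less_T])
    qed
    moreover have "T y - t \<le> dist (x, t) (y, T y)"
      using dist_snd_le[of "(x, t)" "(y, T y)"] by (simp add: dist_real_def abs_le_iff)
    moreover have "(T x - t) / 2 < s - t" using True by (simp add: s_def field_simps)
    ultimately show ?thesis by linarith
  qed
  then have le: "(T x - t) / 2 \<le> dist (x, t) p" if "p \<in> blowup_graph u0 u1" for p
    using that by (auto simp: blowup_graph_def)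
  have "blowup_graph u0 u1 \<noteq> {}" by (auto simp: blowup_graph_def)
  then show ?thesis
    using cINF_greatest[OF _ le] by (simp add: infdist_def)
qed

text \<open>\<open>exp u * \<psi>^2\<close> is the exponential of the free wave and thus bounded
  below on bounded sets. An upper bound of \<psi> by a multiple of the distance is therefore a lower
  bound of \<open>exp u\<close> times the squared distance.\<close>

lemma lower_bound:
  assumes W: "W1_inf u0" "L_inf u1" and R: "R > 0"
  shows "\<exists>C>0. \<forall>(x, t) \<in> D \<inter> closure (D_R R). non_characteristic u0 u1 x \<longrightarrow>
    exp (u x t) * (infdist (x, t) (blowup_graph u0 u1))\<^sup>2 \<ge> 1 / C"
proof -
  obtain K where K: "K \<ge> 0" "\<And>x t. (x, t) \<in> D \<Longrightarrow> T x \<le> K + \<bar>x\<bar>"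
    by (rule T_bounded) (rule that)
  obtain \<kappa> where \<kappa>: "\<kappa> \<ge> 0" "\<And>y. \<bar>y\<bar> \<le> K + 2 * R \<Longrightarrow> \<bar>A y\<bar> \<le> \<kappa>" "\<And>y. \<bar>y\<bar> \<le> K + 2 * R \<Longrightarrow> \<bar>B y\<bar> \<le> \<kappa>"
    by (rule free_wave_bounded[of "K + 2 * R"]) (rule that)
  \<comment> \<open>The Lipschitz constant of \<open>psi_vanishes\<close> with \<open>T x\<close>
    replaced by its bound \<open>K + R\<close>.\<close>
  define c where "c = exp (2 * \<kappa>) * (K + R) / 2"
  have c: "c > 0" using K(1) R by (simp add: c_def)
  have "1 / (4 * c\<^sup>2 * exp (2 * \<kappa>)) \<le> exp (u x t) * (infdist (x, t) (blowup_graph u0 u1))\<^sup>2"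
    if xt: "(x, t) \<in> D" "(x, t) \<in> closure (D_R R)" and nc: "non_characteristic u0 u1 x" for x t
  proof -
    have "closed {p :: real \<times> real. \<bar>fst p\<bar> \<le> R - snd p}"
      by (intro closed_Collect_le continuous_intros)
    then have "closure (D_R R) \<subseteq> {p. \<bar>fst p\<bar> \<le> R - snd p}"
      by (intro closure_minimal) (auto simp: D_R_def)
    then have xR: "\<bar>x\<bar> \<le> R" using xt(2) D_nonneg[OF xt(1)] by auto
    have tT: "0 \<le> t" "t < T x" using less_T[OF xt(1)] D_nonneg[OF xt(1)] by auto
    have TK: "T x \<le> K + R" using K(2)[OF xt(1)] xR by linarith
    have le: "\<bar>y\<bar> \<le> K + 2 * R" if "\<bar>y - x\<bar> \<le> T x" for y using that xR TK by linarith
    have "psi x t \<le> exp (2 * \<kappa>) * T x / 2 * (T x - t)"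
      by (rule psi_vanishes[OF W xt(1) nc]) (use \<kappa> le in auto)
    also have "\<dots> \<le> c * (T x - t)"
      unfolding c_def using tT TK by (intro mult_right_mono divide_right_mono mult_left_mono) auto
    finally have p: "psi x t \<le> c * (T x - t)" .
    have p0: "0 < psi x t" by (simp add: psi_def)
    have "u x t = A (x + t) + B (x - t) + duh (\<lambda>z \<tau>. exp (u z \<tau>)) x t / 2" by (rule duhamel_D[OF xt(1)])
    moreover have "\<bar>A (x + t)\<bar> \<le> \<kappa>" "\<bar>B (x - t)\<bar> \<le> \<kappa>" using tT by (auto intro!: \<kappa> le)
    ultimately have "- (2 * \<kappa>) + duh (\<lambda>z \<tau>. exp (u z \<tau>)) x t / 2 \<le> u x t" by linarith
    then have "exp (- (2 * \<kappa>)) * exp (duh (\<lambda>z \<tau>. exp (u z \<tau>)) x t / 2) \<le> exp (u x t)"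
      by (simp add: exp_add[symmetric])
    moreover have "exp (duh (\<lambda>z \<tau>. exp (u z \<tau>)) x t / 2) * (psi x t)\<^sup>2 = 1"
      by (simp add: psi_def exp_double[symmetric] exp_add[symmetric])
    ultimately have u: "exp (- (2 * \<kappa>)) \<le> exp (u x t) * (psi x t)\<^sup>2"
      using mult_right_mono[of "exp (- (2 * \<kappa>)) * exp (duh (\<lambda>z \<tau>. exp (u z \<tau>)) x t / 2)" "exp (u x t)" "(psi x t)\<^sup>2"]
      by (simp add: mult.assoc)
    have "psi x t \<le> 2 * c * infdist (x, t) (blowup_graph u0 u1)"
    proof -
      have "c * ((T x - t) / 2) \<le> c * infdist (x, t) (blowup_graph u0 u1)"
        using c infdist_graph_ge[OF xt(1)] by (intro mult_left_mono) auto
      then show ?thesis using p by simp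
    qed
    then have "(psi x t)\<^sup>2 \<le> (2 * c * infdist (x, t) (blowup_graph u0 u1))\<^sup>2"
      using p0 by (intro power_mono) auto
    then have "exp (u x t) * (psi x t)\<^sup>2 \<le> exp (u x t) * (2 * c * infdist (x, t) (blowup_graph u0 u1))\<^sup>2"
      by (intro mult_left_mono) auto
    moreover have "exp (u x t) * (2 * c * infdist (x, t) (blowup_graph u0 u1))\<^sup>2
        = 4 * c\<^sup>2 * (exp (u x t) * (infdist (x, t) (blowup_graph u0 u1))\<^sup>2)"
      by (simp add: power_mult_distrib)
    ultimately have "exp (- (2 * \<kappa>)) \<le> 4 * c\<^sup>2 * (exp (u x t) * (infdist (x, t) (blowup_graph u0 u1))\<^sup>2)"
      using u by linarith
    then show ?thesis using c by (simp add: exp_minus field_simps)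
  qed
  then show ?thesis
    using c by (intro exI[of _ "4 * c\<^sup>2 * exp (2 * \<kappa>)"]) auto
qed

end

theorem proposition4p6:
  fixes u0 u1 :: "real \<Rightarrow> real" and u :: "real \<Rightarrow> real \<Rightarrow> real" and R :: real
  assumes "H1_locu u0" and "continuous_on UNIV u0" and "L2_locu u1"
    and "blowup_solution u0 u1 u"
    and "R > 0"
  shows "\<exists>C>0.
    (\<forall>(x, t) \<in> max_domain u0 u1 \<inter> D_R R.
       exp (u x t) * (infdist (x, t) (blowup_graph u0 u1))\<^sup>2 \<le> C) \<and>
    (W1_inf u0 \<and> L_inf u1 \<longrightarrow>
       (\<forall>(x, t) \<in> max_domain u0 u1 \<inter> closure (D_R R).
          non_characteristic u0 u1 x \<longrightarrow>
          exp (u x t) * (infdist (x, t) (blowup_graph u0 u1))\<^sup>2 \<ge> 1 / C))"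
proof -
  interpret blowup u0 u1 u by unfold_locales (use assms in auto)
  obtain C1 where C1: "C1 > 0" "\<And>x t. (x, t) \<in> D \<inter> D_R R \<Longrightarrow> exp (u x t) * (infdist (x, t) (blowup_graph u0 u1))\<^sup>2 \<le> C1"
    using upper_bound[of R] by auto
  show ?thesis
  proof (cases "W1_inf u0 \<and> L_inf u1")
    case False
    then show ?thesis using C1 by (intro exI[of _ C1]) auto
  next
    case True
    then obtain C2 where C2: "C2 > 0" "\<And>x t. (x, t) \<in> D \<inter> closure (D_R R) \<Longrightarrow> non_characteristic u0 u1 x \<Longrightarrow>
        1 / C2 \<le> exp (u x t) * (infdist (x, t) (blowup_graph u0 u1))\<^sup>2"
      using lower_bound[of R] assms(5) by auto
    \<comment> \<open>Both inequalities weaken as the constant grows, so the maximum serves for the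
      two of them.\<close>
    define C where "C = max C1 C2"
    have "1 / C \<le> 1 / C2" using C2(1) unfolding C_def by (intro divide_left_mono) auto
    then have "1 / C \<le> exp (u x t) * (infdist (x, t) (blowup_graph u0 u1))\<^sup>2"
      if "(x, t) \<in> D \<inter> closure (D_R R)" "non_characteristic u0 u1 x" for x t
      using C2(2)[OF that] by linarith
    moreover have "exp (u x t) * (infdist (x, t) (blowup_graph u0 u1))\<^sup>2 \<le> C" if "(x, t) \<in> D \<inter> D_R R" for x t
      using C1(2)[OF that] by (simp add: C_def)
    moreover have "C > 0" using C1(1) by (simp add: C_def)
    ultimately show ?thesis by (intro exI[of _ C]) blast
  qed
qed

end
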